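(* For every $D>1$, $\mathfrak{d}>0$, $\beta\in[0,1)$ and $\epsilon\in(0,1)$ there exists $p=p(D,\beta,\epsilon)\ge 1$ such that the following holds. Let $\sigma$ be a $(D,\beta)$-uniformly perfect Borel probability measure on $\mathbb{R}^2$ with $\operatorname{spt}\sigma\subset\mathbb{P}$ and $\operatorname{diam}(\operatorname{spt}\sigma)\ge\mathfrak{d}$. Then $$\|\hat\sigma\|_{L^p(B(R))}^p\le C\,R^{\epsilon}\qquad\text{for all } R\ge 1,$$ where $C$ depends only on $D,\mathfrak{d},\beta,\epsilon$ (and $\varphi$), and $B(R)$ is the open ball of radius $R$ centred at $0\in\mathbb{R}^2$.
   Context: Fix $\varphi\in C^2(\mathbb{R})$ with $\varphi''(x)>0$ for all $x\in[-2,2]$, and let $\mathbb{P}:=\{(x,\varphi(x)):x\in[-1,1]\}\subset\mathbb{R}^2$. All implicit constants may depend on $\varphi$. Definition (uniformly perfect): Let $D>1$, $\beta\in[0,1)$, $U\subset\mathbb{R}^d$. A Radon measure $\sigma$ on $\mathbb{R}^d$ is $(D,\beta,U)$-uniformly perfect if $\operatorname{diam}(\operatorname{spt}\sigma)>0$ and $\sigma(B(x,r))\le\beta\,\sigma(B(x,Dr))$ for every open ball $B(x,r)$ with $\operatorname{spt}\sigma\not\subset B(x,Dr)$ and $B(x,Dr)\subset U$. "$(D,\beta)$-uniformly perfect" means $(D,\beta,\mathbb{R}^d)$-uniformly perfect. *)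

theory Defs
  imports "HOL-Probability.Probability"
begin

definition curveP :: "(real \<Rightarrow> real) \<Rightarrow> (real \<times> real) set" where
  "curveP \<phi> = {(x, \<phi> x) | x. x \<in> {-1..1}}"

definition spt :: "'a::metric_space measure \<Rightarrow> 'a set" where
  "spt \<sigma> = {x. \<forall>r>0. emeasure \<sigma> (ball x r) \<noteq> 0}"

definition uniformly_perfect_on ::
  "real \<Rightarrow> real \<Rightarrow> 'a::metric_space set \<Rightarrow> 'a measure \<Rightarrow> bool" where
  "uniformly_perfect_on D \<beta> U \<sigma> \<longleftrightarrow>
     diameter (spt \<sigma>) > 0 \<and>
     (\<forall>x r. r > 0 \<longrightarrow> \<not> spt \<sigma> \<subseteq> ball x (D * r) \<longrightarrow> ball x (D * r) \<subseteq> U \<longrightarrow>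
        emeasure \<sigma> (ball x r) \<le> ennreal \<beta> * emeasure \<sigma> (ball x (D * r)))"

abbreviation uniformly_perfect :: "real \<Rightarrow> real \<Rightarrow> 'a::metric_space measure \<Rightarrow> bool" where
  "uniformly_perfect D \<beta> \<sigma> \<equiv> uniformly_perfect_on D \<beta> UNIV \<sigma>"

definition fourier_meas :: "(real \<times> real) measure \<Rightarrow> real \<times> real \<Rightarrow> complex" where
  "fourier_meas \<sigma> \<xi> = (LINT x|\<sigma>. cis (- 2 * pi * (x \<bullet> \<xi>)))"

end

theory Submission
  imports Defs
begin

text \<open>
  Let \<open>\<mu>\<close> be the projection of \<open>\<sigma>\<close> to the first axis. Cells of length \<open>r\<close> are split into \<open>b\<close> children, and a
  normalised piece of the measure is tested against the supremum of its oscillatory integrals over all densities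
  that are bounded by 1 and Lipschitz at scale \<open>r\<close>. This supremum absorbs modulations, so it passes from a cell to
  its children with constant exactly 1, uniformly over a frequency box of side about \<open>b / r\<close>, and no constant is
  raised to the (huge) power \<open>p\<close>. For two cells over transversal arcs, uniform perfectness forces phase
  cancellation, hence (for large \<open>p\<close>) an arbitrarily large gain, outside a single frequency
  parallelogram of side about \<open>g / r\<close>, where \<open>g\<close> is a small power of \<open>b\<close>. Iterating from scale 1 down to \<open>1 / R\<close>
  loses only a small power of \<open>R\<close>. The measure need not be doubling, and a cell whose mass clings to its endpoints shows no
  cancellation; weighting each cell by a power of the ratio of the masses of its triple and of itself compensates
  for this. Finally, \<open>\<sigma>\<close> is cut into arcs of length about a small negative power of \<open>R\<close>: pairs of far arcs are
  transversal, and pairs of near arcs have small total mass.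
\<close>

section \<open>Elementary inequalities\<close>

text \<open>The order in which the parameters are chosen shapes the proof. Where there is
  cancellation, one scale step gains only a factor \<open>1 - \<eta>\<close> with
  \<open>\<eta>\<close> proportional to \<open>1 / b\<close>, so a gain of
  \<open>b powr (- 2)\<close> forces \<open>p\<close> to be at least of order
  \<open>b * ln b\<close>. A constant above 1 inside the \<open>p\<close>-th power would thus cost
  far more than any power of \<open>b\<close>. Constants are tolerable only with the exponent
  \<open>C\<close>, which is fixed before \<open>b\<close>; then \<open>b\<close> is taken so large
  that these constants are below \<open>b powr e\<close>, and \<open>p\<close> comes last. Two arcs
  are needed because a single arc sees a frequency only through one linear form, the slope of its
  phase. The frequencies without cancellation would then fill a strip, a fraction of order
  \<open>g / b\<close> of the frequency box instead of \<open>(g / b)\<^sup>2\<close>. The lower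
  bound on the diameter enters only through the largest scale \<open>d / 4\<close> at which mass
  growth is available. It therefore affects the final constant but not \<open>p\<close>.\<close>

lemma powr_mean_le:
  fixes w z :: "'i \<Rightarrow> real"
  assumes "finite I" "\<And>i. i \<in> I \<Longrightarrow> 0 \<le> w i" "\<And>i. i \<in> I \<Longrightarrow> 0 \<le> z i" "sum w I = 1" "1 \<le> p"
  shows "(\<Sum>i\<in>I. w i * z i) powr p \<le> (\<Sum>i\<in>I. w i * z i powr p)"
proof -
  have "I \<noteq> {}" using assms by auto
  have "convex_on {0..} (\<lambda>x::real. x powr p)"
  proof (intro convex_onI)
    fix t x y :: real
    assume t: "0 < t" "t < 1" and xy: "x \<in> {0..}" "y \<in> {0..}"
    \<comment> \<open>Covers convex combinations with an endpoint at 0: there the claim reduces to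
      this inequality for the weight of the other point.\<close>
    have shrink: "c powr p \<le> c" if "0 < c" "c < 1" for c
      using that \<open>1 \<le> p\<close> powr_mono'[of 1 p c] by simp
    consider "x = 0" | "y = 0" | "x > 0" "y > 0" using xy by force
    then show "((1 - t) *\<^sub>R x + t *\<^sub>R y) powr p \<le> (1 - t) * x powr p + t * y powr p"
    proof cases
      case 1
      then show ?thesis using t xy shrink[of t] by (simp add: powr_mult mult_right_mono)
    next
      case 2
      then show ?thesis using t xy shrink[of "1 - t"] by (simp add: powr_mult mult_right_mono)
    next
      case 3
      then show ?thesis using convex_onD[OF powr_convex[OF \<open>1 \<le> p\<close>], of t x y] t by simp
    qed
  qed simp
  then show ?thesis
    using convex_on_sum[OF \<open>finite I\<close> \<open>I \<noteq> {}\<close>, of "{0..}" "\<lambda>x. x powr p" w z] assms by simp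
qed

text \<open>Jensen's inequality for the tilted weights proportional to
  \<open>W i * y i powr x\<close>, where \<open>x = C / (p - 1)\<close>, applied to
  \<open>z i * y i powr (- x)\<close>. The exponent \<open>x\<close> is tuned so that the
  normalisation \<open>S powr (p - 1)\<close> becomes, by a second use of Jensen
  (\<open>1 / x \<ge> 1\<close>), the mean of \<open>y\<close> to the power \<open>C\<close>.
  Inserting the weights \<open>y\<close> thus costs a power \<open>C\<close>, however large
  \<open>p\<close> is.\<close>

lemma weighted_Hoelder:
  fixes W y z :: "'i \<Rightarrow> real"
  assumes I: "finite I" and W: "\<And>i. i \<in> I \<Longrightarrow> 0 \<le> W i" "sum W I = 1"
    and y: "\<And>i. i \<in> I \<Longrightarrow> 0 < y i" and z: "\<And>i. i \<in> I \<Longrightarrow> 0 \<le> z i"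
    and p: "0 < C" "C + 1 \<le> p"
  shows "(\<Sum>i\<in>I. W i * z i) powr p
     \<le> (\<Sum>i\<in>I. W i * y i) powr C * (\<Sum>i\<in>I. W i * y i powr (- C) * z i powr p)"
proof -
  define x where "x = C / (p - 1)"
  have x: "0 < x" "x \<le> 1" "x * (p - 1) = C" using p by (auto simp: x_def)
  define S where "S = (\<Sum>i\<in>I. W i * y i powr x)"
  obtain j where j: "j \<in> I" "W j > 0"
    using W sum_nonpos[of I W] by (metis not_le zero_less_one)
  have S: "S > 0" unfolding S_def
    using j y[OF j(1)] W by (intro sum_pos2[OF I j(1)]) (auto intro!: mult_pos_pos)
  define V where "V i = W i * y i powr x / S" for i
  have V: "\<And>i. i \<in> I \<Longrightarrow> 0 \<le> V i" "sum V I = 1"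
    using S W by (auto simp: V_def S_def sum_divide_distrib[symmetric])
  have "(\<Sum>i\<in>I. V i * (z i * y i powr (-x))) powr p \<le> (\<Sum>i\<in>I. V i * (z i * y i powr (-x)) powr p)"
    using V p z by (intro powr_mean_le[OF I]) auto
  also have "(\<Sum>i\<in>I. V i * (z i * y i powr (-x))) = (\<Sum>i\<in>I. W i * z i) / S"
    unfolding sum_divide_distrib
  proof (intro sum.cong refl)
    fix i assume i: "i \<in> I"
    have "y i powr x * y i powr (-x) = 1" using y[OF i] by (simp add: powr_add[symmetric])
    then show "V i * (z i * y i powr - x) = W i * z i / S" by (simp add: V_def field_simps)
  qed
  also have "(\<Sum>i\<in>I. V i * (z i * y i powr (-x)) powr p)
     = (\<Sum>i\<in>I. W i * y i powr (- C) * z i powr p) / S"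
    unfolding sum_divide_distrib
  proof (intro sum.cong refl)
    fix i assume i: "i \<in> I"
    have "y i powr x * (y i powr (-x)) powr p = y i powr (-C)"
      using y[OF i] x(3) by (simp add: powr_powr powr_add[symmetric] algebra_simps)
    then show "V i * (z i * y i powr - x) powr p = W i * y i powr (- C) * z i powr p / S"
      using y[OF i] z[OF i] by (simp add: V_def powr_mult algebra_simps)
  qed
  finally have 1: "((\<Sum>i\<in>I. W i * z i) / S) powr p \<le> (\<Sum>i\<in>I. W i * y i powr (- C) * z i powr p) / S" .
  have n: "0 \<le> (\<Sum>i\<in>I. W i * z i)" using W z by (auto intro!: sum_nonneg)
  have n2: "0 \<le> (\<Sum>i\<in>I. W i * y i powr (- C) * z i powr p)" using W z by (auto intro!: sum_nonneg)
  have "(\<Sum>i\<in>I. W i * z i) powr p = S powr p * ((\<Sum>i\<in>I. W i * z i) / S) powr p"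
    using S n by (simp add: powr_divide)
  also have "\<dots> \<le> S powr p * ((\<Sum>i\<in>I. W i * y i powr (- C) * z i powr p) / S)"
    using 1 by (intro mult_left_mono) auto
  also have "\<dots> = S powr (p - 1) * (\<Sum>i\<in>I. W i * y i powr (- C) * z i powr p)"
    using S by (simp add: powr_diff)
  finally have 2: "(\<Sum>i\<in>I. W i * z i) powr p \<le> S powr (p - 1) * (\<Sum>i\<in>I. W i * y i powr (- C) * z i powr p)" .
  have "S powr (1 / x) \<le> (\<Sum>i\<in>I. W i * (y i powr x) powr (1 / x))"
    unfolding S_def using W x by (intro powr_mean_le[OF I]) auto
  also have "\<dots> = (\<Sum>i\<in>I. W i * y i)"
    using x less_imp_le[OF y] by (intro sum.cong) (simp_all add: powr_powr)
  finally have "(S powr (1 / x)) powr C \<le> (\<Sum>i\<in>I. W i * y i) powr C"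
    using p by (intro powr_mono2) auto
  moreover have "(S powr (1 / x)) powr C = S powr (p - 1)"
  proof -
    have "1 / x * C = p - 1" using x by (simp add: field_simps)
    then show ?thesis by (simp only: powr_powr)
  qed
  ultimately have "S powr (p - 1) \<le> (\<Sum>i\<in>I. W i * y i) powr C" by simp
  then show ?thesis using 2 n2 by (meson mult_right_mono order_trans)
qed

text \<open>Stability of Cauchy-Schwarz: a mean close to the quadratic mean \<open>J\<close> forces
  the terms to be nearly constant, so \<open>G\<close> contributes about its share of weight to the
  sum, and giving up the fraction \<open>k\<close> of that contribution is affordable only if
  \<open>G\<close> is light. Comparison with the arithmetic mean would say nothing, since the terms
  of \<open>G\<close> might vanish; hence the quadratic means in the sequel.\<close>

lemma weight_of_deficient_terms:
  fixes w s :: "'i \<Rightarrow> real"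
  assumes I: "finite I" "G \<subseteq> I" and w: "\<And>i. i \<in> I \<Longrightarrow> 0 \<le> w i" "sum w I = 1"
    and s: "\<And>i. i \<in> I \<Longrightarrow> 0 \<le> s i"
    and J: "J = sqrt (\<Sum>i\<in>I. w i * (s i)\<^sup>2)" "0 < J" and k: "0 < k" "0 \<le> \<eta>"
    and le: "(1 - \<eta>) * J \<le> (\<Sum>i\<in>I. w i * s i) - k * (\<Sum>i\<in>G. w i * s i)"
  shows "sum w G \<le> 2 * \<eta> * (1 + 1 / k)"
proof -
  have CS: "(\<Sum>i\<in>H. w i * s i) \<le> sqrt (sum w H) * J" if H: "H \<subseteq> I" for H
  proof -
    have "(\<Sum>i\<in>H. sqrt (w i) * (sqrt (w i) * s i))\<^sup>2
       \<le> (\<Sum>i\<in>H. (sqrt (w i))\<^sup>2) * (\<Sum>i\<in>H. (sqrt (w i) * s i)\<^sup>2)"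
      by (rule Cauchy_Schwarz_ineq_sum)
    also have "(\<Sum>i\<in>H. sqrt (w i) * (sqrt (w i) * s i)) = (\<Sum>i\<in>H. w i * s i)"
      using H w by (intro sum.cong) (auto simp: mult.assoc[symmetric])
    also have "(\<Sum>i\<in>H. (sqrt (w i))\<^sup>2) = sum w H" using H w by (intro sum.cong) auto
    also have "(\<Sum>i\<in>H. (sqrt (w i) * s i)\<^sup>2) = (\<Sum>i\<in>H. w i * (s i)\<^sup>2)"
      using H w by (intro sum.cong) (auto simp: power_mult_distrib)
    finally have "(\<Sum>i\<in>H. w i * s i)\<^sup>2 \<le> sum w H * (\<Sum>i\<in>H. w i * (s i)\<^sup>2)" .
    also have "\<dots> \<le> sum w H * (\<Sum>i\<in>I. w i * (s i)\<^sup>2)"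
      using H w I by (intro mult_left_mono sum_mono2 sum_nonneg) auto
    finally have "(\<Sum>i\<in>H. w i * s i) \<le> sqrt (sum w H * (\<Sum>i\<in>I. w i * (s i)\<^sup>2))"
      by (rule real_le_rsqrt)
    then show ?thesis by (simp add: J real_sqrt_mult)
  qed
  let ?g = "sum w G"
  have g: "0 \<le> ?g" "?g \<le> 1" using w I sum_mono2[of I G w] by (auto intro!: sum_nonneg)
  have split: "(\<Sum>i\<in>I. w i * s i) = (\<Sum>i\<in>G. w i * s i) + (\<Sum>i\<in>I - G. w i * s i)"
    using I by (simp add: sum.subset_diff)
  have all: "(\<Sum>i\<in>I. w i * s i) \<le> J" using CS[of I] w by simp
  have "sum w (I - G) = 1 - ?g" using I w by (simp add: sum_diff)
  then have "(\<Sum>i\<in>I - G. w i * s i) \<le> sqrt (1 - ?g) * J" using CS[of "I - G"] by auto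
  \<comment> \<open>Without \<open>G\<close> the sum reaches at most the fraction
    \<open>1 - ?g / 2\<close> of \<open>J\<close>; so \<open>G\<close> must contribute at least
    \<open>(?g / 2 - \<eta>) * J\<close>.\<close>
  also have "sqrt (1 - ?g) \<le> 1 - ?g / 2"
    using g by (intro real_le_lsqrt) (auto simp: power2_eq_square algebra_simps)
  finally have ub: "(\<Sum>i\<in>I - G. w i * s i) \<le> (1 - ?g / 2) * J" using J by simp
  have Gn: "0 \<le> (\<Sum>i\<in>G. w i * s i)" using w s I by (auto intro!: sum_nonneg)
  have kG: "k * (\<Sum>i\<in>G. w i * s i) \<le> \<eta> * J" using le all by (simp add: algebra_simps)
  have "(1 - \<eta>) * J \<le> (\<Sum>i\<in>I. w i * s i)" using le Gn k
    by (smt (verit) mult_nonneg_nonneg)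
  then have "(?g / 2 - \<eta>) * J \<le> (\<Sum>i\<in>G. w i * s i)" using ub split by (simp add: algebra_simps)
  then have "k * ((?g / 2 - \<eta>) * J) \<le> \<eta> * J" using kG k by (meson mult_left_mono less_imp_le order_trans)
  then have "(k * (?g / 2 - \<eta>)) * J \<le> \<eta> * J" by (simp add: mult.assoc)
  then have "k * (?g / 2 - \<eta>) \<le> \<eta>" using J by simp
  then show ?thesis using k by (simp add: field_simps)
qed

section \<open>Complex phases\<close>

lemma cmod_cis_diff_le: "cmod (cis a - cis b) \<le> \<bar>a - b\<bar>"
proof -
  have "cis a - cis b = cis b * (exp (\<i> * of_real (a - b)) - 1)"
    by (simp add: right_diff_distrib[of "cis b"] cis_conv_exp[symmetric, of "a - b", simplified] cis_mult)
  then have "cmod (cis a - cis b) = 2 * \<bar>sin ((a - b) / 2)\<bar>"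
    by (simp only: norm_mult norm_cis dist_exp_i_1)
  also have "\<dots> \<le> 2 * \<bar>(a - b) / 2\<bar>" by (intro mult_left_mono abs_sin_x_le_abs_x) auto
  finally show ?thesis by simp
qed

text \<open>On \<open>[0, pi / 4]\<close> the slope of the sine is at least
  \<open>sqrt 2 / 2\<close>, and \<open>pi * sqrt 2 \<ge> 3 * 1.4 > 4\<close>.\<close>

lemma cmod_cis_minus_one_ge:
  assumes "\<bar>a\<bar> \<le> 1 / 4" shows "4 * \<bar>a\<bar> \<le> cmod (cis (2 * pi * a) - 1)"
proof (cases "a = 0")
  case False
  let ?x = "pi * \<bar>a\<bar>"
  have x: "0 < ?x" "?x \<le> pi / 4" using assms False by auto
  obtain z where z: "0 < z" "z < ?x" "sin ?x - sin 0 = (?x - 0) * cos z"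
    using MVT2[OF x(1), of sin cos] by (metis DERIV_sin)
  have "sqrt 2 / 2 \<le> cos z"
    using cos_monotone_0_pi_le[of z "pi / 4"] z x pi_gt_zero by (simp add: cos_45)
  then have "?x * (sqrt 2 / 2) \<le> sin ?x" using x(1) z(3) mult_left_mono[of "sqrt 2 / 2" "cos z" ?x] by simp
  moreover have "4 * \<bar>a\<bar> \<le> 2 * (?x * (sqrt 2 / 2))"
  proof -
    have "1.4 \<le> sqrt (2::real)" by (rule real_le_rsqrt) (simp add: power2_eq_square)
    moreover have "3 \<le> pi" using pi_gt3 by simp
    ultimately have "3 * 1.4 \<le> pi * sqrt 2" by (intro mult_mono) auto
    then have "4 * \<bar>a\<bar> \<le> (pi * sqrt 2) * \<bar>a\<bar>" by (intro mult_right_mono) auto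
    then show ?thesis by (simp add: algebra_simps)
  qed
  moreover have "cmod (cis (2 * pi * a) - 1) = 2 * \<bar>sin (pi * a)\<bar>"
    using dist_exp_i_1[of "2 * pi * a"] by (simp add: cis_conv_exp)
  moreover have "sin ?x \<le> \<bar>sin (pi * a)\<bar>" by (cases "a \<ge> 0") (auto simp: abs_if)
  ultimately show ?thesis by linarith
qed auto

text \<open>Strict convexity of the unit disc: expanding the square of the modulus of
  \<open>H + H'\<close> shows that two points of the disc whose midpoint is close to the circle have
  \<open>Re (H * cnj H')\<close> close to 1. The product is used rather than the difference because,
  for modulated densities, it isolates the wave of the difference of the two frequencies.\<close>

lemma phase_rigidity:
  fixes H H' :: complex
  assumes H: "cmod H \<le> 1" "cmod H' \<le> 1" and k: "1 - k < cmod ((H + H') / 2)" "k \<le> 1"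
    and e: "8 * k \<le> e\<^sup>2" "0 \<le> e"
  shows "cmod (H * cnj H' - 1) \<le> e"
proof -
  let ?z = "H * cnj H'"
  have 1: "(cmod (H + H'))\<^sup>2 = (cmod H)\<^sup>2 + (cmod H')\<^sup>2 + 2 * Re ?z"
    by (simp add: cmod_power2) (simp add: power2_eq_square algebra_simps)
  have "2 * (1 - k) \<le> cmod (H + H')" using k by (simp add: norm_divide)
  then have "(2 * (1 - k))\<^sup>2 \<le> (cmod (H + H'))\<^sup>2" using k by (intro power_mono) auto
  moreover have "(cmod H)\<^sup>2 \<le> 1" "(cmod H')\<^sup>2 \<le> 1" using H by (auto simp: power_le_one)
  ultimately have "4 * (1 - k)\<^sup>2 \<le> 2 + 2 * Re ?z" using 1 unfolding power_mult_distrib by simp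
  moreover have "(1 - k)\<^sup>2 \<ge> 1 - 2 * k" by (simp add: power2_eq_square algebra_simps)
  ultimately have re: "Re ?z \<ge> 1 - 4 * k" by linarith
  have "cmod ?z \<le> 1" using H by (simp add: norm_mult mult_le_one)
  then have "(cmod ?z)\<^sup>2 \<le> 1" by (simp add: power_le_one)
  moreover have "(cmod (?z - 1))\<^sup>2 = (cmod ?z)\<^sup>2 + 1 - 2 * Re ?z"
    by (simp only: cmod_power2) (simp add: power2_eq_square algebra_simps)
  ultimately have "(cmod (?z - 1))\<^sup>2 \<le> e\<^sup>2" using re e by linarith
  then show ?thesis by (rule power2_le_imp_le) (rule e(2))
qed

section \<open>Oscillatory integrals over cells\<close>

text \<open>Half-open, so that the children partition a cell and masses add exactly, atoms
  included.\<close>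

definition cell :: "real \<Rightarrow> real \<Rightarrow> real set" where
  "cell a r = {a..<a + r}"

definition child :: "real \<Rightarrow> real \<Rightarrow> nat \<Rightarrow> nat \<Rightarrow> real set" where
  "child a r b i = cell (a + real i * (r / b)) (r / b)"

lemma cell_sets [measurable, simp]: "cell a r \<in> sets borel"
  by (simp add: cell_def)

lemma child_sets [measurable, simp]: "child a r b i \<in> sets borel"
  by (simp add: child_def)

lemma child_subset_cell:
  assumes "0 < r" "i < b" shows "child a r b i \<subseteq> cell a r"
proof
  fix x assume "x \<in> child a r b i"
  then have x: "a + real i * (r / b) \<le> x" "x < a + (real i + 1) * (r / b)"
    by (auto simp: child_def cell_def distrib_right add.assoc add_divide_distrib)
  have "(real i + 1) * (r / b) \<le> real b * (r / b)"
    using assms by (intro mult_right_mono) auto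
  moreover have "real b * (r / b) = r" "0 \<le> real i * (r / b)" using assms by auto
  ultimately show "x \<in> cell a r" using x unfolding cell_def atLeastLessThan_iff by linarith
qed

lemma mem_child_iff:
  assumes "0 < r" "0 < b"
  shows "x \<in> child a r b i \<longleftrightarrow> \<lfloor>(x - a) / (r / b)\<rfloor> = int i"
proof -
  have d: "0 < r / b" using assms by simp
  have "x \<in> child a r b i \<longleftrightarrow> real i * (r / b) \<le> x - a \<and> x - a < (real i + 1) * (r / b)"
    by (auto simp: child_def cell_def distrib_right add_divide_distrib)
  also have "\<dots> \<longleftrightarrow> real i \<le> (x - a) / (r / b) \<and> (x - a) / (r / b) < real i + 1"
    using d by (simp only: pos_le_divide_eq pos_divide_less_eq)
  also have "\<dots> \<longleftrightarrow> \<lfloor>(x - a) / (r / b)\<rfloor> = int i" by (auto simp: floor_eq_iff)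
  finally show ?thesis .
qed

lemma cell_eq_UN_child:
  assumes "0 < r" "0 < b" shows "cell a r = (\<Union>i<b. child a r b i)"
proof
  show "(\<Union>i<b. child a r b i) \<subseteq> cell a r" using assms child_subset_cell by blast
  show "cell a r \<subseteq> (\<Union>i<b. child a r b i)"
  proof
    fix x assume x: "x \<in> cell a r"
    let ?k = "\<lfloor>(x - a) / (r / b)\<rfloor>"
    have "0 \<le> (x - a) / (r / b)" using x assms by (auto simp: cell_def)
    then have k: "?k = int (nat ?k)" by simp
    have "(x - a) / (r / b) < b" using x assms mult_strict_right_mono[of x "a + r" "real b"]
      by (simp add: cell_def pos_divide_less_eq algebra_simps)
    then have "nat ?k < b" using k by linarith
    moreover have "x \<in> child a r b (nat ?k)" using assms k by (simp add: mem_child_iff)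
    ultimately show "x \<in> (\<Union>i<b. child a r b i)" by blast
  qed
qed

lemma disjoint_child:
  assumes "0 < r" "0 < b" shows "disjoint_family (child a r b)"
  using assms by (auto simp: disjoint_family_on_def mem_child_iff)

section \<open>Waves and modulated densities\<close>

definition phase :: "(real \<Rightarrow> real) \<Rightarrow> real \<times> real \<Rightarrow> real \<Rightarrow> real" where
  "phase \<phi> \<xi> x = x * fst \<xi> + \<phi> x * snd \<xi>"

text \<open>Both bounds are imposed on \<open>q\<close> only, while measurability is global:
  restriction to a child is then an inclusion of sets of densities (\<open>modulators_mono\<close>),
  and no function has to be cut off.\<close>

definition modulators :: "real set \<Rightarrow> real \<Rightarrow> (real \<Rightarrow> complex) set" where
  "modulators q L = {h \<in> borel_measurable borel. (\<forall>x\<in>q. cmod (h x) \<le> 1) \<and>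
     (\<forall>x\<in>q. \<forall>y\<in>q. cmod (h x - h y) \<le> L * \<bar>x - y\<bar>)}"

definition wave :: "(real \<Rightarrow> real) \<Rightarrow> real \<times> real \<Rightarrow> real \<Rightarrow> complex" where
  "wave \<phi> \<xi> x = cis (- 2 * pi * phase \<phi> \<xi> x)"

lemma norm_wave [simp]: "cmod (wave \<phi> \<xi> x) = 1"
  by (simp add: wave_def)

lemma wave_measurable [measurable]:
  "\<phi> \<in> borel_measurable borel \<Longrightarrow> wave \<phi> \<xi> \<in> borel_measurable borel"
  unfolding wave_def[abs_def] phase_def cis_conv_exp by simp

lemma phase_add: "phase \<phi> (\<xi> + \<zeta>) x = phase \<phi> \<xi> x + phase \<phi> \<zeta> x"
  by (simp add: phase_def algebra_simps)

lemma phase_diff: "phase \<phi> (\<xi> - \<zeta>) x = phase \<phi> \<xi> x - phase \<phi> \<zeta> x"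
  by (simp add: phase_def algebra_simps)

lemma wave_add: "wave \<phi> (\<xi> + \<zeta>) x = wave \<phi> \<zeta> x * wave \<phi> \<xi> x"
  by (simp add: wave_def phase_add cis_mult algebra_simps)

lemma cmod_wave_diff_le: "cmod (wave \<phi> \<xi> x - wave \<phi> \<eta> y) \<le> 2 * pi * \<bar>phase \<phi> \<xi> x - phase \<phi> \<eta> y\<bar>"
proof -
  have "cmod (wave \<phi> \<xi> x - wave \<phi> \<eta> y) \<le> \<bar>- 2 * pi * phase \<phi> \<xi> x - - 2 * pi * phase \<phi> \<eta> y\<bar>"
    unfolding wave_def by (rule cmod_cis_diff_le)
  also have "\<dots> = \<bar>(2 * pi) * (phase \<phi> \<eta> y - phase \<phi> \<xi> x)\<bar>"
    by (simp add: right_diff_distrib)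
  also have "\<dots> = 2 * pi * \<bar>phase \<phi> \<xi> x - phase \<phi> \<eta> y\<bar>"
    unfolding abs_mult by (simp add: abs_minus_commute)
  finally show ?thesis .
qed

lemma modulators_mono: "q' \<subseteq> q \<Longrightarrow> L \<le> L' \<Longrightarrow> modulators q L \<subseteq> modulators q' L'"
  by (auto simp: modulators_def)
     (metis (no_types, opaque_lifting) abs_ge_zero mult_right_mono order_trans subsetD)

lemma one_in_modulators: "0 \<le> L \<Longrightarrow> (\<lambda>_. 1) \<in> modulators q L"
  by (auto simp: modulators_def)

lemma const_mult_modulators: "h \<in> modulators q L \<Longrightarrow> cmod c = 1 \<Longrightarrow> (\<lambda>x. c * h x) \<in> modulators q L"
  by (auto simp: modulators_def norm_mult right_diff_distrib[symmetric])

lemma modulate_modulators: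
  assumes h: "h \<in> modulators q L" and \<phi>: "\<phi> \<in> borel_measurable borel"
    and lip: "\<And>x y. x \<in> q \<Longrightarrow> y \<in> q \<Longrightarrow> 2 * pi * \<bar>phase \<phi> \<zeta> x - phase \<phi> \<zeta> y\<bar> \<le> M * \<bar>x - y\<bar>"
  shows "(\<lambda>x. h x * wave \<phi> \<zeta> x) \<in> modulators q (L + M)"
proof -
  have [measurable]: "h \<in> borel_measurable borel" "\<phi> \<in> borel_measurable borel"
    using h \<phi> by (auto simp: modulators_def)
  have meas: "(\<lambda>x. h x * wave \<phi> \<zeta> x) \<in> borel_measurable borel"
    by measurable
  have "cmod (h x * wave \<phi> \<zeta> x - h y * wave \<phi> \<zeta> y) \<le> (L + M) * \<bar>x - y\<bar>"
    if xy: "x \<in> q" "y \<in> q" for x y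
  proof -
    let ?c = "\<lambda>x. wave \<phi> \<zeta> x"
    have "cmod (h x * ?c x - h y * ?c y) = cmod ((h x - h y) * ?c x + h y * (?c x - ?c y))"
      by (simp add: algebra_simps)
    also have "\<dots> \<le> cmod (h x - h y) + cmod (h y) * cmod (?c x - ?c y)"
      by (rule order_trans[OF norm_triangle_ineq]) (simp add: norm_mult)
    also have "\<dots> \<le> L * \<bar>x - y\<bar> + 1 * (M * \<bar>x - y\<bar>)"
    proof (intro add_mono mult_mono)
      show "cmod (?c x - ?c y) \<le> M * \<bar>x - y\<bar>"
        using cmod_wave_diff_le[of \<phi> \<zeta> x \<zeta> y] lip[OF xy] by linarith
    qed (use h xy in \<open>auto simp: modulators_def\<close>)
    finally show ?thesis by (simp add: algebra_simps)
  qed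
  then show ?thesis using h meas by (auto simp: modulators_def norm_mult)
qed

section \<open>Extremal oscillatory integrals of a finite measure\<close>

locale curve_measure = finite_measure \<mu> for \<mu> :: "real measure" +
  fixes \<phi> :: "real \<Rightarrow> real"
  assumes sets_\<mu> [simp, measurable_cong]: "sets \<mu> = sets borel"
    and \<phi>_cont: "continuous_on UNIV \<phi>"
begin

lemma \<phi>_meas [measurable]: "\<phi> \<in> borel_measurable borel"
  using \<phi>_cont by (rule borel_measurable_continuous_onI)

definition osc :: "real set \<Rightarrow> (real \<Rightarrow> complex) \<Rightarrow> real \<times> real \<Rightarrow> complex" where
  "osc q h \<xi> = (LINT x:q|\<mu>. h x * wave \<phi> \<xi> x)"

definition oscsup :: "real set \<Rightarrow> real \<Rightarrow> real \<times> real \<Rightarrow> real" where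
  "oscsup q L \<xi> = (SUP h\<in>modulators q L. cmod (osc q h \<xi>))"

text \<open>On a null cell division by zero gives 0, in agreement with the vanishing of
  \<open>oscsup\<close> there; so \<open>measure_times_avgsup\<close> has no exceptional
  case.\<close>

definition avgsup :: "real set \<Rightarrow> real \<Rightarrow> real \<times> real \<Rightarrow> real" where
  "avgsup q L \<xi> = oscsup q L \<xi> / measure \<mu> q"

lemma set_integrable_bounded:
  fixes g :: "real \<Rightarrow> complex"
  assumes [measurable]: "q \<in> sets borel" "g \<in> borel_measurable borel" and "\<And>x. x \<in> q \<Longrightarrow> cmod (g x) \<le> B"
  shows "set_integrable \<mu> q g"
  unfolding set_integrable_def
proof (rule integrable_const_bound[where B="max B 0"])
  show "AE x in \<mu>. norm (indicator q x *\<^sub>R g x) \<le> max B 0"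
    using order_trans[OF assms(3) max.cobounded1] by (intro AE_I2) (auto simp: indicator_def)
qed measurable

lemma cmod_set_integral_le:
  fixes g :: "real \<Rightarrow> complex"
  assumes [measurable]: "q \<in> sets borel" "g \<in> borel_measurable borel" and "\<And>x. x \<in> q \<Longrightarrow> cmod (g x) \<le> B"
  shows "cmod (LINT x:q|\<mu>. g x) \<le> B * measure \<mu> q"
proof -
  have "cmod (LINT x:q|\<mu>. g x) \<le> (LINT x|\<mu>. norm (indicator q x *\<^sub>R g x))"
    unfolding set_lebesgue_integral_def by (rule integral_norm_bound)
  also have "\<dots> \<le> (LINT x|\<mu>. indicator q x * B)"
  proof (intro integral_mono integrable_norm)
    show "integrable \<mu> (\<lambda>x. indicator q x *\<^sub>R g x)"
      using set_integrable_bounded[OF assms] by (simp add: set_integrable_def)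
    show "integrable \<mu> (\<lambda>x. indicator q x * B)"
      by (intro integrable_mult_left integrable_real_indicator) (auto simp: emeasure_finite less_top[symmetric])
  qed (use assms(3) in \<open>auto simp: indicator_def\<close>)
  finally show ?thesis by (simp add: mult.commute)
qed

lemma cmod_osc_le:
  assumes "q \<in> sets borel" "h \<in> modulators q L"
  shows "cmod (osc q h \<xi>) \<le> measure \<mu> q"
  unfolding osc_def using cmod_set_integral_le[OF assms(1), where B=1] assms
  by (auto simp: modulators_def norm_mult)

lemma bdd_above_osc:
  assumes "q \<in> sets borel" shows "bdd_above ((\<lambda>h. cmod (osc q h \<xi>)) ` modulators q L)"
  by (intro bdd_aboveI[where M="measure \<mu> q"]) (auto intro: cmod_osc_le[OF assms])

lemma cmod_osc_le_oscsup:
  assumes "q \<in> sets borel" "h \<in> modulators q L" shows "cmod (osc q h \<xi>) \<le> oscsup q L \<xi>"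
  unfolding oscsup_def by (intro cSUP_upper assms bdd_above_osc)

lemma oscsup_least:
  assumes "0 \<le> L" "\<And>h. h \<in> modulators q L \<Longrightarrow> cmod (osc q h \<xi>) \<le> B"
  shows "oscsup q L \<xi> \<le> B"
  unfolding oscsup_def using assms one_in_modulators by (intro cSUP_least) auto

lemma oscsup_le_measure: "q \<in> sets borel \<Longrightarrow> 0 \<le> L \<Longrightarrow> oscsup q L \<xi> \<le> measure \<mu> q"
  by (intro oscsup_least cmod_osc_le)

lemma oscsup_nonneg: "q \<in> sets borel \<Longrightarrow> 0 \<le> L \<Longrightarrow> 0 \<le> oscsup q L \<xi>"
  using cmod_osc_le_oscsup[OF _ one_in_modulators] by (meson norm_ge_zero order_trans)

lemma avgsup_nonneg: "q \<in> sets borel \<Longrightarrow> 0 \<le> L \<Longrightarrow> 0 \<le> avgsup q L \<xi>"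
  by (simp add: avgsup_def oscsup_nonneg)

lemma avgsup_le_1: "q \<in> sets borel \<Longrightarrow> 0 \<le> L \<Longrightarrow> avgsup q L \<xi> \<le> 1"
  using oscsup_le_measure[of q L \<xi>] by (simp add: avgsup_def divide_le_eq_1 zero_less_measure_iff)

lemma measure_times_avgsup: "q \<in> sets borel \<Longrightarrow> 0 \<le> L \<Longrightarrow> measure \<mu> q * avgsup q L \<xi> = oscsup q L \<xi>"
  using oscsup_le_measure[of q L \<xi>] oscsup_nonneg[of q L \<xi>] by (simp add: avgsup_def)

lemma osc_shift: "osc q h (\<xi> + \<zeta>) = osc q (\<lambda>x. h x * wave \<phi> \<zeta> x) \<xi>"
  unfolding osc_def by (simp add: wave_add mult.assoc)

lemma osc_cmult: "osc q (\<lambda>x. c * h x) \<xi> = c * osc q h \<xi>"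
  unfolding osc_def set_lebesgue_integral_def
  by (subst integral_mult_right_zero[symmetric]) (simp add: algebra_simps)

lemma osc_add:
  assumes "q \<in> sets borel" "h \<in> modulators q L" "h' \<in> modulators q L'"
  shows "osc q (\<lambda>x. h x + h' x) \<xi> = osc q h \<xi> + osc q h' \<xi>"
proof -
  have "set_integrable \<mu> q (\<lambda>x. g x * wave \<phi> \<xi> x)" if "g \<in> modulators q K" for g K
    using that assms(1) by (intro set_integrable_bounded[where B=1]) (auto simp: modulators_def norm_mult)
  from set_integral_add(2)[OF this[OF assms(2)] this[OF assms(3)]]
  show ?thesis unfolding osc_def by (simp add: distrib_right)
qed

lemma osc_cell:
  assumes "0 < r" "0 < b" "h \<in> modulators (cell a r) L"
  shows "osc (cell a r) h \<xi> = (\<Sum>i<b. osc (child a r b i) h \<xi>)"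
proof -
  have "set_integrable \<mu> (cell a r) (\<lambda>x. h x * wave \<phi> \<xi> x)"
    using assms by (intro set_integrable_bounded[where B=1]) (auto simp: modulators_def norm_mult)
  then have "set_integrable \<mu> (child a r b i) (\<lambda>x. h x * wave \<phi> \<xi> x)" if "i < b" for i
    by (rule set_integrable_subset) (simp_all add: child_subset_cell[OF assms(1) that])
  then show ?thesis unfolding osc_def cell_eq_UN_child[OF assms(1,2)]
    using disjoint_child[OF assms(1,2)]
    by (intro set_integral_finite_Union) (auto simp: disjoint_family_on_def)
qed

lemma measure_cell_sum:
  assumes "0 < r" "0 < b" shows "measure \<mu> (cell a r) = (\<Sum>i<b. measure \<mu> (child a r b i))"
  unfolding cell_eq_UN_child[OF assms]
  using disjoint_child[OF assms] by (intro finite_measure_finite_Union) (auto simp: disjoint_family_on_def)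

text \<open>A supremum over uncountably many densities need not be measurable. Here the integrals
  are Lipschitz in \<open>\<xi>\<close> with a constant common to all densities, because
  \<open>x\<close> and \<open>\<phi> x\<close> are bounded on \<open>q\<close>; so the supremum is
  Lipschitz too.\<close>

lemma oscsup_measurable [measurable]:
  assumes q: "q \<in> sets borel" "q \<subseteq> {-M..M}" and L: "0 \<le> L"
  shows "oscsup q L \<in> borel_measurable borel"
proof -
  have "bounded (\<phi> ` {-M..M})"
    by (intro compact_imp_bounded compact_continuous_image continuous_on_subset[OF \<phi>_cont]) auto
  then obtain K where K: "\<And>x. x \<in> {-M..M} \<Longrightarrow> \<bar>\<phi> x\<bar> \<le> K"
    unfolding bounded_iff real_norm_def by blast
  define B where "B = 2 * pi * (\<bar>M\<bar> + \<bar>K\<bar>)"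
  have key: "oscsup q L \<xi> \<le> oscsup q L \<eta> + B * measure \<mu> q * dist \<xi> \<eta>" for \<xi> \<eta>
  proof (rule oscsup_least[OF L])
    fix h assume h: "h \<in> modulators q L"
    have [measurable]: "h \<in> borel_measurable borel" "q \<in> sets borel" using h q by (auto simp: modulators_def)
    let ?c = "\<lambda>\<xi> x. wave \<phi> \<xi> x"
    have int: "set_integrable \<mu> q (\<lambda>x. h x * ?c \<xi> x)" for \<xi>
      using h q by (intro set_integrable_bounded[where B=1]) (auto simp: modulators_def norm_mult)
    have "osc q h \<xi> - osc q h \<eta> = (LINT x:q|\<mu>. h x * ?c \<xi> x - h x * ?c \<eta> x)"
      unfolding osc_def by (rule set_integral_diff(2)[symmetric]) (rule int)+
    also have "cmod \<dots> \<le> (B * dist \<xi> \<eta>) * measure \<mu> q"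
    proof (rule cmod_set_integral_le)
      fix x assume x: "x \<in> q"
      have "cmod (h x * ?c \<xi> x - h x * ?c \<eta> x) \<le> 1 * cmod (?c \<xi> x - ?c \<eta> x)"
        unfolding right_diff_distrib[symmetric] norm_mult
        using h x by (intro mult_right_mono) (auto simp: modulators_def)
      also have "\<dots> \<le> 2 * pi * \<bar>x * fst (\<xi> - \<eta>) + \<phi> x * snd (\<xi> - \<eta>)\<bar>"
        using cmod_wave_diff_le[of \<phi> \<xi> x \<eta> x] by (simp add: phase_def algebra_simps)
      also have "\<dots> \<le> 2 * pi * (\<bar>M\<bar> * norm (\<xi> - \<eta>) + \<bar>K\<bar> * norm (\<xi> - \<eta>))"
      proof (intro mult_left_mono order_trans[OF abs_triangle_ineq] add_mono)
        have x': "\<bar>x\<bar> \<le> \<bar>M\<bar>" "\<bar>\<phi> x\<bar> \<le> \<bar>K\<bar>" using x q(2) K[of x] by fastforce+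
        have n: "\<bar>fst (\<xi> - \<eta>)\<bar> \<le> norm (\<xi> - \<eta>)" "\<bar>snd (\<xi> - \<eta>)\<bar> \<le> norm (\<xi> - \<eta>)"
          by (metis norm_fst_le norm_snd_le prod.collapse real_norm_def)+
        show "\<bar>x * fst (\<xi> - \<eta>)\<bar> \<le> \<bar>M\<bar> * norm (\<xi> - \<eta>)" "\<bar>\<phi> x * snd (\<xi> - \<eta>)\<bar> \<le> \<bar>K\<bar> * norm (\<xi> - \<eta>)"
          unfolding abs_mult using x' n by (auto intro!: mult_mono)
      qed auto
      finally show "cmod (h x * ?c \<xi> x - h x * ?c \<eta> x) \<le> B * dist \<xi> \<eta>"
        by (simp add: B_def dist_norm algebra_simps)
    qed measurable
    finally have "cmod (osc q h \<xi> - osc q h \<eta>) \<le> B * measure \<mu> q * dist \<xi> \<eta>" by (simp add: algebra_simps)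
    then show "cmod (osc q h \<xi>) \<le> oscsup q L \<eta> + B * measure \<mu> q * dist \<xi> \<eta>"
      using cmod_osc_le_oscsup[OF q(1) h, of \<eta>] norm_triangle_sub[of "osc q h \<xi>" "osc q h \<eta>"] by linarith
  qed
  have "lipschitz_on (B * measure \<mu> q) UNIV (oscsup q L)"
  proof (rule lipschitz_onI)
    fix \<xi> \<eta>
    show "dist (oscsup q L \<xi>) (oscsup q L \<eta>) \<le> B * measure \<mu> q * dist \<xi> \<eta>"
      using key[of \<xi> \<eta>] key[of \<eta> \<xi>] by (simp add: dist_real_def dist_commute)
  qed (simp add: B_def)
  then show ?thesis by (intro borel_measurable_continuous_onI lipschitz_on_continuous_on)
qed

lemma avgsup_measurable [measurable]:
  "q \<in> sets borel \<Longrightarrow> q \<subseteq> {-M..M} \<Longrightarrow> 0 \<le> L \<Longrightarrow> avgsup q L \<in> borel_measurable borel"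
  using oscsup_measurable[of q M L] by (auto simp: avgsup_def[abs_def])

text \<open>Dividing by \<open>1 - k\<close> gives an admissible density again; so a density with
  room to spare in both bounds, size and Lipschitz constant, loses the factor \<open>1 - k\<close>
  against the supremum.\<close>

lemma cmod_osc_scaled_le:
  assumes q: "q \<in> sets borel" and h: "h \<in> borel_measurable borel" and k: "k < 1"
    and "\<And>x. x \<in> q \<Longrightarrow> cmod (h x) \<le> 1 - k"
    and "\<And>x y. x \<in> q \<Longrightarrow> y \<in> q \<Longrightarrow> cmod (h x - h y) \<le> (1 - k) * L * \<bar>x - y\<bar>"
  shows "cmod (osc q h \<xi>) \<le> (1 - k) * oscsup q L \<xi>"
proof -
  let ?g = "\<lambda>x. of_real (1 / (1 - k)) * h x"
  have "?g \<in> modulators q L"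
    unfolding modulators_def
  proof (intro CollectI conjI ballI)
    fix x assume "x \<in> q"
    then show "cmod (?g x) \<le> 1" using assms(4) k by (simp only: norm_mult norm_of_real) (simp add: field_simps)
  next
    fix x y assume xy: "x \<in> q" "y \<in> q"
    have "cmod (?g x - ?g y) = 1 / (1 - k) * cmod (h x - h y)"
      unfolding right_diff_distrib[symmetric] norm_mult norm_of_real using k by simp
    also have "\<dots> \<le> 1 / (1 - k) * ((1 - k) * L * \<bar>x - y\<bar>)"
      using k assms(5)[OF xy] by (intro mult_left_mono) auto
    also have "\<dots> = L * \<bar>x - y\<bar>" using k by simp
    finally show "cmod (?g x - ?g y) \<le> L * \<bar>x - y\<bar>" .
  qed (use h in measurable)
  from cmod_osc_le_oscsup[OF q this] have "cmod (osc q ?g \<xi>) \<le> oscsup q L \<xi>" .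
  then show ?thesis 
    unfolding osc_cmult norm_mult norm_of_real using k by (simp add: field_simps)
qed

lemma avgsup_shift_le:
  assumes r: "0 < r" "0 < b" and L: "0 \<le> L" "0 \<le> L'" "L + M \<le> L'"
    and lip: "\<And>x y. x \<in> cell a r \<Longrightarrow> y \<in> cell a r \<Longrightarrow> 2 * pi * \<bar>phase \<phi> \<zeta> x - phase \<phi> \<zeta> y\<bar> \<le> M * \<bar>x - y\<bar>"
  shows "avgsup (cell a r) L (\<xi> + \<zeta>)
    \<le> (\<Sum>i<b. measure \<mu> (child a r b i) / measure \<mu> (cell a r) * avgsup (child a r b i) L' \<xi>)"
proof -
  have "oscsup (cell a r) L (\<xi> + \<zeta>) \<le> (\<Sum>i<b. oscsup (child a r b i) L' \<xi>)"
  proof (rule oscsup_least[OF L(1)])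
    fix h assume h: "h \<in> modulators (cell a r) L"
    let ?H = "\<lambda>x. h x * wave \<phi> \<zeta> x"
    have H: "?H \<in> modulators (cell a r) (L + M)" using h lip by (intro modulate_modulators) auto
    have "cmod (osc (cell a r) h (\<xi> + \<zeta>)) = cmod (\<Sum>i<b. osc (child a r b i) ?H \<xi>)"
      unfolding osc_shift osc_cell[OF r H] ..
    also have "\<dots> \<le> (\<Sum>i<b. cmod (osc (child a r b i) ?H \<xi>))" by (rule norm_sum)
    also have "\<dots> \<le> (\<Sum>i<b. oscsup (child a r b i) L' \<xi>)"
      using H modulators_mono[OF child_subset_cell[OF r(1)] L(3)]
      by (intro sum_mono cmod_osc_le_oscsup) auto
    finally show "cmod (osc (cell a r) h (\<xi> + \<zeta>)) \<le> (\<Sum>i<b. oscsup (child a r b i) L' \<xi>)" .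
  qed
  then have "avgsup (cell a r) L (\<xi> + \<zeta>) \<le> (\<Sum>i<b. oscsup (child a r b i) L' \<xi>) / measure \<mu> (cell a r)"
    unfolding avgsup_def by (rule divide_right_mono) simp
  also have "\<dots> = (\<Sum>i<b. measure \<mu> (child a r b i) / measure \<mu> (cell a r) * avgsup (child a r b i) L' \<xi>)"
    unfolding sum_divide_distrib using L by (intro sum.cong) (auto simp flip: measure_times_avgsup)
  finally show ?thesis .
qed


section \<open>Phase cancellation on a single arc\<close>

text \<open>A constant rotation makes the integral real and nonnegative. This is what permits
  averaging two such densities: real parts add, whereas integrals with different arguments could
  cancel.\<close>

lemma obtain_near_optimal_modulator:
  assumes L: "0 \<le> L" "L + M \<le> L'" and q: "q \<in> sets borel"
    and lip: "\<And>x y. x \<in> q \<Longrightarrow> y \<in> q \<Longrightarrow> 2 * pi * \<bar>phase \<phi> \<zeta> x - phase \<phi> \<zeta> y\<bar> \<le> M * \<bar>x - y\<bar>"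
    and B: "B < oscsup q L (\<xi> + \<zeta>)"
  obtains h where "h \<in> modulators q L" "(\<lambda>x. h x * wave \<phi> \<zeta> x) \<in> modulators q L'"
    "B < Re (osc q (\<lambda>x. h x * wave \<phi> \<zeta> x) \<xi>)"
proof -
  obtain h where h: "h \<in> modulators q L" "B < cmod (osc q h (\<xi> + \<zeta>))"
    using oscsup_least[OF L(1), of q "\<xi> + \<zeta>" B] B by (meson not_le)
  define z where "z = osc q h (\<xi> + \<zeta>)"
  define c where "c = (if z = 0 then 1 else cnj z / of_real (cmod z))"
  have c: "cmod c = 1" "c * z = of_real (cmod z)"
    by (auto simp: c_def norm_divide complex_norm_square[symmetric] power2_eq_square mult.commute[of "cnj z" z])
  let ?h = "\<lambda>x. c * h x"
  have h1: "?h \<in> modulators q L" by (rule const_mult_modulators[OF h(1) c(1)])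
  then have "(\<lambda>x. ?h x * wave \<phi> \<zeta> x) \<in> modulators q (L + M)"
    using lip by (intro modulate_modulators) auto
  then have "(\<lambda>x. ?h x * wave \<phi> \<zeta> x) \<in> modulators q L'" using modulators_mono[OF order_refl L(2)] by blast
  moreover have "osc q (\<lambda>x. ?h x * wave \<phi> \<zeta> x) \<xi> = of_real (cmod z)"
    unfolding osc_shift[symmetric] osc_cmult z_def[symmetric] c(2) ..
  ultimately show ?thesis using h1 h(2) by (intro that[of ?h]) (auto simp: z_def)
qed

text \<open>Two extremal modulated densities \<open>H\<close>, \<open>H'\<close> for the frequencies \<open>\<xi> + \<zeta>\<close> and \<open>\<xi> + \<zeta>'\<close> can be averaged.
  Wherever \<open>H\<close> and \<open>H'\<close> disagree, the average is an admissible density with room to spare, so the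
  children on which they disagree everywhere carry little mass.\<close>

lemma near_extremal_frequencies:
  assumes r: "0 < r" and b: "4 \<le> b" and lam: "0 < lam" "lam \<le> 1 / 2"
    and k: "k = lam\<^sup>2 / 8" and \<eta>: "\<eta> = k / (32 * real b)"
    and m: "0 < measure \<mu> (cell a r)"
    and lip: "\<And>x y. x \<in> cell a r \<Longrightarrow> y \<in> cell a r \<Longrightarrow> 2 * pi * \<bar>phase \<phi> \<zeta> x - phase \<phi> \<zeta> y\<bar> \<le> lam * b / (4 * r) * \<bar>x - y\<bar>"
    and lip': "\<And>x y. x \<in> cell a r \<Longrightarrow> y \<in> cell a r \<Longrightarrow> 2 * pi * \<bar>phase \<phi> \<zeta>' x - phase \<phi> \<zeta>' y\<bar> \<le> lam * b / (4 * r) * \<bar>x - y\<bar>"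
    and J: "J = sqrt (\<Sum>i<b. measure \<mu> (child a r b i) / measure \<mu> (cell a r) * (avgsup (child a r b i) (lam * b / r) \<xi>)\<^sup>2)"
    and bad: "(1 - \<eta>) * J < avgsup (cell a r) (lam / r) (\<xi> + \<zeta>)" "(1 - \<eta>) * J < avgsup (cell a r) (lam / r) (\<xi> + \<zeta>')"
  obtains G V where "G \<subseteq> {..<b}" "(\<Sum>i\<in>G. measure \<mu> (child a r b i)) \<le> measure \<mu> (cell a r) / (8 * real b)"
    "\<And>i. i < b \<Longrightarrow> i \<notin> G \<Longrightarrow> \<exists>x\<in>child a r b i. x \<in> V"
    "\<And>x y. x \<in> V \<Longrightarrow> y \<in> V \<Longrightarrow> cmod (wave \<phi> (\<zeta> - \<zeta>') x - wave \<phi> (\<zeta> - \<zeta>') y) \<le> 8 * lam"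
proof -
  let ?q = "cell a r" and ?c = "child a r b" and ?L = "lam / r" and ?L' = "lam * b / r"
  let ?m = "measure \<mu> ?q"
  have b0: "0 < b" using b by simp
  have kb: "0 < k" "k \<le> 1 / 2" using lam power_mono[OF lam(2), of 2] by (auto simp: k power2_eq_square)
  have \<eta>0: "0 \<le> \<eta>" using kb by (simp add: \<eta>)
  have L: "0 \<le> ?L" "0 \<le> ?L'" using lam r by auto
  have LL: "?L + lam * b / (4 * r) \<le> ?L' / 2"
  proof -
    have "4 * lam \<le> b * lam" using b lam by (intro mult_right_mono) auto
    then show ?thesis using r mult_right_mono[of "4 * lam" "b * lam" r] by (simp add: field_simps)
  qed
  have big: "(1 - \<eta>) * J * ?m < oscsup ?q ?L (\<xi> + \<zeta>)" "(1 - \<eta>) * J * ?m < oscsup ?q ?L (\<xi> + \<zeta>')"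
    using bad m by (simp_all add: avgsup_def pos_less_divide_eq)
  obtain h where h: "h \<in> modulators ?q ?L" "(\<lambda>x. h x * wave \<phi> \<zeta> x) \<in> modulators ?q (?L' / 2)"
      "(1 - \<eta>) * J * ?m < Re (osc ?q (\<lambda>x. h x * wave \<phi> \<zeta> x) \<xi>)"
    using obtain_near_optimal_modulator[OF L(1) LL cell_sets lip big(1)] by blast
  obtain h' where h': "h' \<in> modulators ?q ?L" "(\<lambda>x. h' x * wave \<phi> \<zeta>' x) \<in> modulators ?q (?L' / 2)"
      "(1 - \<eta>) * J * ?m < Re (osc ?q (\<lambda>x. h' x * wave \<phi> \<zeta>' x) \<xi>)"
    using obtain_near_optimal_modulator[OF L(1) LL cell_sets lip' big(2)] by blast
  define H where "H x = h x * wave \<phi> \<zeta> x" for x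
  define H' where "H' x = h' x * wave \<phi> \<zeta>' x" for x
  define K where "K x = (H x + H' x) / 2" for x
  have HM: "H \<in> modulators ?q (?L' / 2)" "H' \<in> modulators ?q (?L' / 2)"
    using h(2) h'(2) by (simp_all add: H_def[abs_def] H'_def[abs_def])
  have [measurable]: "H \<in> borel_measurable borel" "H' \<in> borel_measurable borel"
    using HM by (auto simp: modulators_def)
  have Km [measurable]: "K \<in> borel_measurable borel" unfolding K_def[abs_def] by measurable
  have Klip: "cmod (K x - K y) \<le> ?L' / 2 * \<bar>x - y\<bar>" if "x \<in> ?q" "y \<in> ?q" for x y
  proof -
    have "K x - K y = ((H x - H y) + (H' x - H' y)) / 2" by (simp add: K_def field_simps)
    then have "cmod (K x - K y) = cmod ((H x - H y) + (H' x - H' y)) / 2"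
      by (simp only: norm_divide norm_numeral)
    also have "\<dots> \<le> (cmod (H x - H y) + cmod (H' x - H' y)) / 2"
      by (intro divide_right_mono norm_triangle_ineq) simp
    also have "\<dots> \<le> (?L' / 2 * \<bar>x - y\<bar> + ?L' / 2 * \<bar>x - y\<bar>) / 2"
      using HM that unfolding modulators_def by (intro divide_right_mono add_mono) auto
    finally show ?thesis by simp
  qed
  have K1: "cmod (K x) \<le> 1" if "x \<in> ?q" for x
  proof -
    have "cmod (H x) \<le> 1" "cmod (H' x) \<le> 1" using HM that by (auto simp: modulators_def)
    then show ?thesis using norm_triangle_ineq[of "H x" "H' x"] by (simp add: K_def norm_divide)
  qed
  have KM: "K \<in> modulators ?q (?L' / 2)" using Klip K1 by (simp add: modulators_def)
  have "osc ?q (\<lambda>x. H x + H' x) \<xi> = osc ?q H \<xi> + osc ?q H' \<xi>"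
    by (rule osc_add[OF cell_sets HM])
  moreover have "osc ?q K \<xi> = of_real (1 / 2) * osc ?q (\<lambda>x. H x + H' x) \<xi>"
    unfolding osc_cmult[symmetric] by (simp add: K_def[abs_def])
  ultimately have "Re (osc ?q K \<xi>) = 1 / 2 * Re (osc ?q H \<xi>) + 1 / 2 * Re (osc ?q H' \<xi>)"
    by (simp only: Re_complex_of_real Im_complex_of_real times_complex.simps plus_complex.simps) (simp add: distrib_left)
  moreover have "(1 - \<eta>) * J * ?m < Re (osc ?q H \<xi>)" "(1 - \<eta>) * J * ?m < Re (osc ?q H' \<xi>)"
    using h(3) h'(3) by (simp_all add: H_def[abs_def] H'_def[abs_def])
  ultimately have K2: "(1 - \<eta>) * J * ?m < Re (osc ?q K \<xi>)" by linarith
  \<comment> \<open>The children on which the average stays away from the unit circle; there it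
    loses the factor \<open>1 - k\<close>.\<close>
  define G where "G = {i. i < b \<and> (\<forall>x\<in>?c i. cmod (K x) \<le> 1 - k)}"
  have G: "G \<subseteq> {..<b}" by (auto simp: G_def)
  define S where "S i = oscsup (?c i) ?L' \<xi>" for i
  have S0: "0 \<le> S i" for i using L by (simp add: S_def oscsup_nonneg)
  have oK: "cmod (osc (?c i) K \<xi>) \<le> S i - (if i \<in> G then k * S i else 0)" if i: "i < b" for i
  proof (cases "i \<in> G")
    case True
    have sub: "?c i \<subseteq> ?q" by (rule child_subset_cell[OF r i])
    have "cmod (osc (?c i) K \<xi>) \<le> (1 - k) * oscsup (?c i) ?L' \<xi>"
    proof (rule cmod_osc_scaled_le)
      fix x y assume "x \<in> ?c i" "y \<in> ?c i"
      then have "cmod (K x - K y) \<le> ?L' / 2 * \<bar>x - y\<bar>" using sub Klip by blast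
      also have "\<dots> \<le> (1 - k) * ?L' * \<bar>x - y\<bar>"
        using kb L(2) mult_right_mono[of "1 / 2" "1 - k" ?L'] by (intro mult_right_mono) auto
      finally show "cmod (K x - K y) \<le> (1 - k) * ?L' * \<bar>x - y\<bar>" .
    qed (use True kb in \<open>auto simp: G_def\<close>)
    then show ?thesis using True by (simp add: S_def algebra_simps)
  next
    case False
    have "K \<in> modulators (?c i) ?L'"
      using KM modulators_mono[OF child_subset_cell[OF r i], of "?L' / 2" ?L'] L(2) by auto
    then show ?thesis using False cmod_osc_le_oscsup[of "?c i" K ?L' \<xi>] by (simp add: S_def)
  qed
  have "Re (osc ?q K \<xi>) \<le> cmod (\<Sum>i<b. osc (?c i) K \<xi>)"
    using complex_Re_le_cmod osc_cell[OF r b0 KM] by metis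
  also have "\<dots> \<le> (\<Sum>i<b. S i - (if i \<in> G then k * S i else 0))"
    using oK by (intro sum_norm_le) auto
  also have "\<dots> = (\<Sum>i<b. S i) - k * (\<Sum>i\<in>G. S i)"
    using G by (simp add: sum_subtractf sum.inter_restrict[symmetric] Int_absorb1 sum_distrib_left)
  finally have main: "(1 - \<eta>) * J * ?m < (\<Sum>i<b. S i) - k * (\<Sum>i\<in>G. S i)" using K2 by linarith
  define w where "w i = measure \<mu> (?c i) / ?m" for i
  define s where "s i = avgsup (?c i) ?L' \<xi>" for i
  have ws: "w i * s i = S i / ?m" for i
    using measure_times_avgsup[of "?c i" ?L' \<xi>] L by (simp add: w_def s_def S_def)
  have w: "\<And>i. 0 \<le> w i" "sum w {..<b} = 1"
    using m measure_cell_sum[OF r b0, of a] by (auto simp: w_def sum_divide_distrib[symmetric])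
  have s: "\<And>i. 0 \<le> s i" using L by (simp add: s_def avgsup_nonneg)
  have Jw: "J = sqrt (\<Sum>i<b. w i * (s i)\<^sup>2)" by (simp add: J w_def s_def)
  have "(1 - \<eta>) * J * ?m / ?m < ((\<Sum>i<b. S i) - k * (\<Sum>i\<in>G. S i)) / ?m"
    using main m by (rule divide_strict_right_mono)
  then have main': "(1 - \<eta>) * J < (\<Sum>i<b. w i * s i) - k * (\<Sum>i\<in>G. w i * s i)"
    using m by (simp add: ws sum_divide_distrib[symmetric] diff_divide_distrib)
  have "0 < J"
  proof (rule ccontr)
    assume "\<not> 0 < J"
    moreover have nn: "0 \<le> (\<Sum>i<b. w i * (s i)\<^sup>2)" using w by (intro sum_nonneg) auto
    ultimately have J0: "(\<Sum>i<b. w i * (s i)\<^sup>2) = 0" "J = 0" unfolding Jw by auto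
    then have "\<forall>i\<in>{..<b}. w i * (s i)\<^sup>2 = 0" using w by (subst (asm) sum_nonneg_eq_0_iff) auto
    then have "(\<Sum>i<b. w i * s i) = 0" by (intro sum.neutral) auto
    moreover have "0 \<le> k * (\<Sum>i\<in>G. w i * s i)" using kb w s by (intro mult_nonneg_nonneg sum_nonneg) auto
    ultimately show False using main' J0 by simp
  qed
  then have "sum w G \<le> 2 * \<eta> * (1 + 1 / k)"
    using weight_of_deficient_terms[OF finite_lessThan G w(1) w(2) s Jw _ kb(1) \<eta>0] main' by simp
  \<comment> \<open>The reason for \<open>\<eta>\<close> being proportional to \<open>k / b\<close>:
    all of \<open>G\<close> together weighs less than a single child of half the average mass, so
    such a child cannot belong to \<open>G\<close>.\<close>
  also have "\<dots> \<le> 1 / (8 * real b)"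
    using kb b0 by (simp add: \<eta> field_simps)
  finally have wG: "(\<Sum>i\<in>G. measure \<mu> (?c i)) \<le> ?m / (8 * real b)"
    using m by (simp add: w_def sum_divide_distrib[symmetric] pos_divide_le_eq)
  define V where "V = {x \<in> ?q. 1 - k < cmod (K x)}"
  have "\<exists>x\<in>?c i. x \<in> V" if "i < b" "i \<notin> G" for i
    using that child_subset_cell[OF r that(1), of a] by (fastforce simp: G_def V_def not_le)
  moreover have "cmod (wave \<phi> (\<zeta> - \<zeta>') x - wave \<phi> (\<zeta> - \<zeta>') y) \<le> 8 * lam" if xy: "x \<in> V" "y \<in> V" for x y
  proof -
    \<comment> \<open>In \<open>H * cnj H'\<close> the factor \<open>h * cnj h'\<close> varies by at
      most \<open>2 * lam\<close> over the whole cell, since \<open>h\<close> and \<open>h'\<close>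
      are Lipschitz with constant \<open>lam / r\<close>. As the product is within
      \<open>lam\<close> of 1 on \<open>V\<close>, the remaining factor, the wave of
      \<open>\<zeta> - \<zeta>'\<close>, is nearly constant on \<open>V\<close>.\<close>
    let ?k = "\<lambda>x. h x * cnj (h' x)" and ?W = "wave \<phi> (\<zeta> - \<zeta>')"
    have W: "H x * cnj (H' x) = ?k x * ?W x" for x
      by (simp add: H_def H'_def wave_def cis_cnj cis_mult phase_diff algebra_simps)
    have near1: "cmod (?k x * ?W x - 1) \<le> lam" if "x \<in> V" for x
      unfolding W[symmetric]
    proof (rule phase_rigidity[where k=k])
      show "cmod (H x) \<le> 1" "cmod (H' x) \<le> 1" using HM that by (auto simp: modulators_def V_def)
      show "1 - k < cmod ((H x + H' x) / 2)" using that by (simp add: V_def K_def)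
    qed (use lam kb k in auto)
    have q: "x \<in> ?q" "y \<in> ?q" using xy by (auto simp: V_def)
    have "\<bar>x - y\<bar> \<le> r" using q by (auto simp: cell_def)
    then have Lr: "?L * \<bar>x - y\<bar> \<le> lam" using r lam mult_left_mono[of "\<bar>x - y\<bar>" r ?L] by simp
    have "?k y - ?k x = (h y - h x) * cnj (h' y) + h x * cnj (h' y - h' x)" by (simp add: algebra_simps)
    then have "cmod (?k y - ?k x) \<le> cmod (h y - h x) * cmod (h' y) + cmod (h x) * cmod (h' y - h' x)"
      by (metis norm_triangle_ineq norm_mult complex_mod_cnj)
    also have "\<dots> \<le> lam * 1 + 1 * lam"
    proof (intro add_mono mult_mono)
      have "cmod (h y - h x) \<le> ?L * \<bar>y - x\<bar>" "cmod (h' y - h' x) \<le> ?L * \<bar>y - x\<bar>"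
        using h(1) h'(1) q unfolding modulators_def by blast+
      then show "cmod (h y - h x) \<le> lam" "cmod (h' y - h' x) \<le> lam" using Lr by (simp_all add: abs_minus_commute)
    qed (use h(1) h'(1) q lam in \<open>auto simp: modulators_def\<close>)
    finally have kk: "cmod (?k y - ?k x) \<le> 2 * lam" by simp
    have "?k x * (?W x - ?W y) = (?k x * ?W x - 1) - (?k y * ?W y - 1) + (?k y - ?k x) * ?W y"
      by (simp add: algebra_simps)
    then have "cmod (?k x * (?W x - ?W y)) \<le> cmod (?k x * ?W x - 1) + cmod (?k y * ?W y - 1) + cmod ((?k y - ?k x) * ?W y)"
      by (simp only:) (intro order_trans[OF norm_triangle_ineq] add_right_mono norm_triangle_ineq4)
    also have "\<dots> \<le> 4 * lam" using near1[OF xy(1)] near1[OF xy(2)] kk by (simp add: norm_mult)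
    finally have A: "cmod (?k x) * cmod (?W x - ?W y) \<le> 4 * lam" by (simp add: norm_mult)
    have "1 / 2 \<le> cmod (?k x)"
      using near1[OF xy(1)] norm_triangle_ineq2[of 1 "1 - ?k x * ?W x"] lam
      by (simp add: norm_minus_commute norm_mult)
    then have "1 / 2 * cmod (?W x - ?W y) \<le> cmod (?k x) * cmod (?W x - ?W y)" by (intro mult_right_mono) auto
    then show ?thesis using A by simp
  qed
  ultimately show ?thesis using that[OF G wG] by blast
qed


lemma measure_le_sum_children:
  assumes r: "0 < r" "0 < b" and Y: "Y \<in> sets borel" "Y \<subseteq> cell a r"
  shows "measure \<mu> Y \<le> (\<Sum>i\<in>{i. i < b \<and> child a r b i \<inter> Y \<noteq> {}}. measure \<mu> (child a r b i))"
proof -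
  let ?I = "{i. i < b \<and> child a r b i \<inter> Y \<noteq> {}}"
  have "Y \<subseteq> (\<Union>i\<in>?I. child a r b i)" 
  proof
    fix x assume "x \<in> Y"
    moreover from this obtain i where "i < b" "x \<in> child a r b i"
      using Y(2) cell_eq_UN_child[OF r, of a] by blast
    ultimately show "x \<in> (\<Union>i\<in>?I. child a r b i)" by blast
  qed
  then have "measure \<mu> Y \<le> measure \<mu> (\<Union>i\<in>?I. child a r b i)"
    by (intro finite_measure_mono) auto
  also have "\<dots> \<le> (\<Sum>i\<in>?I. measure \<mu> (child a r b i))"
    by (intro finite_measure_subadditive_finite) auto
  finally show ?thesis .
qed

text \<open>\<open>u\<close> stands for the linear form
  \<open>fst \<zeta> + c * snd \<zeta>\<close>, the slope of the phase where the curve has slope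
  \<open>c\<close>, and \<open>N\<close> for a norm dominating it. The number 40 absorbs
  \<open>2 * pi < 8\<close> and the factor 5/4 due to the linearisation error:
  \<open>8 * (5 / 4) / 40 = 1 / 4\<close>.\<close>

lemma phase_lipschitz:
  assumes u: "\<And>\<zeta> x y. x \<in> q \<Longrightarrow> y \<in> q \<Longrightarrow> \<bar>phase \<phi> \<zeta> x - phase \<phi> \<zeta> y - (x - y) * u \<zeta>\<bar> \<le> \<bar>x - y\<bar> * N \<zeta> / 4"
    and uN: "\<And>\<zeta>. \<bar>u \<zeta>\<bar> \<le> N \<zeta>" and xy: "x \<in> q" "y \<in> q" and N: "N \<theta> \<le> lam * b / (40 * r)"
  shows "2 * pi * \<bar>phase \<phi> \<theta> x - phase \<phi> \<theta> y\<bar> \<le> lam * b / (4 * r) * \<bar>x - y\<bar>"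
proof -
  have "\<bar>phase \<phi> \<theta> x - phase \<phi> \<theta> y\<bar> \<le> \<bar>(x - y) * u \<theta>\<bar> + \<bar>x - y\<bar> * N \<theta> / 4"
    using u[OF xy, of \<theta>] by linarith
  also have "\<dots> \<le> \<bar>x - y\<bar> * N \<theta> + \<bar>x - y\<bar> * N \<theta> / 4"
    using mult_left_mono[OF uN[of \<theta>], of "\<bar>x - y\<bar>"] by (simp add: abs_mult mult.commute)
  also have "\<dots> = 5 / 4 * (\<bar>x - y\<bar> * N \<theta>)" by simp
  also have "\<dots> \<le> 5 / 4 * (\<bar>x - y\<bar> * (lam * b / (40 * r)))" using N by (intro mult_left_mono) auto
  finally have "2 * pi * \<bar>phase \<phi> \<theta> x - phase \<phi> \<theta> y\<bar> \<le> 2 * 4 * (5 / 4 * (\<bar>x - y\<bar> * (lam * b / (40 * r))))"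
    using pi_less_4 by (intro mult_mono) auto
  then show ?thesis by (simp add: field_simps)
qed

text \<open>A frequency difference of size larger than \<open>g / (5 * r)\<close> would be incompatible with two heavy pieces
  of the cell whose distance is comparable to the reciprocal of that difference.\<close>

lemma near_extremal_frequencies_localised:
  assumes r: "0 < r" and b: "4 \<le> b" and D: "1 \<le> D" and lam: "lam = 1 / (200 * D)"
    and k: "k = lam\<^sup>2 / 8" and \<eta>: "\<eta> = k / (32 * real b)"
    and m: "0 < measure \<mu> (cell a r)"
    and doubling: "\<And>x \<rho>. x \<in> cell a r \<Longrightarrow> 0 < \<rho> \<Longrightarrow> D * \<rho> \<le> r \<Longrightarrow> 2 * measure \<mu> (ball x \<rho>) \<le> measure \<mu> (ball x (D * \<rho>))"
    and g: "0 < g" and good: "measure \<mu> (cell a r) \<le> 2 * measure \<mu> {a + 2 * r / g..<a + r - 2 * r / g}"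
    and u: "\<And>\<zeta> x y. x \<in> cell a r \<Longrightarrow> y \<in> cell a r \<Longrightarrow> \<bar>phase \<phi> \<zeta> x - phase \<phi> \<zeta> y - (x - y) * u \<zeta>\<bar> \<le> \<bar>x - y\<bar> * N \<zeta> / 4"
    and uN: "\<And>\<zeta>. \<bar>u \<zeta>\<bar> \<le> N \<zeta>" and NN: "N (\<zeta> - \<zeta>') \<le> N \<zeta> + N \<zeta>'"
    and small: "N \<zeta> \<le> lam * b / (40 * r)" "N \<zeta>' \<le> lam * b / (40 * r)"
    and J: "J = sqrt (\<Sum>i<b. measure \<mu> (child a r b i) / measure \<mu> (cell a r) * (avgsup (child a r b i) (lam * b / r) \<xi>)\<^sup>2)"
    and bad: "(1 - \<eta>) * J < avgsup (cell a r) (lam / r) (\<xi> + \<zeta>)" "(1 - \<eta>) * J < avgsup (cell a r) (lam / r) (\<xi> + \<zeta>')"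
    and dir: "\<bar>u (\<zeta> - \<zeta>')\<bar> = N (\<zeta> - \<zeta>')"
  shows "N (\<zeta> - \<zeta>') \<le> g / (5 * r)"
proof (rule ccontr)
  let ?\<omega> = "\<zeta> - \<zeta>'" and ?q = "cell a r" and ?c = "child a r b"
  let ?m = "measure \<mu> ?q"
  have b0: "0 < b" using b by simp
  have lam0: "0 < lam" "lam \<le> 1 / 2" using D by (auto simp: lam divide_simps)
  have pi8: "2 * pi * \<bar>phase \<phi> \<theta> x - phase \<phi> \<theta> y\<bar> \<le> lam * b / (4 * r) * \<bar>x - y\<bar>"
    if "x \<in> ?q" "y \<in> ?q" "N \<theta> \<le> lam * b / (40 * r)" for \<theta> x y
    by (rule phase_lipschitz[where u=u and N=N, OF _ uN that]) (rule u)
  obtain G V where G: "G \<subseteq> {..<b}" "(\<Sum>i\<in>G. measure \<mu> (?c i)) \<le> ?m / (8 * real b)"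
    and V: "\<And>i. i < b \<Longrightarrow> i \<notin> G \<Longrightarrow> \<exists>x\<in>?c i. x \<in> V"
      "\<And>x y. x \<in> V \<Longrightarrow> y \<in> V \<Longrightarrow> cmod (wave \<phi> ?\<omega> x - wave \<phi> ?\<omega> y) \<le> 8 * lam"
    using near_extremal_frequencies[OF r b lam0 k \<eta> m pi8[OF _ _ small(1)] pi8[OF _ _ small(2)] J bad] by blast
  define P where "P = N ?\<omega>"
  assume "\<not> N ?\<omega> \<le> g / (5 * r)"
  then have P: "g / (5 * r) < P" by (simp add: P_def)
  then have P0: "0 < P" using g r by (smt (verit) divide_pos_pos mult_pos_pos)
  \<comment> \<open>Over the distance \<open>t\<close> the frequency difference turns by about a
    fifth of a full turn; with the linearisation error the turn is at most 1/4, the range of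
    \<open>cmod_cis_minus_one_ge\<close>. A large \<open>P\<close> makes \<open>t\<close> smaller
    than the margin of the interior \<open>Y\<close>, so intervals of radius \<open>t / 4\<close>
    around the heavy child stay in the cell.\<close>
  define t where "t = 1 / (5 * P)"
  define r' where "r' = r / b"
  have t: "0 < t" "t < r / g" using P P0 g r by (auto simp: t_def field_simps)
  have r'0: "0 < r'" using r b0 by (simp add: r'_def)
  have "P \<le> lam * b / (20 * r)" using NN small by (simp add: P_def)
  also have "\<dots> = lam / (20 * r')" by (simp add: r'_def)
  finally have "P * (20 * r') \<le> lam" using r'0 by (simp add: pos_le_divide_eq)
  then have "r' * 800 * D \<le> t" using P0 D by (simp add: t_def lam field_simps)
  then have Dr: "800 * (D * r') \<le> t" by (simp add: algebra_simps)
  have r't: "r' \<le> t / 800" using Dr mult_right_mono[of 1 D r'] D r'0 by linarith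
  define Y where "Y = {a + 2 * r / g..<a + r - 2 * r / g}"
  have rg: "0 < r / g" using r g by simp
  have Y: "Y \<in> sets borel" "Y \<subseteq> ?q" using rg by (auto simp: Y_def cell_def)
  \<comment> \<open>Pigeonhole: the interior carries at least half of the mass and is met by at most
    \<open>b\<close> children.\<close>
  have "\<exists>i<b. ?c i \<inter> Y \<noteq> {} \<and> ?m / (2 * real b) \<le> measure \<mu> (?c i)"
  proof (rule ccontr)
    assume neg: "\<not> ?thesis"
    let ?I = "{i. i < b \<and> ?c i \<inter> Y \<noteq> {}}"
    have lt: "measure \<mu> (?c i) < ?m / (2 * real b)" if "i \<in> ?I" for i using neg that by auto
    have half: "?m / 2 \<le> (\<Sum>i\<in>?I. measure \<mu> (?c i))"
      using measure_le_sum_children[OF r b0 Y] good by (simp add: Y_def)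
    then have ne: "?I \<noteq> {}" using m by (metis half_gt_zero not_le sum.empty)
    have "(\<Sum>i\<in>?I. measure \<mu> (?c i)) < (\<Sum>i\<in>?I. ?m / (2 * real b))"
      by (rule sum_strict_mono) (use ne lt in auto)
    also have "\<dots> = card ?I * (?m / (2 * real b))" by simp
    also have "\<dots> \<le> b * (?m / (2 * real b))"
      using card_mono[of "{..<b}" ?I] by (intro mult_right_mono) auto
    finally show False using half b0 by simp
  qed
  then obtain i where i: "i < b" "?c i \<inter> Y \<noteq> {}" "?m / (2 * real b) \<le> measure \<mu> (?c i)" by blast
  have mb: "?m / (8 * real b) < ?m / (2 * real b)" using m b0 by (simp add: field_simps)
  have iG: "i \<notin> G"
  proof
    assume "i \<in> G"
    then have "measure \<mu> (?c i) \<le> (\<Sum>i\<in>G. measure \<mu> (?c i))"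
      by (intro member_le_sum finite_subset[OF G(1)]) auto
    then show False using G(2) i(3) mb by linarith
  qed
  then obtain x where x: "x \<in> ?c i" "x \<in> V" using V(1)[OF i(1)] by blast
  define x0 where "x0 = a + real i * r'"
  have c_i: "?c i = {x0..<x0 + r'}" by (simp add: child_def cell_def x0_def r'_def)
  obtain y0 where y0: "y0 \<in> ?c i" "y0 \<in> Y" using i(2) by blast
  have x0: "a + t \<le> x0" "x0 \<le> a + r - t"
  proof -
    have "a + 2 * (r / g) \<le> y0" "y0 < a + r - 2 * (r / g)" using y0(2) by (simp_all add: Y_def)
    moreover have "x0 \<le> y0" "y0 < x0 + r'" using y0(1) unfolding c_i by auto
    ultimately show "a + t \<le> x0" "x0 \<le> a + r - t" using t r't by linarith+
  qed
  have x0q: "x0 \<in> ?q" using x0 t by (simp add: cell_def)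
  \<comment> \<open>By the doubling condition at least half of the mass of
    \<open>ball x0 (t / 4)\<close> lies outside \<open>ball x0 ra\<close>. This yields a second
    piece too heavy for \<open>G\<close>, at a distance bounded below and above by multiples of
    \<open>t\<close>.\<close>
  define ra where "ra = t / (4 * D)"
  have ra: "0 < ra" "D * ra = t / 4" using t D by (auto simp: ra_def)
  have "t / 4 \<le> r"
  proof -
    have "a + t \<le> a + r - t" using x0 by linarith
    then show ?thesis using t by simp
  qed
  then have dbl: "2 * measure \<mu> (ball x0 ra) \<le> measure \<mu> (ball x0 (t / 4))"
    using doubling[OF x0q ra(1)] ra(2) by simp
  define T where "T = ball x0 (t / 4) - ball x0 ra"
  have "ra \<le> t / 4" using D t by (simp add: ra_def field_simps)
  then have "measure \<mu> T = measure \<mu> (ball x0 (t / 4)) - measure \<mu> (ball x0 ra)"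
    unfolding T_def by (intro finite_measure_Diff) auto
  then have "measure \<mu> (ball x0 (t / 4)) \<le> 2 * measure \<mu> T" using dbl by simp
  moreover have "measure \<mu> (?c i) \<le> measure \<mu> (ball x0 (t / 4))"
    using r't t by (intro finite_measure_mono) (auto simp: c_i dist_real_def)
  ultimately have mT: "?m / (4 * real b) \<le> measure \<mu> T" using i(3) by simp
  have "ball x0 (t / 4) \<subseteq> ?q"
  proof
    fix x assume "x \<in> ball x0 (t / 4)"
    then have "\<bar>x0 - x\<bar> < t / 4" by (simp add: dist_real_def)
    then have "a < x" "x < a + r" using x0 t by arith+
    then show "x \<in> ?q" by (simp add: cell_def)
  qed
  then have T: "T \<in> sets borel" "T \<subseteq> ?q" by (auto simp: T_def)
  obtain j where j: "j < b" "?c j \<inter> T \<noteq> {}" "j \<notin> G"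
  proof (rule ccontr)
    assume neg: "\<not> thesis"
    have "measure \<mu> T \<le> (\<Sum>j\<in>{j. j < b \<and> ?c j \<inter> T \<noteq> {}}. measure \<mu> (?c j))"
      by (rule measure_le_sum_children[OF r b0 T])
    also have "\<dots> \<le> (\<Sum>j\<in>G. measure \<mu> (?c j))"
      using neg that by (intro sum_mono2 finite_subset[OF G(1)]) auto
    also have "\<dots> \<le> ?m / (8 * real b)" by (rule G(2))
    also have "\<dots> < ?m / (4 * real b)" using m b0 by (simp add: field_simps)
    finally show False using mT by simp
  qed
  then obtain y where y: "y \<in> ?c j" "y \<in> V" using V(1) by blast
  obtain y1 where y1: "y1 \<in> ?c j" "y1 \<in> T" using j(2) by blast
  have "\<bar>y - y1\<bar> \<le> r'" using y(1) y1(1) by (auto simp: child_def cell_def r'_def)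
  moreover have "\<bar>x - x0\<bar> \<le> r'" using x(1) by (auto simp: c_i)
  moreover have "ra \<le> \<bar>y1 - x0\<bar>" "\<bar>y1 - x0\<bar> \<le> t / 4"
    using y1(2) by (auto simp: T_def dist_real_def abs_minus_commute)
  moreover have "r' \<le> ra / 200" using Dr D by (simp add: ra_def field_simps)
  ultimately have xy: "ra / 2 \<le> \<bar>x - y\<bar>" "\<bar>x - y\<bar> \<le> t" using r't t ra by linarith+
  have q: "x \<in> ?q" "y \<in> ?q" using x(1) y(1) child_subset_cell[OF r] i(1) j(1) by blast+
  define \<delta> where "\<delta> = phase \<phi> ?\<omega> y - phase \<phi> ?\<omega> x"
  have tP: "t * P = 1 / 5" using P0 by (simp add: t_def)
  have "\<bar>(y - x) * u ?\<omega>\<bar> = \<bar>x - y\<bar> * P" using dir by (simp add: abs_mult P_def abs_minus_commute)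
  moreover have "\<bar>\<delta> - (y - x) * u ?\<omega>\<bar> \<le> \<bar>x - y\<bar> * P / 4"
    using u[OF q(2,1), of ?\<omega>] by (simp add: \<delta>_def P_def abs_minus_commute)
  ultimately have \<delta>: "3 / 4 * (\<bar>x - y\<bar> * P) \<le> \<bar>\<delta>\<bar>" "\<bar>\<delta>\<bar> \<le> 5 / 4 * (\<bar>x - y\<bar> * P)" by linarith+
  have "\<bar>x - y\<bar> * P \<le> t * P" "ra / 2 * P \<le> \<bar>x - y\<bar> * P" using xy P0 by (auto intro: mult_right_mono)
  moreover have "ra / 2 * P = 1 / (40 * D)" using tP D by (simp add: ra_def field_simps)
  ultimately have \<delta>2: "3 / (160 * D) \<le> \<bar>\<delta>\<bar>" "\<bar>\<delta>\<bar> \<le> 1 / 4" using \<delta> tP by auto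
  have "wave \<phi> ?\<omega> x - wave \<phi> ?\<omega> y = wave \<phi> ?\<omega> y * (cis (2 * pi * \<delta>) - 1)"
    by (simp add: wave_def \<delta>_def right_diff_distrib cis_mult algebra_simps)
  then have "cmod (cis (2 * pi * \<delta>) - 1) \<le> 8 * lam" using V(2)[OF x(2) y(2)] by (simp add: norm_mult)
  then have "4 * \<bar>\<delta>\<bar> \<le> 8 * lam" using cmod_cis_minus_one_ge[OF \<delta>2(2)] by linarith
  \<comment> \<open>The role of the number 200 in \<open>lam\<close>: the turn is at least
    \<open>3 / (160 * D)\<close>, but near constancy of the wave on \<open>V\<close> allows at most
    \<open>2 * lam\<close>.\<close>
  then have "3 / (160 * D) \<le> 2 / (200 * D)" using \<delta>2(1) by (simp add: lam)
  then show False using D by (simp add: field_simps)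
qed

end

section \<open>Frequency boxes\<close>

text \<open>The two linear forms are the slopes of the phase of \<open>\<zeta>\<close> where the
  curve has slope \<open>c1\<close> and \<open>c2\<close>. For distinct slopes the balls are
  parallelograms; for equal slopes they would be strips.\<close>

definition strip_norm :: "real \<Rightarrow> real \<Rightarrow> real \<times> real \<Rightarrow> real" where
  "strip_norm c1 c2 \<zeta> = max \<bar>fst \<zeta> + c1 * snd \<zeta>\<bar> \<bar>fst \<zeta> + c2 * snd \<zeta>\<bar>"

definition strip_box :: "real \<Rightarrow> real \<Rightarrow> real \<Rightarrow> (real \<times> real) set" where
  "strip_box c1 c2 \<rho> = {\<zeta>. strip_norm c1 c2 \<zeta> \<le> \<rho>}"

lemma strip_norm_diff_le: "strip_norm c1 c2 (\<zeta> - \<zeta>') \<le> strip_norm c1 c2 \<zeta> + strip_norm c1 c2 \<zeta>'"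
  unfolding strip_norm_def by (auto simp: algebra_simps)

lemma strip_norm_scaleR: "strip_norm c1 c2 (t *\<^sub>R \<zeta>) = \<bar>t\<bar> * strip_norm c1 c2 \<zeta>"
proof -
  have "t * fst \<zeta> + c * (t * snd \<zeta>) = t * (fst \<zeta> + c * snd \<zeta>)" for c by (simp add: algebra_simps)
  then show ?thesis by (simp add: strip_norm_def abs_mult max_mult_distrib_left)
qed

lemma abs_snd_le_strip_norm:
  assumes "c1 \<noteq> c2" shows "\<bar>snd \<zeta>\<bar> \<le> 2 * strip_norm c1 c2 \<zeta> / \<bar>c1 - c2\<bar>"
proof -
  let ?N = "strip_norm c1 c2 \<zeta>"
  have "\<bar>fst \<zeta> + c1 * snd \<zeta>\<bar> \<le> ?N" "\<bar>fst \<zeta> + c2 * snd \<zeta>\<bar> \<le> ?N" by (auto simp: strip_norm_def)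
  moreover have "\<bar>c1 - c2\<bar> * \<bar>snd \<zeta>\<bar> = \<bar>(fst \<zeta> + c1 * snd \<zeta>) - (fst \<zeta> + c2 * snd \<zeta>)\<bar>"
    by (simp add: abs_mult[symmetric] algebra_simps)
  ultimately have "\<bar>c1 - c2\<bar> * \<bar>snd \<zeta>\<bar> \<le> 2 * ?N" by linarith
  then show ?thesis using assms by (simp add: field_simps)
qed

text \<open>Comparison factor between the euclidean norm and \<open>strip_norm\<close>. It blows up
  as the slopes coalesce and has to be tracked, because the arcs eventually used get closer as
  \<open>R\<close> grows.\<close>

definition stretch :: "real \<Rightarrow> real \<Rightarrow> real" where
  "stretch c1 c2 = 1 + 2 * (1 + \<bar>c1\<bar>) / \<bar>c1 - c2\<bar>"

lemma norm_le_strip_norm: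
  assumes "c1 \<noteq> c2"
  shows "norm \<zeta> \<le> stretch c1 c2 * strip_norm c1 c2 \<zeta>"
proof -
  let ?N = "strip_norm c1 c2 \<zeta>"
  have "\<bar>fst \<zeta>\<bar> \<le> \<bar>fst \<zeta> + c1 * snd \<zeta>\<bar> + \<bar>c1\<bar> * \<bar>snd \<zeta>\<bar>" by (simp add: abs_mult[symmetric])
  also have "\<dots> \<le> ?N + \<bar>c1\<bar> * \<bar>snd \<zeta>\<bar>" by (simp add: strip_norm_def)
  finally have "\<bar>fst \<zeta>\<bar> + \<bar>snd \<zeta>\<bar> \<le> ?N + (1 + \<bar>c1\<bar>) * \<bar>snd \<zeta>\<bar>" by (simp add: algebra_simps)
  also have "\<dots> \<le> ?N + (1 + \<bar>c1\<bar>) * (2 * ?N / \<bar>c1 - c2\<bar>)"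
    using abs_snd_le_strip_norm[OF assms] by (intro add_left_mono mult_left_mono) auto
  also have "\<dots> = stretch c1 c2 * ?N" by (simp add: stretch_def algebra_simps)
  finally show ?thesis using norm_Pair_le[of "fst \<zeta>" "snd \<zeta>"] by simp
qed

lemma strip_norm_measurable [measurable]: "strip_norm c1 c2 \<in> borel_measurable borel"
  unfolding strip_norm_def[abs_def]
  by (intro borel_measurable_continuous_onI continuous_intros)

lemma strip_box_sets [measurable, simp]: "strip_box c1 c2 \<rho> \<in> sets borel"
  unfolding strip_box_def by measurable

lemma emeasure_lborel_translate:
  fixes S :: "'a::euclidean_space set"
  assumes "S \<in> sets borel" shows "emeasure lborel {x. x - c \<in> S} = emeasure lborel S"
proof -
  have "emeasure (distr lborel borel ((+) (- c))) S = emeasure lborel ((+) (- c) -` S \<inter> space lborel)"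
    using assms by (intro emeasure_distr) auto
  moreover have "(+) (- c) -` S \<inter> space lborel = {x. x - c \<in> S}" by auto
  ultimately show ?thesis by (simp add: lborel_distr_plus)
qed

text \<open>Scaling in dimension two. Only ratios of areas matter later, so for the unit
  parallelogram positivity and finiteness of the area are enough.\<close>

lemma emeasure_strip_box:
  assumes "0 < \<rho>" shows "emeasure lborel (strip_box c1 c2 \<rho>) = ennreal (\<rho>\<^sup>2) * emeasure lborel (strip_box c1 c2 1)"
proof -
  have "emeasure lborel (strip_box c1 c2 \<rho>)
      = emeasure (density (distr lborel borel (\<lambda>x. 0 + \<rho> *\<^sub>R x)) (\<lambda>_. ennreal (\<bar>\<rho>\<bar> ^ DIM(real \<times> real)))) (strip_box c1 c2 \<rho>)"
    using assms by (subst lborel_affine[of \<rho> 0]) auto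
  also have "\<dots> = ennreal (\<rho>\<^sup>2) * emeasure (distr lborel borel (\<lambda>x. 0 + \<rho> *\<^sub>R x)) (strip_box c1 c2 \<rho>)"
    using assms by (subst emeasure_density_const) (auto simp: power2_eq_square)
  also have "emeasure (distr lborel borel (\<lambda>x. 0 + \<rho> *\<^sub>R x)) (strip_box c1 c2 \<rho>)
     = emeasure lborel ((\<lambda>x. 0 + \<rho> *\<^sub>R x) -` strip_box c1 c2 \<rho> \<inter> space lborel)"
    by (intro emeasure_distr) auto
  also have "(\<lambda>x. 0 + \<rho> *\<^sub>R x) -` strip_box c1 c2 \<rho> \<inter> space lborel = strip_box c1 c2 1"
    using assms by (auto simp: strip_box_def strip_norm_scaleR mult_le_cancel_left1)
  finally show ?thesis .
qed

lemma emeasure_strip_box_finite: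
  assumes "c1 \<noteq> c2" shows "emeasure lborel (strip_box c1 c2 \<rho>) < \<infinity>"
proof -
  let ?d = "stretch c1 c2"
  have "strip_box c1 c2 \<rho> \<subseteq> cball 0 (?d * \<rho>)"
  proof
    fix \<zeta> assume "\<zeta> \<in> strip_box c1 c2 \<rho>"
    then have "?d * strip_norm c1 c2 \<zeta> \<le> ?d * \<rho>" by (intro mult_left_mono) (auto simp: strip_box_def stretch_def)
    then show "\<zeta> \<in> cball 0 (?d * \<rho>)" using norm_le_strip_norm[OF assms, of \<zeta>] by simp
  qed
  then have "bounded (strip_box c1 c2 \<rho>)" by (rule bounded_subset[OF bounded_cball])
  then show ?thesis by (rule emeasure_bounded_finite)
qed

lemma emeasure_strip_box_pos: "0 < emeasure lborel (strip_box c1 c2 1)"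
proof -
  let ?S = "{\<zeta>. strip_norm c1 c2 \<zeta> < 1}"
  have "open ?S" unfolding strip_norm_def
    by (intro open_Collect_less continuous_intros)
  moreover have "(0, 0) \<in> ?S" by (simp add: strip_norm_def)
  ultimately have "emeasure lborel ?S \<noteq> 0"
    using open_not_negligible negligible_iff_null_sets null_sets_completionI by (metis empty_iff null_setsI sets_lborel borel_open)
  moreover have "emeasure lborel ?S \<le> emeasure lborel (strip_box c1 c2 1)"
    by (intro emeasure_mono) (auto simp: strip_box_def)
  ultimately show ?thesis by (metis le_zero_eq zero_less_iff_neq_zero)
qed

section \<open>Averages over frequency translates\<close>

lemma nn_integral_lborel_translate:
  fixes F :: "'a::euclidean_space \<Rightarrow> ennreal"
  assumes [measurable]: "F \<in> borel_measurable borel"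
  shows "(\<integral>\<^sup>+ x. F (x + c) \<partial>lborel) = (\<integral>\<^sup>+ x. F x \<partial>lborel)"
proof -
  have "(\<integral>\<^sup>+ x. F x \<partial>distr lborel borel ((+) c)) = (\<integral>\<^sup>+ x. F (c + x) \<partial>lborel)"
    by (intro nn_integral_distr) auto
  then show ?thesis by (simp add: lborel_distr_plus add.commute)
qed

text \<open>Tonelli and translation invariance. Cancellation holds for most frequencies of a box
  around a given one, not pointwise, so the integrand is replaced by its means over translates of
  \<open>Z\<close>; the price is an enlargement of the ball by the radius of
  \<open>Z\<close>.\<close>

lemma nn_integral_ball_le_translates:
  fixes F :: "real \<times> real \<Rightarrow> ennreal"
  assumes F [measurable]: "F \<in> borel_measurable borel" and Z [measurable]: "Z \<in> sets borel"
    and d: "\<And>\<zeta>. \<zeta> \<in> Z \<Longrightarrow> norm \<zeta> \<le> d"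
  shows "emeasure lborel Z * (\<integral>\<^sup>+ \<xi>\<in>ball 0 T. F \<xi> \<partial>lborel)
     \<le> (\<integral>\<^sup>+ \<xi>\<in>ball 0 (T + d). (\<integral>\<^sup>+ \<zeta>\<in>Z. F (\<xi> + \<zeta>) \<partial>lborel) \<partial>lborel)"
proof -
  have [measurable]: "ball (0 :: real \<times> real) S \<in> sets borel" for S by simp
  have meas: "(\<lambda>\<xi>. F \<xi> * indicator (ball 0 T) \<xi>) \<in> borel_measurable borel" by measurable
  have "emeasure lborel Z * (\<integral>\<^sup>+ \<xi>\<in>ball 0 T. F \<xi> \<partial>lborel)
     = (\<integral>\<^sup>+ \<zeta>. (\<integral>\<^sup>+ \<xi>. F \<xi> * indicator (ball 0 T) \<xi> \<partial>lborel) * indicator Z \<zeta> \<partial>lborel)"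
    by (subst nn_integral_cmult) (auto simp: mult.commute)
  also have "\<dots> = (\<integral>\<^sup>+ \<zeta>. (\<integral>\<^sup>+ \<xi>. F (\<xi> + \<zeta>) * indicator (ball 0 T) (\<xi> + \<zeta>) \<partial>lborel) * indicator Z \<zeta> \<partial>lborel)"
    by (simp only: nn_integral_lborel_translate[OF meas])
  also have "\<dots> \<le> (\<integral>\<^sup>+ \<zeta>. (\<integral>\<^sup>+ \<xi>. F (\<xi> + \<zeta>) * indicator (ball 0 (T + d)) \<xi> * indicator Z \<zeta> \<partial>lborel) \<partial>lborel)"
  proof (rule nn_integral_mono)
    fix \<zeta> :: "real \<times> real"
    have "(\<integral>\<^sup>+ \<xi>. F (\<xi> + \<zeta>) * indicator (ball 0 T) (\<xi> + \<zeta>) \<partial>lborel)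
       \<le> (\<integral>\<^sup>+ \<xi>. F (\<xi> + \<zeta>) * indicator (ball 0 (T + d)) \<xi> * indicator Z \<zeta> \<partial>lborel)" if "\<zeta> \<in> Z"
    proof (intro nn_integral_mono)
      fix \<xi> :: "real \<times> real"
      have "norm \<xi> < T + d" if "norm (\<xi> + \<zeta>) < T"
        using that d[OF \<open>\<zeta> \<in> Z\<close>] norm_triangle_ineq4[of "\<xi> + \<zeta>" \<zeta>] by simp
      then show "F (\<xi> + \<zeta>) * indicator (ball 0 T) (\<xi> + \<zeta>) \<le> F (\<xi> + \<zeta>) * indicator (ball 0 (T + d)) \<xi> * indicator Z \<zeta>"
        using \<open>\<zeta> \<in> Z\<close> by (auto simp: indicator_def)
    qed
    then show "(\<integral>\<^sup>+ \<xi>. F (\<xi> + \<zeta>) * indicator (ball 0 T) (\<xi> + \<zeta>) \<partial>lborel) * indicator Z \<zeta>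
       \<le> (\<integral>\<^sup>+ \<xi>. F (\<xi> + \<zeta>) * indicator (ball 0 (T + d)) \<xi> * indicator Z \<zeta> \<partial>lborel)"
      by (cases "\<zeta> \<in> Z") auto
  qed
  also have "\<dots> = (\<integral>\<^sup>+ \<xi>. (\<integral>\<^sup>+ \<zeta>. F (\<xi> + \<zeta>) * indicator (ball 0 (T + d)) \<xi> * indicator Z \<zeta> \<partial>lborel) \<partial>lborel)"
    by (rule lborel_pair.Fubini') measurable
  also have "\<dots> = (\<integral>\<^sup>+ \<xi>\<in>ball 0 (T + d). (\<integral>\<^sup>+ \<zeta>\<in>Z. F (\<xi> + \<zeta>) \<partial>lborel) \<partial>lborel)"
    by (intro nn_integral_cong) (simp add: indicator_def)
  finally show ?thesis .
qed

context curve_measure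
begin

section \<open>Mass concentrated near the endpoints of a cell\<close>

definition triple :: "real \<Rightarrow> real \<Rightarrow> real" where
  "triple a r = measure \<mu> {a - r..<a + 2 * r}"

text \<open>The value 1 for null cells only serves to make the ratio positive.\<close>

definition spread :: "real \<Rightarrow> real \<Rightarrow> real" where
  "spread a r = (if measure \<mu> (cell a r) = 0 then 1 else triple a r / measure \<mu> (cell a r))"

text \<open>Taken at the unshifted frequency \<open>\<xi>\<close>, this is a common bound for the
  cell at all \<open>\<xi> + \<zeta>\<close> with small \<open>\<zeta>\<close>
  (\<open>avgsup_le_rms\<close>). It is a quadratic mean for the sake of
  \<open>weight_of_deficient_terms\<close>.\<close>

definition rms :: "nat \<Rightarrow> real \<Rightarrow> real \<Rightarrow> real \<Rightarrow> real \<times> real \<Rightarrow> real" where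
  "rms b lam a r \<xi> = sqrt (\<Sum>i<b. measure \<mu> (child a r b i) / measure \<mu> (cell a r) * (avgsup (child a r b i) (lam * b / r) \<xi>)\<^sup>2)"

lemma triple_nonneg: "0 \<le> triple a r"
  by (simp add: triple_def)

lemma spread_ge_1: "0 < r \<Longrightarrow> 1 \<le> spread a r"
  using finite_measure_mono[of "cell a r" "{a - r..<a + 2 * r}"]
  by (auto simp: spread_def triple_def cell_def le_divide_eq_1 zero_less_measure_iff)

lemma measure_times_spread: "measure \<mu> (cell a r) * spread a r \<le> triple a r"
  by (simp add: spread_def triple_nonneg)

text \<open>Each triple consists of three adjacent cells of length \<open>r / b\<close>; summed over
  \<open>i\<close> they give the masses of three translates of the whole cell, by
  \<open>- r / b\<close>, 0 and \<open>r / b\<close>.\<close>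

lemma sum_triple_le:
  assumes r: "0 < r" "0 < b"
  shows "(\<Sum>i<b. triple (a + real i * (r / b)) (r / b)) \<le> 3 * measure \<mu> {a - r / b..<a + r + r / b}"
proof -
  let ?d = "r / b"
  have d: "0 < ?d" using r by simp
  have split: "triple (a + real i * ?d) ?d
     = measure \<mu> (child (a - ?d) r b i) + measure \<mu> (child a r b i) + measure \<mu> (child (a + ?d) r b i)" for i
  proof -
    have three: "measure \<mu> {x - e..<x + 2 * e} = measure \<mu> (cell (x - e) e) + measure \<mu> (cell x e) + measure \<mu> (cell (x + e) e)"
      if "0 < e" for x e
    proof -
      have "{x - e..<x + 2 * e} = (cell (x - e) e \<union> cell x e) \<union> cell (x + e) e"
        using that by (auto simp: cell_def)
      moreover have "measure \<mu> ((cell (x - e) e \<union> cell x e) \<union> cell (x + e) e)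
          = measure \<mu> (cell (x - e) e \<union> cell x e) + measure \<mu> (cell (x + e) e)"
        using that by (intro finite_measure_Union) (auto simp: cell_def)
      moreover have "measure \<mu> (cell (x - e) e \<union> cell x e) = measure \<mu> (cell (x - e) e) + measure \<mu> (cell x e)"
        by (intro finite_measure_Union) (auto simp: cell_def)
      ultimately show ?thesis by simp
    qed
    show ?thesis unfolding triple_def three[OF d] by (simp add: child_def add_ac diff_add_eq)
  qed
  have "(\<Sum>i<b. triple (a + real i * ?d) ?d)
     = measure \<mu> (cell (a - ?d) r) + measure \<mu> (cell a r) + measure \<mu> (cell (a + ?d) r)"
    unfolding split by (simp add: sum.distrib measure_cell_sum[OF r])
  also have "\<dots> \<le> 3 * measure \<mu> {a - ?d..<a + r + ?d}"
    using d finite_measure_mono[of "cell (a - ?d) r" "{a - ?d..<a + r + ?d}"]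
      finite_measure_mono[of "cell a r" "{a - ?d..<a + r + ?d}"]
      finite_measure_mono[of "cell (a + ?d) r" "{a - ?d..<a + r + ?d}"]
    by (simp add: cell_def subset_eq)
  finally show ?thesis .
qed

lemma sum_triple_le_triple:
  assumes r: "0 < r" "0 < b" shows "(\<Sum>i<b. triple (a + real i * (r / b)) (r / b)) \<le> 3 * triple a r"
proof -
  have "r / b \<le> r" using r by (simp add: divide_le_eq)
  then have "measure \<mu> {a - r / b..<a + r + r / b} \<le> triple a r"
    unfolding triple_def by (intro finite_measure_mono) auto
  then show ?thesis using sum_triple_le[OF r, of a] by simp
qed

text \<open>If the interior has less than half of the mass, the slightly enlarged cell has at most
  twice the mass of the two small balls around the endpoints, and growth makes these small compared
  with the triple, though not with the cell itself. The number 12 is \<open>3 * 2 * 2\<close>: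
  overlap of the triples, the factor for the interior, two endpoints.\<close>

lemma sum_triple_le_of_edge_mass:
  assumes r: "0 < r" "0 < b" and g: "3 \<le> g" "g \<le> b" and A: "0 \<le> A"
    and growth: "\<And>x. x \<in> {a, a + r} \<Longrightarrow> measure \<mu> (ball x (3 * r / g)) \<le> A * (3 / g) powr al * measure \<mu> (ball x r)"
    and edge: "2 * measure \<mu> {a + 2 * r / g..<a + r - 2 * r / g} < measure \<mu> (cell a r)"
  shows "(\<Sum>i<b. triple (a + real i * (r / b)) (r / b)) \<le> 12 * A * (3 / g) powr al * triple a r"
proof -
  let ?e = "r / g" and ?Y = "{a + 2 * r / g..<a + r - 2 * r / g}"
  let ?B = "measure \<mu> (ball a (3 * r / g)) + measure \<mu> (ball (a + r) (3 * r / g))"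
  have e: "0 < ?e" "r / b \<le> ?e" using r g by (auto intro: divide_left_mono)
  have U: "measure \<mu> S \<le> ?B + measure \<mu> ?Y" if "S \<subseteq> {a - r / b..<a + r + r / b}" for S
  proof -
    have "S \<subseteq> (ball a (3 * r / g) \<union> ball (a + r) (3 * r / g)) \<union> ?Y"
    proof
      fix x assume "x \<in> S"
      then have x: "a - ?e \<le> x" "x < a + r + ?e" using that e by auto
      have "x \<in> ball a (3 * ?e) \<or> x \<in> ball (a + r) (3 * ?e) \<or> a + 2 * ?e \<le> x \<and> x < a + r - 2 * ?e"
        using x e unfolding mem_ball dist_real_def by arith
      then show "x \<in> (ball a (3 * r / g) \<union> ball (a + r) (3 * r / g)) \<union> ?Y" by auto
    qed
    then have "measure \<mu> S \<le> measure \<mu> ((ball a (3 * r / g) \<union> ball (a + r) (3 * r / g)) \<union> ?Y)"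
      by (intro finite_measure_mono) auto
    also have "\<dots> \<le> measure \<mu> (ball a (3 * r / g) \<union> ball (a + r) (3 * r / g)) + measure \<mu> ?Y"
      by (intro measure_Un_le) auto
    also have "measure \<mu> (ball a (3 * r / g) \<union> ball (a + r) (3 * r / g)) \<le> ?B"
      by (intro measure_Un_le) auto
    finally show ?thesis by simp
  qed
  have "r / b > 0" using r by simp
  then have "cell a r \<subseteq> {a - r / b..<a + r + r / b}" by (auto simp: cell_def)
  then have "measure \<mu> (cell a r) \<le> ?B + measure \<mu> ?Y" by (rule U)
  then have "measure \<mu> ?Y \<le> ?B" using edge by linarith
  then have "measure \<mu> {a - r / b..<a + r + r / b} \<le> ?B + ?B" using U[OF order_refl] by (meson add_left_mono order_trans)
  moreover have "?B \<le> A * (3 / g) powr al * triple a r + A * (3 / g) powr al * triple a r"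
  proof (intro add_mono)
    have tr: "measure \<mu> (ball a r) \<le> triple a r" "measure \<mu> (ball (a + r) r) \<le> triple a r"
      unfolding triple_def using r by (auto intro!: finite_measure_mono simp: dist_real_def)
    have "0 \<le> A * (3 / g) powr al" using A by simp
    then show "measure \<mu> (ball a (3 * r / g)) \<le> A * (3 / g) powr al * triple a r"
      "measure \<mu> (ball (a + r) (3 * r / g)) \<le> A * (3 / g) powr al * triple a r"
      by (meson growth insertI1 insertI2 mult_left_mono order_trans tr)+
  qed
  ultimately have "measure \<mu> {a - r / b..<a + r + r / b} \<le> 4 * (A * (3 / g) powr al * triple a r)" by linarith
  then show ?thesis using sum_triple_le[OF r, of a] by (simp add: mult.assoc)
qed

text \<open>\<open>weighted_Hoelder\<close> with exponent \<open>p / 2\<close>, because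
  \<open>rms\<close> contains squares, and with the spreads of the children as \<open>y\<close>;
  their mean is at most the sum of the triples divided by the mass of the cell.\<close>

lemma rms_powr_le:
  assumes r: "0 < r" "0 < b" and lam: "0 \<le> lam" and p: "0 < C" "2 * (C + 1) \<le> p" and m: "0 < measure \<mu> (cell a r)"
  shows "rms b lam a r \<xi> powr p \<le> ((\<Sum>i<b. triple (a + real i * (r / b)) (r / b)) / measure \<mu> (cell a r)) powr C
     * (\<Sum>i<b. measure \<mu> (child a r b i) / measure \<mu> (cell a r) * spread (a + real i * (r / b)) (r / b) powr (- C)
          * avgsup (child a r b i) (lam * b / r) \<xi> powr p)"
proof -
  define w where "w i = measure \<mu> (child a r b i) / measure \<mu> (cell a r)" for i
  define y where "y i = spread (a + real i * (r / b)) (r / b)" for i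
  define s where "s i = avgsup (child a r b i) (lam * b / r) \<xi>" for i
  have s: "0 \<le> s i" for i using lam r by (simp add: s_def avgsup_nonneg)
  have y: "1 \<le> y i" for i using r by (simp add: y_def spread_ge_1)
  have w: "0 \<le> w i" "sum w {..<b} = 1" for i
    using m by (simp_all add: w_def sum_divide_distrib[symmetric] measure_cell_sum[OF r, symmetric])
  have "rms b lam a r \<xi> powr p = (\<Sum>i<b. w i * (s i)\<^sup>2) powr (p / 2)"
    using w s by (simp add: rms_def w_def s_def powr_half_sqrt[symmetric] powr_powr sum_nonneg)
  also have "\<dots> \<le> (\<Sum>i<b. w i * y i) powr C * (\<Sum>i<b. w i * y i powr (- C) * (s i)\<^sup>2 powr (p / 2))"
    using p w y by (intro weighted_Hoelder) (auto intro: less_le_trans[OF zero_less_one])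
  also have "(\<Sum>i<b. w i * y i powr (- C) * (s i)\<^sup>2 powr (p / 2)) = (\<Sum>i<b. w i * y i powr (- C) * s i powr p)"
    using s by (intro sum.cong) (auto simp: powr_powr simp flip: powr_numeral)
  also have "(\<Sum>i<b. w i * y i) powr C \<le> ((\<Sum>i<b. triple (a + real i * (r / b)) (r / b)) / measure \<mu> (cell a r)) powr C"
  proof (intro powr_mono2)
    show "(\<Sum>i<b. w i * y i) \<le> (\<Sum>i<b. triple (a + real i * (r / b)) (r / b)) / measure \<mu> (cell a r)"
      unfolding sum_divide_distrib w_def y_def child_def using m
      by (intro sum_mono) (auto intro!: divide_right_mono measure_times_spread)
    show "0 \<le> (\<Sum>i<b. w i * y i)" using w y by (intro sum_nonneg) (meson mult_nonneg_nonneg order_trans zero_le_one)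
  qed (use p in auto)
  finally show ?thesis using w by (simp add: w_def y_def s_def mult_right_mono sum_nonneg)
qed

lemma avgsup_le_rms:
  assumes r: "0 < r" "4 \<le> b" and lam: "0 < lam"
    and lip: "\<And>x y. x \<in> cell a r \<Longrightarrow> y \<in> cell a r \<Longrightarrow> 2 * pi * \<bar>phase \<phi> \<zeta> x - phase \<phi> \<zeta> y\<bar> \<le> lam * b / (4 * r) * \<bar>x - y\<bar>"
  shows "avgsup (cell a r) (lam / r) (\<xi> + \<zeta>) \<le> rms b lam a r \<xi>"
proof (cases "measure \<mu> (cell a r) = 0")
  case True
  then show ?thesis using r by (simp add: avgsup_def rms_def)
next
  case False
  have b: "0 < b" using r by simp
  define w where "w i = measure \<mu> (child a r b i) / measure \<mu> (cell a r)" for i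
  define s where "s i = avgsup (child a r b i) (lam * b / r) \<xi>" for i
  have s: "0 \<le> s i" for i using lam r by (simp add: s_def avgsup_nonneg)
  have w: "0 \<le> w i" "sum w {..<b} = 1" for i
    using False by (simp_all add: w_def sum_divide_distrib[symmetric] measure_cell_sum[OF r(1) b, symmetric])
  have "lam / r + lam * b / (4 * r) \<le> lam * b / r"
  proof -
    have "4 * lam \<le> b * lam" using r lam by (intro mult_right_mono) auto
    then show ?thesis using r mult_right_mono[of "4 * lam" "b * lam" r] mult_right_mono[of 0 lam r] lam by (simp add: field_simps)
  qed
  then have "avgsup (cell a r) (lam / r) (\<xi> + \<zeta>) \<le> (\<Sum>i<b. w i * s i)"
    unfolding w_def s_def using r lam lip b by (intro avgsup_shift_le) auto
  also have "\<dots> \<le> sqrt (\<Sum>i<b. w i * (s i)\<^sup>2)"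
    using powr_mean_le[of "{..<b}" w s 2] w s by (intro real_le_rsqrt) (simp add: sum_nonneg)
  finally show ?thesis by (simp add: rms_def w_def s_def)
qed

end

section \<open>Transversal pairs of arcs\<close>

text \<open>
  \<open>edge_gain\<close> makes the weight exponent \<open>C\<close> so large that cells with an empty interior gain \<open>b\<^sup>-\<^sup>2\<close>, and \<open>gain\<close> makes
  \<open>p\<close> so large that frequencies with cancellation gain \<open>b\<^sup>-\<^sup>2\<close>. This is the ratio of the areas of the frequency
  boxes of two consecutive scales, so that \<open>loss\<close> below is optimal up to \<open>g\<^sup>2\<close> and constants.
\<close>

locale growth_measure = curve_measure \<mu> \<phi> for \<mu> \<phi> +
  fixes b :: nat and A al r0 D lam g C p :: real
  assumes b: "4 \<le> b" and D: "1 \<le> D" and lam: "lam = 1 / (200 * D)" and g: "3 \<le> g" "g \<le> b" and A: "0 \<le> A"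
    and C: "0 < C" and p: "2 * (C + 1) \<le> p"
    and gain: "(1 - lam\<^sup>2 / 8 / (32 * real b)) powr p \<le> 1 / (real b)\<^sup>2"
    and edge_gain: "(12 * A * (3 / g) powr al) powr C \<le> 1 / (real b)\<^sup>2"
    and growth: "\<And>x \<rho> r'. x \<in> {-2..2} \<Longrightarrow> 0 < \<rho> \<Longrightarrow> \<rho> \<le> r' \<Longrightarrow> r' \<le> r0 \<Longrightarrow>
      measure \<mu> (ball x \<rho>) \<le> A * (\<rho> / r') powr al * measure \<mu> (ball x r')"
    and doubling: "\<And>x \<rho>. x \<in> {-2..2} \<Longrightarrow> 0 < \<rho> \<Longrightarrow> D * \<rho> \<le> r0 \<Longrightarrow>
      2 * measure \<mu> (ball x \<rho>) \<le> measure \<mu> (ball x (D * \<rho>))"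
begin

lemma b_pos: "0 < b"
  using b by simp

lemma lam_pos: "0 < lam"
  using D by (simp add: lam)

lemma p_pos: "0 < p"
  using C p by argo

definition \<eta> :: real where
  "\<eta> = lam\<^sup>2 / 8 / (32 * real b)"

text \<open>\<open>9 powr C\<close> comes from the threefold overlap of triples in each of two
  cells, \<open>64 / lam\<^sup>2\<close> from the area of the exceptional parallelogram relative to
  the frequency box, and the summand 1 from the frequencies outside it.\<close>

definition loss :: real where
  "loss = 9 powr C * (64 / lam\<^sup>2 + 1) * (g / b)\<^sup>2"

definition amp :: "real \<Rightarrow> real \<Rightarrow> real \<Rightarrow> real \<times> real \<Rightarrow> real" where
  "amp a1 a2 r \<xi> = (avgsup (cell a1 r) (lam / r) \<xi> * avgsup (cell a2 r) (lam / r) \<xi>) powr p"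

definition interior_heavy :: "real \<Rightarrow> real \<Rightarrow> bool" where
  "interior_heavy a r \<longleftrightarrow> measure \<mu> (cell a r) \<le> 2 * measure \<mu> {a + 2 * r / g..<a + r - 2 * r / g}"

lemma \<eta>_bounds: "0 \<le> \<eta>" "\<eta> \<le> 1"
proof -
  have "lam \<le> 1" using D by (simp add: lam divide_le_eq)
  then have "lam\<^sup>2 \<le> 1" using lam_pos by (simp add: power_le_one)
  moreover have "256 * 1 \<le> 256 * real b" using b by (intro mult_left_mono) auto
  ultimately show "0 \<le> \<eta>" "\<eta> \<le> 1" by (auto simp: \<eta>_def divide_le_eq)
qed

lemma loss_nonneg: "0 \<le> loss"
  by (simp add: loss_def)

text \<open>The dichotomy behind the weights: in general the passage to the children costs the
  overlap factor \<open>3 powr C\<close>, and the gain has to come from cancellation; a cell with a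
  light interior gains through the weights alone.\<close>

lemma sum_triple_powr_le:
  assumes r: "0 < r" "r \<le> r0" and a: "-2 \<le> a" "a + r \<le> 2" and m: "0 < measure \<mu> (cell a r)"
  shows "((\<Sum>i<b. triple (a + real i * (r / b)) (r / b)) / measure \<mu> (cell a r)) powr C \<le> (3 powr C) * spread a r powr C"
    and "\<not> interior_heavy a r \<Longrightarrow>
      ((\<Sum>i<b. triple (a + real i * (r / b)) (r / b)) / measure \<mu> (cell a r)) powr C \<le> 1 / (real b)\<^sup>2 * spread a r powr C"
proof -
  let ?T = "\<Sum>i<b. triple (a + real i * (r / b)) (r / b)" and ?m = "measure \<mu> (cell a r)"
  have T: "0 \<le> ?T" by (intro sum_nonneg triple_nonneg)
  have sp: "spread a r = triple a r / ?m" "0 \<le> spread a r" using m triple_nonneg by (auto simp: spread_def)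
  have "?T / ?m \<le> 3 * spread a r"
    using sum_triple_le_triple[OF r(1) b_pos, of a] m by (simp add: sp divide_right_mono)
  then have "(?T / ?m) powr C \<le> (3 * spread a r) powr C" using T m C by (intro powr_mono2) auto
  then show "(?T / ?m) powr C \<le> 3 powr C * spread a r powr C" by (simp only: powr_mult)
  assume "\<not> interior_heavy a r"
  then have "?T \<le> 12 * A * (3 / g) powr al * triple a r"
    using growth[of a "3 * r / g" r] growth[of "a + r" "3 * r / g" r] r a g
    by (intro sum_triple_le_of_edge_mass[OF r(1) b_pos g A]) (auto simp: interior_heavy_def divide_le_eq)
  then have "?T / ?m \<le> 12 * A * (3 / g) powr al * spread a r"
    using m by (simp add: sp divide_right_mono)
  then have "(?T / ?m) powr C \<le> (12 * A * (3 / g) powr al * spread a r) powr C" using T m C by (intro powr_mono2) auto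
  also have "\<dots> = (12 * A * (3 / g) powr al) powr C * spread a r powr C" by (rule powr_mult)
  also have "\<dots> \<le> 1 / (real b)\<^sup>2 * spread a r powr C" using edge_gain by (intro mult_right_mono) auto
  finally show "(?T / ?m) powr C \<le> 1 / (real b)\<^sup>2 * spread a r powr C" .
qed

end

text \<open>\<open>phase1\<close> and \<open>phase2\<close> say that along each arc the phase is
  linear up to an error of a quarter of \<open>strip_norm\<close>. The error is measured by the norm
  built from both slopes, so along one arc it may exceed the linear term; the linear term is sure to
  dominate only on an arc whose form attains the maximum.\<close>

locale arc_pair = growth_measure \<mu> \<phi> b A al r0 D lam g C p
  for \<mu> \<phi> b A al r0 D lam g C p +
  fixes c1 c2 l1 h1 l2 h2 :: real
  assumes c12: "c1 \<noteq> c2" and arcs: "-2 \<le> l1" "h1 \<le> 2" "-2 \<le> l2" "h2 \<le> 2"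
    and phase1: "\<And>\<zeta> x y. x \<in> {l1..<h1} \<Longrightarrow> y \<in> {l1..<h1} \<Longrightarrow>
      \<bar>phase \<phi> \<zeta> x - phase \<phi> \<zeta> y - (x - y) * (fst \<zeta> + c1 * snd \<zeta>)\<bar> \<le> \<bar>x - y\<bar> * strip_norm c1 c2 \<zeta> / 4"
    and phase2: "\<And>\<zeta> x y. x \<in> {l2..<h2} \<Longrightarrow> y \<in> {l2..<h2} \<Longrightarrow>
      \<bar>phase \<phi> \<zeta> x - phase \<phi> \<zeta> y - (x - y) * (fst \<zeta> + c2 * snd \<zeta>)\<bar> \<le> \<bar>x - y\<bar> * strip_norm c1 c2 \<zeta> / 4"
begin

lemma avgsup_le_rms_1:
  assumes "0 < r" "l1 \<le> a" "a + r \<le> h1" "\<zeta> \<in> strip_box c1 c2 (lam * b / (40 * r))"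
  shows "avgsup (cell a r) (lam / r) (\<xi> + \<zeta>) \<le> rms b lam a r \<xi>"
proof (rule avgsup_le_rms[OF assms(1) b lam_pos])
  fix x y assume "x \<in> cell a r" "y \<in> cell a r"
  then have xy: "x \<in> {l1..<h1}" "y \<in> {l1..<h1}" using assms by (auto simp: cell_def)
  have N: "strip_norm c1 c2 \<zeta> \<le> lam * b / (40 * r)" using assms(4) by (simp add: strip_box_def)
  show "2 * pi * \<bar>phase \<phi> \<zeta> x - phase \<phi> \<zeta> y\<bar> \<le> lam * b / (4 * r) * \<bar>x - y\<bar>"
    by (rule phase_lipschitz[where u="\<lambda>\<zeta>. fst \<zeta> + c1 * snd \<zeta>", OF phase1 _ xy N]) (auto simp: strip_norm_def)
qed

lemma avgsup_le_rms_2: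
  assumes "0 < r" "l2 \<le> a" "a + r \<le> h2" "\<zeta> \<in> strip_box c1 c2 (lam * b / (40 * r))"
  shows "avgsup (cell a r) (lam / r) (\<xi> + \<zeta>) \<le> rms b lam a r \<xi>"
proof (rule avgsup_le_rms[OF assms(1) b lam_pos])
  fix x y assume "x \<in> cell a r" "y \<in> cell a r"
  then have xy: "x \<in> {l2..<h2}" "y \<in> {l2..<h2}" using assms by (auto simp: cell_def)
  have N: "strip_norm c1 c2 \<zeta> \<le> lam * b / (40 * r)" using assms(4) by (simp add: strip_box_def)
  show "2 * pi * \<bar>phase \<phi> \<zeta> x - phase \<phi> \<zeta> y\<bar> \<le> lam * b / (4 * r) * \<bar>x - y\<bar>"
    by (rule phase_lipschitz[where u="\<lambda>\<zeta>. fst \<zeta> + c2 * snd \<zeta>", OF phase2 _ xy N]) (auto simp: strip_norm_def)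
qed

text \<open>Transversality enters here. The argument on one arc requires that the full size of
  \<open>\<zeta> - \<zeta>'\<close> be visible as the slope of the phase there; the maximum in
  \<open>strip_norm\<close> is attained by one of the two forms, and the arc with that slope is
  used.\<close>

lemma extremal_frequencies_close:
  assumes r: "0 < r" "r \<le> r0" and a: "l1 \<le> a1" "a1 + r \<le> h1" "l2 \<le> a2" "a2 + r \<le> h2"
    and m: "0 < measure \<mu> (cell a1 r)" "0 < measure \<mu> (cell a2 r)"
    and heavy: "interior_heavy a1 r" "interior_heavy a2 r"
    and \<zeta>: "\<zeta> \<in> strip_box c1 c2 (lam * b / (40 * r))" "\<zeta>' \<in> strip_box c1 c2 (lam * b / (40 * r))"
    and bad: "(1 - \<eta>) * rms b lam a1 r \<xi> < avgsup (cell a1 r) (lam / r) (\<xi> + \<zeta>)"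
      "(1 - \<eta>) * rms b lam a1 r \<xi> < avgsup (cell a1 r) (lam / r) (\<xi> + \<zeta>')"
      "(1 - \<eta>) * rms b lam a2 r \<xi> < avgsup (cell a2 r) (lam / r) (\<xi> + \<zeta>)"
      "(1 - \<eta>) * rms b lam a2 r \<xi> < avgsup (cell a2 r) (lam / r) (\<xi> + \<zeta>')"
  shows "\<zeta> - \<zeta>' \<in> strip_box c1 c2 (g / (5 * r))"
proof -
  have small: "strip_norm c1 c2 \<zeta> \<le> lam * b / (40 * r)" "strip_norm c1 c2 \<zeta>' \<le> lam * b / (40 * r)"
    using \<zeta> by (auto simp: strip_box_def)
  have g0: "0 < g" using g by simp
  consider "strip_norm c1 c2 (\<zeta> - \<zeta>') = \<bar>fst (\<zeta> - \<zeta>') + c1 * snd (\<zeta> - \<zeta>')\<bar>"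
    | "strip_norm c1 c2 (\<zeta> - \<zeta>') = \<bar>fst (\<zeta> - \<zeta>') + c2 * snd (\<zeta> - \<zeta>')\<bar>"
    unfolding strip_norm_def by linarith
  then have "strip_norm c1 c2 (\<zeta> - \<zeta>') \<le> g / (5 * r)"
  proof cases
    case 1
    show ?thesis
    proof (rule near_extremal_frequencies_localised[where N="strip_norm c1 c2" and u="\<lambda>\<zeta>. fst \<zeta> + c1 * snd \<zeta>",
          OF r(1) b D lam refl \<eta>_def m(1) _ g0 heavy(1)[unfolded interior_heavy_def] _ _ strip_norm_diff_le small rms_def bad(1,2) 1[symmetric]])
      show "2 * measure \<mu> (ball x \<rho>) \<le> measure \<mu> (ball x (D * \<rho>))" if "x \<in> cell a1 r" "0 < \<rho>" "D * \<rho> \<le> r" for x \<rho>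
        using doubling[of x \<rho>] that a arcs r by (auto simp: cell_def)
      show "\<bar>phase \<phi> \<zeta> x - phase \<phi> \<zeta> y - (x - y) * (fst \<zeta> + c1 * snd \<zeta>)\<bar> \<le> \<bar>x - y\<bar> * strip_norm c1 c2 \<zeta> / 4"
        if "x \<in> cell a1 r" "y \<in> cell a1 r" for \<zeta> x y
        using phase1[of x y] that a by (auto simp: cell_def)
    qed (simp add: strip_norm_def)
  next
    case 2
    show ?thesis
    proof (rule near_extremal_frequencies_localised[where N="strip_norm c1 c2" and u="\<lambda>\<zeta>. fst \<zeta> + c2 * snd \<zeta>",
          OF r(1) b D lam refl \<eta>_def m(2) _ g0 heavy(2)[unfolded interior_heavy_def] _ _ strip_norm_diff_le small rms_def bad(3,4) 2[symmetric]])
      show "2 * measure \<mu> (ball x \<rho>) \<le> measure \<mu> (ball x (D * \<rho>))" if "x \<in> cell a2 r" "0 < \<rho>" "D * \<rho> \<le> r" for x \<rho>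
        using doubling[of x \<rho>] that a arcs r by (auto simp: cell_def)
      show "\<bar>phase \<phi> \<zeta> x - phase \<phi> \<zeta> y - (x - y) * (fst \<zeta> + c2 * snd \<zeta>)\<bar> \<le> \<bar>x - y\<bar> * strip_norm c1 c2 \<zeta> / 4"
        if "x \<in> cell a2 r" "y \<in> cell a2 r" for \<zeta> x y
        using phase2[of x y] that a by (auto simp: cell_def)
    qed (simp add: strip_norm_def)
  qed
  then show ?thesis by (simp add: strip_box_def)
qed

text \<open>Frequencies of \<open>Z\<close> that are nearly extremal for both cells at once lie in
  one small parallelogram. At every other frequency at least one of the two factors loses
  \<open>1 - \<eta>\<close>, which \<open>gain\<close> converts into
  \<open>1 / b\<^sup>2\<close>.\<close>

lemma amp_average_le_rms:
  assumes r: "0 < r" "r \<le> r0" and a: "l1 \<le> a1" "a1 + r \<le> h1" "l2 \<le> a2" "a2 + r \<le> h2"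
    and m: "0 < measure \<mu> (cell a1 r)" "0 < measure \<mu> (cell a2 r)"
    and heavy: "interior_heavy a1 r" "interior_heavy a2 r"
  defines "Z \<equiv> strip_box c1 c2 (lam * b / (40 * r))"
  shows "(\<integral>\<^sup>+ \<zeta>\<in>Z. ennreal (amp a1 a2 r (\<xi> + \<zeta>)) \<partial>lborel)
    \<le> emeasure lborel Z * ennreal ((64 / lam\<^sup>2 + 1) * (g / b)\<^sup>2 * (rms b lam a1 r \<xi> * rms b lam a2 r \<xi>) powr p)"
proof -
  let ?\<rho> = "lam * b / (40 * r)"
  let ?s1 = "\<lambda>\<zeta>. avgsup (cell a1 r) (lam / r) (\<xi> + \<zeta>)" and ?s2 = "\<lambda>\<zeta>. avgsup (cell a2 r) (lam / r) (\<xi> + \<zeta>)"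
  let ?R1 = "rms b lam a1 r \<xi>" and ?R2 = "rms b lam a2 r \<xi>"
  define X where "X = (?R1 * ?R2) powr p"
  have X: "0 \<le> X" by (simp add: X_def)
  have \<rho>: "0 < ?\<rho>" using r b_pos lam_pos by simp
  have s: "0 \<le> ?s1 \<zeta>" "0 \<le> ?s2 \<zeta>" for \<zeta> using r lam_pos by (auto intro!: avgsup_nonneg)
  have R: "?s1 \<zeta> \<le> ?R1" "?s2 \<zeta> \<le> ?R2" if "\<zeta> \<in> Z" for \<zeta>
    using that r a by (auto simp: Z_def intro: avgsup_le_rms_1 avgsup_le_rms_2)
  have R0: "0 \<le> ?R1" "0 \<le> ?R2" by (auto simp: rms_def intro!: sum_nonneg)
  have F1: "amp a1 a2 r (\<xi> + \<zeta>) \<le> X" if "\<zeta> \<in> Z" for \<zeta>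
    unfolding amp_def X_def using R[OF that] s[of \<zeta>] R0 p_pos by (intro powr_mono2 mult_mono mult_nonneg_nonneg) auto
  define B where "B = {\<zeta> \<in> Z. (1 - \<eta>) * ?R1 < ?s1 \<zeta> \<and> (1 - \<eta>) * ?R2 < ?s2 \<zeta>}"
  have F2: "amp a1 a2 r (\<xi> + \<zeta>) \<le> X / (real b)\<^sup>2" if "\<zeta> \<in> Z" "\<zeta> \<notin> B" for \<zeta>
  proof -
    have "?s1 \<zeta> * ?s2 \<zeta> \<le> (1 - \<eta>) * (?R1 * ?R2)"
    proof (cases "?s1 \<zeta> \<le> (1 - \<eta>) * ?R1")
      case True
      then have "?s1 \<zeta> * ?s2 \<zeta> \<le> ((1 - \<eta>) * ?R1) * ?R2"
        using R(2)[OF that(1)] s[of \<zeta>] R0 \<eta>_bounds by (intro mult_mono) auto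
      then show ?thesis by (simp add: mult.assoc)
    next
      case False
      then have "?s2 \<zeta> \<le> (1 - \<eta>) * ?R2" using that by (auto simp: B_def)
      then have "?s1 \<zeta> * ?s2 \<zeta> \<le> ?R1 * ((1 - \<eta>) * ?R2)"
        using R(1)[OF that(1)] s[of \<zeta>] R0 by (intro mult_mono) auto
      then show ?thesis by (simp add: algebra_simps)
    qed
    then have "amp a1 a2 r (\<xi> + \<zeta>) \<le> ((1 - \<eta>) * (?R1 * ?R2)) powr p"
      unfolding amp_def using s[of \<zeta>] p_pos by (intro powr_mono2) auto
    also have "\<dots> = (1 - \<eta>) powr p * X" using R0 \<eta>_bounds by (simp add: X_def powr_mult)
    also have "\<dots> \<le> 1 / (real b)\<^sup>2 * X" using gain X by (intro mult_right_mono) (auto simp: \<eta>_def)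
    finally show ?thesis by simp
  qed
  have [measurable]: "Z \<in> sets borel" by (simp add: Z_def)
  \<comment> \<open>Any two exceptional frequencies are close, so a parallelogram centred at one of
    them contains them all; it is also a Borel set, unlike possibly \<open>B\<close>. Its side
    relative to that of \<open>Z\<close> is \<open>8 * g / (lam * b)\<close>.\<close>
  obtain B' where B': "B \<subseteq> B'" "B' \<in> sets borel" "emeasure lborel B' \<le> ennreal ((8 * g / (lam * b))\<^sup>2) * emeasure lborel Z"
  proof (cases "B = {}")
    case True then show ?thesis by (intro that[of "{}"]) auto
  next
    case False
    then obtain \<zeta>0 where \<zeta>0: "\<zeta>0 \<in> B" by blast
    let ?B' = "{\<zeta>. \<zeta> - \<zeta>0 \<in> strip_box c1 c2 (g / (5 * r))}"
    have "B \<subseteq> ?B'"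
    proof
      fix \<zeta> assume "\<zeta> \<in> B"
      then have "\<zeta> - \<zeta>0 \<in> strip_box c1 c2 (g / (5 * r))"
        using \<zeta>0 unfolding B_def Z_def by (intro extremal_frequencies_close[OF r a m heavy, of \<zeta> \<zeta>0 \<xi>]) blast+
      then show "\<zeta> \<in> ?B'" by simp
    qed
    moreover have "?B' \<in> sets borel" by measurable
    moreover have "emeasure lborel ?B' = ennreal ((8 * g / (lam * b))\<^sup>2) * emeasure lborel Z"
    proof -
      have g5: "0 < g / (5 * r)" using g r by simp
      have "emeasure lborel ?B' = ennreal ((g / (5 * r))\<^sup>2) * emeasure lborel (strip_box c1 c2 1)"
        by (simp add: emeasure_lborel_translate emeasure_strip_box[OF g5])
      also have "(g / (5 * r))\<^sup>2 = (8 * g / (lam * b))\<^sup>2 * ?\<rho>\<^sup>2"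
        unfolding power_mult_distrib[symmetric] using r b_pos lam_pos by (simp add: field_simps)
      also have "ennreal \<dots> * emeasure lborel (strip_box c1 c2 1) = ennreal ((8 * g / (lam * b))\<^sup>2) * emeasure lborel Z"
        unfolding Z_def by (simp add: emeasure_strip_box[OF \<rho>] ennreal_mult mult.assoc)
      finally show ?thesis .
    qed
    ultimately show ?thesis by (intro that[of ?B']) auto
  qed
  have [measurable]: "B' \<in> sets borel" by (rule B')
  have "(\<integral>\<^sup>+ \<zeta>\<in>Z. ennreal (amp a1 a2 r (\<xi> + \<zeta>)) \<partial>lborel)
    \<le> (\<integral>\<^sup>+ \<zeta>. ennreal X * indicator B' \<zeta> + ennreal (X / (real b)\<^sup>2) * indicator Z \<zeta> \<partial>lborel)"
  proof (rule nn_integral_mono)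
    fix \<zeta>
    show "ennreal (amp a1 a2 r (\<xi> + \<zeta>)) * indicator Z \<zeta> \<le> ennreal X * indicator B' \<zeta> + ennreal (X / (real b)\<^sup>2) * indicator Z \<zeta>"
    proof (cases "\<zeta> \<in> Z")
      case Z: True
      show ?thesis
      proof (cases "\<zeta> \<in> B")
        case True
        then have "\<zeta> \<in> B'" using B' by auto
        then show ?thesis using F1[OF Z] Z by (auto intro: add_increasing2 ennreal_leI)
      next
        case False
        then show ?thesis using F2[OF Z False] Z by (auto intro: add_increasing ennreal_leI)
      qed
    qed simp
  qed
  also have "\<dots> = ennreal X * emeasure lborel B' + ennreal (X / (real b)\<^sup>2) * emeasure lborel Z"
    by (subst nn_integral_add) (auto simp: nn_integral_cmult)
  also have "\<dots> \<le> ennreal X * (ennreal ((8 * g / (lam * b))\<^sup>2) * emeasure lborel Z) + ennreal (X / (real b)\<^sup>2) * emeasure lborel Z"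
    by (intro add_right_mono mult_left_mono B') auto
  also have "\<dots> = emeasure lborel Z * ennreal (X * (8 * g / (lam * b))\<^sup>2 + X / (real b)\<^sup>2)"
    using X by (simp add: ennreal_plus ennreal_mult distrib_left distrib_right mult_ac)
  also have "\<dots> \<le> emeasure lborel Z * ennreal ((64 / lam\<^sup>2 + 1) * (g / b)\<^sup>2 * X)"
  proof (intro mult_left_mono ennreal_leI)
    have "1 \<le> g\<^sup>2" using g by (simp add: power2_eq_square mult_mono[of 1 g 1 g, simplified])
    then have "X / (real b)\<^sup>2 * 1 \<le> X / (real b)\<^sup>2 * g\<^sup>2" using X by (intro mult_left_mono) auto
    then show "X * (8 * g / (lam * b))\<^sup>2 + X / (real b)\<^sup>2 \<le> (64 / lam\<^sup>2 + 1) * (g / b)\<^sup>2 * X"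
      by (simp add: power_divide power_mult_distrib algebra_simps)
  qed simp
  finally show ?thesis by (simp add: X_def)
qed

text \<open>If both interiors are heavy, cancellation gives the gain. Otherwise the trivial bound by
  \<open>rms\<close> is used at every frequency of \<open>Z\<close>, and the factor
  \<open>1 / b\<^sup>2\<close> comes from the weights of a cell whose mass sits near its
  endpoints.\<close>

lemma amp_average_le:
  assumes r: "0 < r" "r \<le> r0" and a: "l1 \<le> a1" "a1 + r \<le> h1" "l2 \<le> a2" "a2 + r \<le> h2"
    and m: "0 < measure \<mu> (cell a1 r)" "0 < measure \<mu> (cell a2 r)"
  defines "Z \<equiv> strip_box c1 c2 (lam * b / (40 * r))"
  shows "(\<integral>\<^sup>+ \<zeta>\<in>Z. ennreal (amp a1 a2 r (\<xi> + \<zeta>)) \<partial>lborel)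
    \<le> emeasure lborel Z * ennreal (loss * (spread a1 r * spread a2 r) powr C *
       (\<Sum>i<b. \<Sum>j<b. measure \<mu> (child a1 r b i) / measure \<mu> (cell a1 r) * (measure \<mu> (child a2 r b j) / measure \<mu> (cell a2 r))
         * (spread (a1 + real i * (r / b)) (r / b) * spread (a2 + real j * (r / b)) (r / b)) powr (- C)
         * amp (a1 + real i * (r / b)) (a2 + real j * (r / b)) (r / b) \<xi>))"
    (is "_ \<le> emeasure lborel Z * ennreal (loss * ?P * ?S)")
proof -
  let ?R1 = "rms b lam a1 r \<xi>" and ?R2 = "rms b lam a2 r \<xi>"
  let ?E = "\<lambda>a. ((\<Sum>i<b. triple (a + real i * (r / b)) (r / b)) / measure \<mu> (cell a r)) powr C"
  let ?Q = "\<lambda>a. (\<Sum>i<b. measure \<mu> (child a r b i) / measure \<mu> (cell a r) * spread (a + real i * (r / b)) (r / b) powr (- C)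
          * avgsup (child a r b i) (lam * b / r) \<xi> powr p)"
  have R0: "0 \<le> ?R1" "0 \<le> ?R2" by (auto simp: rms_def intro!: sum_nonneg)
  have rp: "?R1 powr p \<le> ?E a1 * ?Q a1" "?R2 powr p \<le> ?E a2 * ?Q a2"
    by (intro rms_powr_le r b_pos less_imp_le[OF lam_pos] C p m)+
  have Q0: "0 \<le> ?Q a" for a by (intro sum_nonneg) auto
  have SQ: "?S = ?Q a1 * ?Q a2"
    unfolding sum_product amp_def child_def
    using r lam_pos avgsup_nonneg[OF cell_sets] b_pos spread_ge_1[of "r / b"]
    by (intro sum.cong refl) (simp add: powr_mult order_trans[OF zero_le_one spread_ge_1] mult_ac)
  have RE: "(?R1 * ?R2) powr p \<le> ?E a1 * ?E a2 * ?S"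
  proof -
    have "(?R1 * ?R2) powr p = ?R1 powr p * ?R2 powr p" by (rule powr_mult)
    also have "\<dots> \<le> (?E a1 * ?Q a1) * (?E a2 * ?Q a2)"
      using rp Q0 by (intro mult_mono mult_nonneg_nonneg) auto
    finally show ?thesis unfolding SQ by (simp only: mult_ac)
  qed
  have P: "?P = spread a1 r powr C * spread a2 r powr C"
    using spread_ge_1[OF r(1)] by (simp add: powr_mult order_trans[OF zero_le_one])
  have S0: "0 \<le> ?S" unfolding SQ using Q0 by simp
  note sums = sum_triple_powr_le[OF r]
  have E3: "?E a1 \<le> 3 powr C * spread a1 r powr C" "?E a2 \<le> 3 powr C * spread a2 r powr C"
    using sums(1) a arcs m by auto
  show ?thesis
  proof (cases "interior_heavy a1 r \<and> interior_heavy a2 r")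
    case True
    have "?E a1 * ?E a2 \<le> (3 powr C * spread a1 r powr C) * (3 powr C * spread a2 r powr C)"
      using E3 by (intro mult_mono) auto
    also have "\<dots> = 9 powr C * ?P"
      unfolding P using powr_mult[of 3 3 C] by (simp add: mult_ac)
    finally have "?E a1 * ?E a2 * ?S \<le> 9 powr C * ?P * ?S" using S0 by (intro mult_right_mono)
    then have "(?R1 * ?R2) powr p \<le> 9 powr C * ?P * ?S" using RE by linarith
    then have "(64 / lam\<^sup>2 + 1) * (g / b)\<^sup>2 * (?R1 * ?R2) powr p \<le> (64 / lam\<^sup>2 + 1) * (g / b)\<^sup>2 * (9 powr C * ?P * ?S)"
      by (intro mult_left_mono) auto
    also have "\<dots> = loss * ?P * ?S" by (simp add: loss_def mult_ac)
    finally have "emeasure lborel Z * ennreal ((64 / lam\<^sup>2 + 1) * (g / b)\<^sup>2 * (?R1 * ?R2) powr p)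
      \<le> emeasure lborel Z * ennreal (loss * ?P * ?S)" by (intro mult_left_mono ennreal_leI) auto
    then show ?thesis using amp_average_le_rms[OF r a m, of \<xi>] True unfolding Z_def by (meson order_trans)
  next
    case False
    have one: "?E a1 * ?E a2 \<le> 3 powr C / (real b)\<^sup>2 * ?P"
    proof (cases "interior_heavy a1 r")
      case True
      then have "?E a2 \<le> 1 / (real b)\<^sup>2 * spread a2 r powr C" using False sums(2) a arcs m by auto
      then have "?E a1 * ?E a2 \<le> (3 powr C * spread a1 r powr C) * (1 / (real b)\<^sup>2 * spread a2 r powr C)"
        using E3 by (intro mult_mono) auto
      then show ?thesis unfolding P by (simp add: mult_ac)
    next
      case F1: False
      then have "?E a1 \<le> 1 / (real b)\<^sup>2 * spread a1 r powr C" using sums(2) a arcs m by auto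
      then have "?E a1 * ?E a2 \<le> (1 / (real b)\<^sup>2 * spread a1 r powr C) * (3 powr C * spread a2 r powr C)"
        using E3 by (intro mult_mono) auto
      then show ?thesis unfolding P by (simp add: mult_ac)
    qed
    have "3 powr C / (real b)\<^sup>2 \<le> loss"
    proof -
      have "3 powr C \<le> 9 powr C" using C by (intro powr_mono2) auto
      moreover have "1 \<le> (64 / lam\<^sup>2 + 1) * g\<^sup>2"
        using g mult_mono[of 1 "64 / lam\<^sup>2 + 1" 1 "g\<^sup>2"] by (simp add: one_le_power)
      ultimately have "3 powr C * 1 \<le> 9 powr C * ((64 / lam\<^sup>2 + 1) * g\<^sup>2)" by (intro mult_mono) auto
      then have "3 powr C * 1 / (real b)\<^sup>2 \<le> 9 powr C * ((64 / lam\<^sup>2 + 1) * g\<^sup>2) / (real b)\<^sup>2" by (rule divide_right_mono) simp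
      then show ?thesis by (simp add: loss_def power_divide mult_ac)
    qed
    then have "3 powr C / (real b)\<^sup>2 * ?P \<le> loss * ?P" by (intro mult_right_mono) auto
    then have "?E a1 * ?E a2 * ?S \<le> loss * ?P * ?S" using one S0 by (intro mult_right_mono) auto
    then have le: "(?R1 * ?R2) powr p \<le> loss * ?P * ?S" using RE by linarith
    have "amp a1 a2 r (\<xi> + \<zeta>) \<le> loss * ?P * ?S" if "\<zeta> \<in> Z" for \<zeta>
    proof -
      have "amp a1 a2 r (\<xi> + \<zeta>) \<le> (?R1 * ?R2) powr p" unfolding amp_def
        using that r a lam_pos p_pos R0
        by (intro powr_mono2 mult_mono mult_nonneg_nonneg avgsup_le_rms_1 avgsup_le_rms_2 avgsup_nonneg) (auto simp: Z_def)
      then show ?thesis using le by linarith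
    qed
    then have "(\<integral>\<^sup>+ \<zeta>\<in>Z. ennreal (amp a1 a2 r (\<xi> + \<zeta>)) \<partial>lborel) \<le> (\<integral>\<^sup>+ \<zeta>\<in>Z. ennreal (loss * ?P * ?S) \<partial>lborel)"
      by (intro nn_integral_mono) (auto simp: indicator_def intro: ennreal_leI)
    also have "\<dots> = emeasure lborel Z * ennreal (loss * ?P * ?S)"
      unfolding Z_def by (subst nn_integral_cmult_indicator) (auto simp: mult.commute)
    finally show ?thesis .
  qed
qed

end

section \<open>Iteration over scales\<close>

lemma emeasure_ball_real2_le:
  assumes "0 \<le> T" shows "emeasure lborel (ball (0 :: real \<times> real) T) \<le> ennreal (4 * T\<^sup>2)"
proof -
  have "unit_ball_vol 2 = pi" by (rule unit_ball_vol_2)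
  then have "emeasure lborel (ball (0 :: real \<times> real) T) = ennreal (pi * T\<^sup>2)"
    using assms emeasure_ball[of T "0 :: real \<times> real"] by (simp add: power2_eq_square)
  also have "\<dots> \<le> ennreal (4 * T\<^sup>2)"
    using pi_less_4 by (intro ennreal_leI mult_right_mono) auto
  finally show ?thesis .
qed

lemma nn_integral_double_sum:
  fixes g :: "nat \<Rightarrow> nat \<Rightarrow> 'a \<Rightarrow> ennreal"
  assumes g: "\<And>i j. i < b \<Longrightarrow> j < b \<Longrightarrow> g i j \<in> borel_measurable M"
  shows "(\<integral>\<^sup>+ x. K * (\<Sum>i<b. \<Sum>j<b. c i j * g i j x) \<partial>M) = K * (\<Sum>i<b. \<Sum>j<b. c i j * (\<integral>\<^sup>+ x. g i j x \<partial>M))"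
proof -
  have cg: "(\<lambda>x. c i j * g i j x) \<in> borel_measurable M" if "i < b" "j < b" for i j
    using g[OF that] by measurable
  have cs: "(\<lambda>x. \<Sum>j<b. c i j * g i j x) \<in> borel_measurable M" if "i < b" for i
    using cg[OF that] by (intro borel_measurable_sum) auto
  have "(\<integral>\<^sup>+ x. K * (\<Sum>i<b. \<Sum>j<b. c i j * g i j x) \<partial>M) = K * (\<integral>\<^sup>+ x. (\<Sum>i<b. \<Sum>j<b. c i j * g i j x) \<partial>M)"
    by (rule nn_integral_cmult, rule borel_measurable_sum) (use cs in auto)
  also have "(\<integral>\<^sup>+ x. (\<Sum>i<b. \<Sum>j<b. c i j * g i j x) \<partial>M) = (\<Sum>i<b. \<integral>\<^sup>+ x. (\<Sum>j<b. c i j * g i j x) \<partial>M)"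
    using cs by (intro nn_integral_sum) auto
  also have "\<dots> = (\<Sum>i<b. \<Sum>j<b. \<integral>\<^sup>+ x. c i j * g i j x \<partial>M)"
    using cg by (intro sum.cong refl nn_integral_sum) auto
  also have "\<dots> = (\<Sum>i<b. \<Sum>j<b. c i j * (\<integral>\<^sup>+ x. g i j x \<partial>M))"
    using g by (intro sum.cong refl nn_integral_cmult) auto
  finally show ?thesis .
qed

context arc_pair
begin

lemma amp_nonneg: "0 \<le> amp a1 a2 r \<xi>"
  by (simp add: amp_def)

lemma amp_le_1:
  assumes "0 < r" shows "amp a1 a2 r \<xi> \<le> 1"
proof -
  have L: "0 \<le> lam / r" using assms lam_pos by simp
  let ?x = "avgsup (cell a1 r) (lam / r) \<xi> * avgsup (cell a2 r) (lam / r) \<xi>"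
  have "0 \<le> ?x" "?x \<le> 1"
    by (intro mult_nonneg_nonneg mult_le_one avgsup_le_1 avgsup_nonneg cell_sets L)+
  then have "?x powr p \<le> 1 powr p" using p_pos by (intro powr_mono2) auto
  then show ?thesis by (simp add: amp_def)
qed

lemma amp_measurable [measurable]:
  assumes "0 < r" "l1 \<le> a1" "a1 + r \<le> h1" "l2 \<le> a2" "a2 + r \<le> h2"
  shows "amp a1 a2 r \<in> borel_measurable borel"
proof -
  have "cell a1 r \<subseteq> {-2..2}" "cell a2 r \<subseteq> {-2..2}" using assms arcs by (auto simp: cell_def)
  then have [measurable]: "avgsup (cell a1 r) (lam / r) \<in> borel_measurable borel"
    "avgsup (cell a2 r) (lam / r) \<in> borel_measurable borel"
    using assms lam_pos by (auto intro!: avgsup_measurable)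
  show ?thesis unfolding amp_def[abs_def] by measurable
qed

lemma child_in_arc:
  assumes "0 < r" "l \<le> a" "a + r \<le> h" "i < b"
  shows "l \<le> a + real i * (r / b)" "a + real i * (r / b) + r / b \<le> h"
proof -
  have "0 \<le> real i * (r / b)" using assms by simp
  then show "l \<le> a + real i * (r / b)" using assms by linarith
  have "(real i + 1) * (r / b) \<le> real b * (r / b)" using assms by (intro mult_right_mono) auto
  moreover have "(real i + 1) * (r / b) = real i * (r / b) + r / b" by (simp only: distrib_right mult_1)
  moreover have "real b * (r / b) = r" using b_pos by simp
  ultimately show "a + real i * (r / b) + r / b \<le> h" using assms by linarith
qed

text \<open>Induction on the number of scales. The weights reproduce themselves: the power
  \<open>C\<close> of the spreads in the induction hypothesis for a pair of children cancels the
  power \<open>- C\<close> in \<open>amp_average_le\<close>, and the remaining weights sum to 1, so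
  each step costs exactly \<open>loss\<close>. At the finest scale only \<open>amp_le_1\<close> and
  the area of the ball are used.\<close>

lemma amp_integral_le:
  assumes "0 < r" "r \<le> r0" "l1 \<le> a1" "a1 + r \<le> h1" "l2 \<le> a2" "a2 + r \<le> h2" "0 \<le> T"
  shows "(\<integral>\<^sup>+ \<xi>\<in>ball 0 T. ennreal (amp a1 a2 r \<xi>) \<partial>lborel)
    \<le> ennreal ((spread a1 r * spread a2 r) powr C * loss ^ n * (4 * (T + stretch c1 c2 * lam * (real b ^ n - 1) / (20 * r))\<^sup>2))"
  using assms
proof (induction n arbitrary: a1 a2 r T)
  case 0
  have "1 \<le> spread a1 r * spread a2 r"
    using spread_ge_1[OF 0(1)] mult_mono[of 1 "spread a1 r" 1 "spread a2 r"] by (auto intro: order_trans[OF zero_le_one])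
  then have "1 \<le> (spread a1 r * spread a2 r) powr C" using C by (intro ge_one_powr_ge_zero) auto
  have "(\<integral>\<^sup>+ \<xi>\<in>ball 0 T. ennreal (amp a1 a2 r \<xi>) \<partial>lborel) \<le> (\<integral>\<^sup>+ \<xi>\<in>ball (0 :: real \<times> real) T. 1 \<partial>lborel)"
    using amp_le_1[OF 0(1)] by (intro nn_integral_mono mult_right_mono) (auto simp: ennreal_le_1)
  also have "\<dots> \<le> ennreal (4 * T\<^sup>2)" using emeasure_ball_real2_le[OF 0(7)] by simp
  also have "\<dots> \<le> ennreal ((spread a1 r * spread a2 r) powr C * (4 * T\<^sup>2))"
    using \<open>1 \<le> (spread a1 r * spread a2 r) powr C\<close> mult_right_mono[of 1 _ "4 * T\<^sup>2"] by (intro ennreal_leI) simp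
  finally show ?case by simp
next
  case (Suc n)
  let ?F = "\<lambda>\<xi>. ennreal (amp a1 a2 r \<xi>)" and ?P = "(spread a1 r * spread a2 r) powr C"
  let ?T' = "T + stretch c1 c2 * lam * (real b ^ Suc n - 1) / (20 * r)"
  show ?case
  proof (cases "measure \<mu> (cell a1 r) = 0 \<or> measure \<mu> (cell a2 r) = 0")
    case True
    then have "amp a1 a2 r \<xi> = 0" for \<xi> by (auto simp: amp_def avgsup_def)
    then show ?thesis by simp
  next
    case False
    then have m: "0 < measure \<mu> (cell a1 r)" "0 < measure \<mu> (cell a2 r)" by (auto simp: zero_less_measure_iff)
    define \<rho> where "\<rho> = lam * b / (40 * r)"
    have \<rho>: "0 < \<rho>" using lam_pos b_pos Suc.prems by (simp add: \<rho>_def)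
    define Z where "Z = strip_box c1 c2 \<rho>"
    define d where "d = stretch c1 c2 * \<rho>"
    have st: "0 \<le> stretch c1 c2" by (simp add: stretch_def)
    have Z: "Z \<in> sets borel" "emeasure lborel Z \<noteq> 0" "emeasure lborel Z \<noteq> \<top>" "\<And>\<zeta>. \<zeta> \<in> Z \<Longrightarrow> norm \<zeta> \<le> d"
    proof -
      show "emeasure lborel Z \<noteq> 0"
        unfolding Z_def emeasure_strip_box[OF \<rho>] using \<rho> emeasure_strip_box_pos[of c1 c2] by (simp add: ennreal_zero_less_mult_iff)
      show "emeasure lborel Z \<noteq> \<top>" using emeasure_strip_box_finite[OF c12, of \<rho>] by (simp add: Z_def)
      show "norm \<zeta> \<le> d" if "\<zeta> \<in> Z" for \<zeta>
      proof -
        have "norm \<zeta> \<le> stretch c1 c2 * strip_norm c1 c2 \<zeta>" by (rule norm_le_strip_norm[OF c12])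
        also have "\<dots> \<le> stretch c1 c2 * \<rho>" using that st by (intro mult_left_mono) (auto simp: Z_def strip_box_def)
        finally show ?thesis by (simp add: d_def)
      qed
    qed (simp add: Z_def)
    define w1 where "w1 i = measure \<mu> (child a1 r b i) / measure \<mu> (cell a1 r)" for i
    define w2 where "w2 i = measure \<mu> (child a2 r b i) / measure \<mu> (cell a2 r)" for i
    define Y where "Y i j = spread (a1 + real i * (r / b)) (r / b) * spread (a2 + real j * (r / b)) (r / b)" for i j
    define G where "G i j = amp (a1 + real i * (r / b)) (a2 + real j * (r / b)) (r / b)" for i j
    have rb: "0 < r / b" "r / b \<le> r0" using Suc.prems b_pos divide_left_mono[of 1 "real b" r] by auto
    have w: "\<And>i. 0 \<le> w1 i" "\<And>i. 0 \<le> w2 i" "(\<Sum>i<b. \<Sum>j<b. w1 i * w2 j) = 1"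
      using m by (simp_all add: w1_def w2_def sum_product[symmetric] sum_divide_distrib[symmetric] measure_cell_sum[OF Suc.prems(1) b_pos, symmetric])
    have Y: "1 \<le> Y i j" for i j
    proof -
      have "1 * 1 \<le> Y i j" unfolding Y_def
        by (intro mult_mono spread_ge_1[OF rb(1)] order_trans[OF zero_le_one spread_ge_1[OF rb(1)]]) auto
      then show ?thesis by simp
    qed
    have Gm: "G i j \<in> borel_measurable borel" if "i < b" "j < b" for i j
      unfolding G_def using that Suc.prems rb by (intro amp_measurable child_in_arc) auto
    let ?A = "4 * ?T'\<^sup>2"
    have IH: "(\<integral>\<^sup>+ \<xi>\<in>ball 0 (T + d). ennreal (G i j \<xi>) \<partial>lborel) \<le> ennreal (Y i j powr C * loss ^ n * ?A)"
      if ij: "i < b" "j < b" for i j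
    proof -
      have d0: "0 \<le> d" using st \<rho> by (simp add: d_def)
      have "(\<integral>\<^sup>+ \<xi>\<in>ball 0 (T + d). ennreal (G i j \<xi>) \<partial>lborel)
        \<le> ennreal (Y i j powr C * loss ^ n * (4 * ((T + d) + stretch c1 c2 * lam * (real b ^ n - 1) / (20 * (r / b)))\<^sup>2))"
        unfolding G_def Y_def using ij Suc.prems rb d0 by (intro Suc.IH child_in_arc) auto
      also have "\<dots> \<le> ennreal (Y i j powr C * loss ^ n * ?A)"
      proof (intro ennreal_leI mult_left_mono power_mono)
        \<comment> \<open>The radii added at the successive scales grow geometrically. In the common
          unit the present one is \<open>b / 2\<close>, and
          \<open>b / 2 + (b ^ n - 1) * b \<le> b ^ Suc n - 1\<close>.\<close>
        have "d + stretch c1 c2 * lam * (real b ^ n - 1) / (20 * (r / b)) = stretch c1 c2 * lam / (20 * r) * (b / 2 + (real b ^ n - 1) * b)"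
          using Suc.prems b_pos by (simp add: d_def \<rho>_def field_simps)
        also have "\<dots> \<le> stretch c1 c2 * lam / (20 * r) * (real b ^ Suc n - 1)"
          using Suc.prems st lam_pos b by (intro mult_left_mono) (auto simp: algebra_simps)
        finally show "(T + d) + stretch c1 c2 * lam * (real b ^ n - 1) / (20 * (r / b)) \<le> ?T'" by simp
        have "1 \<le> real b ^ n" using b by (intro one_le_power) auto
        then have "0 \<le> stretch c1 c2 * lam * (real b ^ n - 1) / (20 * (r / b))"
          using rb(1) Suc.prems(1) st lam_pos by (intro divide_nonneg_nonneg mult_nonneg_nonneg) auto
        then show "0 \<le> (T + d) + stretch c1 c2 * lam * (real b ^ n - 1) / (20 * (r / b))" using d0 Suc.prems(7) by linarith
      qed (auto simp: loss_nonneg)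
      finally show ?thesis .
    qed
    have "emeasure lborel Z * (\<integral>\<^sup>+ \<xi>\<in>ball 0 T. ?F \<xi> \<partial>lborel)
      \<le> (\<integral>\<^sup>+ \<xi>\<in>ball 0 (T + d). (\<integral>\<^sup>+ \<zeta>\<in>Z. ?F (\<xi> + \<zeta>) \<partial>lborel) \<partial>lborel)"
      using amp_measurable[OF Suc.prems(1,3-6)] Z by (intro nn_integral_ball_le_translates) auto
    also have "\<dots> \<le> (\<integral>\<^sup>+ \<xi>\<in>ball 0 (T + d). (emeasure lborel Z * ennreal (loss * ?P * (\<Sum>i<b. \<Sum>j<b. w1 i * w2 j * Y i j powr (- C) * G i j \<xi>))) \<partial>lborel)"
      unfolding w1_def w2_def Y_def G_def Z_def \<rho>_def
      by (intro nn_integral_mono mult_right_mono amp_average_le[OF Suc.prems(1-6) m]) auto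
    also have "\<dots> = (\<integral>\<^sup>+ \<xi>. emeasure lborel Z * (\<Sum>i<b. \<Sum>j<b. ennreal (loss * ?P * (w1 i * w2 j * Y i j powr (- C))) * (ennreal (G i j \<xi>) * indicator (ball 0 (T + d)) \<xi>)) \<partial>lborel)"
    proof (intro nn_integral_cong)
      fix \<xi>
      have "ennreal (loss * ?P * (\<Sum>i<b. \<Sum>j<b. w1 i * w2 j * Y i j powr (- C) * G i j \<xi>))
        = ennreal (\<Sum>i<b. \<Sum>j<b. loss * ?P * (w1 i * w2 j * Y i j powr (- C)) * G i j \<xi>)"
        by (simp add: sum_distrib_left mult.assoc)
      also have "\<dots> = (\<Sum>i<b. \<Sum>j<b. ennreal (loss * ?P * (w1 i * w2 j * Y i j powr (- C))) * ennreal (G i j \<xi>))"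
      proof -
        have nn: "0 \<le> loss * ?P * (w1 i * w2 j * Y i j powr (- C))" "0 \<le> G i j \<xi>" for i j
          using w(1,2) loss_nonneg by (auto simp: G_def amp_nonneg intro!: mult_nonneg_nonneg)
        have "(\<Sum>i<b. \<Sum>j<b. ennreal (loss * ?P * (w1 i * w2 j * Y i j powr (- C))) * ennreal (G i j \<xi>))
          = (\<Sum>i<b. \<Sum>j<b. ennreal (loss * ?P * (w1 i * w2 j * Y i j powr (- C)) * G i j \<xi>))"
          by (simp only: ennreal_mult[OF nn])
        also have "\<dots> = (\<Sum>i<b. ennreal (\<Sum>j<b. loss * ?P * (w1 i * w2 j * Y i j powr (- C)) * G i j \<xi>))"
          by (intro sum.cong refl sum_ennreal mult_nonneg_nonneg nn)
        also have "\<dots> = ennreal (\<Sum>i<b. \<Sum>j<b. loss * ?P * (w1 i * w2 j * Y i j powr (- C)) * G i j \<xi>)"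
          by (intro sum_ennreal sum_nonneg mult_nonneg_nonneg[OF nn])
        finally show ?thesis by simp
      qed
      finally show "emeasure lborel Z * ennreal (loss * ?P * (\<Sum>i<b. \<Sum>j<b. w1 i * w2 j * Y i j powr (- C) * G i j \<xi>)) * indicator (ball 0 (T + d)) \<xi>
        = emeasure lborel Z * (\<Sum>i<b. \<Sum>j<b. ennreal (loss * ?P * (w1 i * w2 j * Y i j powr (- C))) * (ennreal (G i j \<xi>) * indicator (ball 0 (T + d)) \<xi>))"
        by (simp add: sum_distrib_right mult.assoc)
    qed
    also have "\<dots> = emeasure lborel Z * (\<Sum>i<b. \<Sum>j<b. ennreal (loss * ?P * (w1 i * w2 j * Y i j powr (- C))) * (\<integral>\<^sup>+ \<xi>\<in>ball 0 (T + d). ennreal (G i j \<xi>) \<partial>lborel))"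
    proof -
      have [measurable]: "ball (0 :: real \<times> real) S \<in> sets borel" for S by simp
      have M: "(\<lambda>\<xi>. ennreal (G i j \<xi>) * indicator (ball 0 (T + d)) \<xi>) \<in> borel_measurable lborel" if "i < b" "j < b" for i j
        using Gm[OF that] by measurable
      show ?thesis by (rule nn_integral_double_sum[OF M])
    qed
    also have "\<dots> \<le> emeasure lborel Z * (\<Sum>i<b. \<Sum>j<b. ennreal (loss * ?P * (w1 i * w2 j * Y i j powr (- C))) * ennreal (Y i j powr C * loss ^ n * ?A))"
      by (intro mult_left_mono sum_mono IH) auto
    also have "(\<Sum>i<b. \<Sum>j<b. ennreal (loss * ?P * (w1 i * w2 j * Y i j powr (- C))) * ennreal (Y i j powr C * loss ^ n * ?A))
      = (\<Sum>i<b. \<Sum>j<b. ennreal (?P * loss ^ Suc n * ?A * (w1 i * w2 j)))"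
    proof (intro sum.cong refl)
      fix i j
      have "Y i j powr (- C) * Y i j powr C = 1" using Y[of i j] by (simp add: powr_add[symmetric])
      then have "loss * ?P * (w1 i * w2 j * Y i j powr (- C)) * (Y i j powr C * loss ^ n * ?A) = ?P * loss ^ Suc n * ?A * (w1 i * w2 j)"
        by (simp add: mult_ac)
      then show "ennreal (loss * ?P * (w1 i * w2 j * Y i j powr (- C))) * ennreal (Y i j powr C * loss ^ n * ?A)
        = ennreal (?P * loss ^ Suc n * ?A * (w1 i * w2 j))"
        using w loss_nonneg by (subst ennreal_mult[symmetric]) auto
    qed
    also have "\<dots> = ennreal (\<Sum>i<b. \<Sum>j<b. ?P * loss ^ Suc n * ?A * (w1 i * w2 j))"
      using w loss_nonneg by (simp add: sum_ennreal sum_nonneg)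
    also have "(\<Sum>i<b. \<Sum>j<b. ?P * loss ^ Suc n * ?A * (w1 i * w2 j)) = ?P * loss ^ Suc n * ?A"
      by (simp only: sum_distrib_left[symmetric] w(3)[unfolded sum_distrib_left[symmetric]] mult_1_right)
    finally show ?thesis
      using Z(2,3) by (subst (asm) ennreal_mult_le_mult_iff) auto
  qed
qed

end

section \<open>From pairs of arcs to the whole curve\<close>

lemma powr_add_le:
  fixes x y p :: real
  assumes "0 \<le> x" "0 \<le> y" "0 \<le> p" shows "(x + y) powr p \<le> 2 powr p * (x powr p + y powr p)"
proof -
  have "(x + y) powr p \<le> (2 * max x y) powr p" using assms by (intro powr_mono2) auto
  also have "\<dots> = 2 powr p * max x y powr p" by (rule powr_mult)
  also have "\<dots> \<le> 2 powr p * (x powr p + y powr p)" by (intro mult_left_mono) (auto simp: max_def)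
  finally show ?thesis .
qed

text \<open>Arcs are compared when at least \<open>k\<close> steps of the grid apart: then the difference of their slopes dominates
  the variation of the slope on each of them.\<close>

locale convex_curve_measure = growth_measure \<mu> \<phi> b A al r0 D lam g C p
  for \<mu> \<phi> b A al r0 D lam g C p +
  fixes \<phi>' :: "real \<Rightarrow> real" and k :: nat and La ka M1 e :: real
  assumes total: "measure \<mu> (space \<mu>) = 1" and concentrated: "AE x in \<mu>. x \<in> {-1..1}"
    and deriv: "\<And>x. (\<phi> has_real_derivative \<phi>' x) (at x)"
    and slope: "\<And>x y. x \<in> {-2..2} \<Longrightarrow> y \<in> {-2..2} \<Longrightarrow> ka * \<bar>x - y\<bar> \<le> \<bar>\<phi>' x - \<phi>' y\<bar>"
      "\<And>x y. x \<in> {-2..2} \<Longrightarrow> y \<in> {-2..2} \<Longrightarrow> \<bar>\<phi>' x - \<phi>' y\<bar> \<le> La * \<bar>x - y\<bar>"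
    and M1: "\<And>x. x \<in> {-2..2} \<Longrightarrow> \<bar>\<phi>' x\<bar> \<le> M1"
    and ka: "0 < ka" and sep: "1 \<le> k" "8 * La \<le> ka * k" and r0: "0 < r0"
    and e: "0 < e" and loss_small: "loss * (real b)\<^sup>2 \<le> real b powr (3 * e)" and p_large: "2 \<le> e * al * p"
    and al: "0 < al"
begin

lemma tangent_error:
  fixes a s x y :: real
  assumes x: "x \<in> {a..<a + s}" "y \<in> {a..<a + s}" and a: "-2 \<le> a" "a + s \<le> 2"
  shows "\<bar>\<phi> x - \<phi> y - \<phi>' a * (x - y)\<bar> \<le> La * s * \<bar>x - y\<bar>"
proof -
  have ord: "\<bar>\<phi> v - \<phi> u - \<phi>' a * (v - u)\<bar> \<le> La * s * \<bar>v - u\<bar>"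
    if uv: "u \<in> {a..<a + s}" "v \<in> {a..<a + s}" "u < v" for u v
  proof -
    obtain z where z: "u < z" "z < v" "\<phi> v - \<phi> u = (v - u) * \<phi>' z"
      using MVT2[OF uv(3), of \<phi> \<phi>'] deriv by blast
    have "\<bar>\<phi>' z - \<phi>' a\<bar> \<le> La * \<bar>z - a\<bar>" using slope(2)[of z a] z uv a by auto
    also have "\<dots> \<le> La * s"
    proof (intro mult_left_mono)
      show "\<bar>z - a\<bar> \<le> s" using z uv by auto
      have "0 < u - v \<or> 0 < v - u" using uv by simp
      then show "0 \<le> La" using slope[of u v] uv a ka
        by (smt (verit) atLeastAtMost_iff atLeastLessThan_iff mult_le_cancel_right mult_nonneg_nonneg)
    qed
    finally have "\<bar>v - u\<bar> * \<bar>\<phi>' z - \<phi>' a\<bar> \<le> \<bar>v - u\<bar> * (La * s)" by (intro mult_left_mono) auto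
    moreover have "\<phi> v - \<phi> u - \<phi>' a * (v - u) = (v - u) * (\<phi>' z - \<phi>' a)" by (simp add: z(3) algebra_simps)
    ultimately show ?thesis by (simp add: abs_mult mult.commute)
  qed
  consider "x < y" | "y < x" | "x = y" by linarith
  then show ?thesis
  proof cases
    case 1
    have "\<phi> x - \<phi> y - \<phi>' a * (x - y) = - (\<phi> y - \<phi> x - \<phi>' a * (y - x))" by (simp add: algebra_simps)
    then show ?thesis using ord[OF x 1] by (simp only: abs_minus_cancel abs_minus_commute[of x y])
  qed (use ord x in auto)
qed

text \<open>The tangent error \<open>La * s\<close> is multiplied by \<open>snd \<zeta>\<close>,
  which is at most twice the norm divided by the difference of the slopes. That difference is at
  least \<open>ka * (k * s)\<close>, hence at least \<open>8 * La * s\<close>, and this leaves the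
  factor 1/4.\<close>

lemma far_arcs:
  fixes a a' s :: real
  assumes s: "0 < s" and a: "-2 \<le> a" "a + s \<le> 2" "-2 \<le> a'" "a' + s \<le> 2" and far: "k * s \<le> \<bar>a - a'\<bar>"
  shows "arc_pair \<mu> \<phi> b A al r0 D lam g C p (\<phi>' a) (\<phi>' a') a (a + s) a' (a' + s)"
    and "ka * (k * s) \<le> \<bar>\<phi>' a - \<phi>' a'\<bar>"
proof -
  show kks: "ka * (k * s) \<le> \<bar>\<phi>' a - \<phi>' a'\<bar>"
  proof -
    have "ka * (k * s) \<le> ka * \<bar>a - a'\<bar>" using far ka by (intro mult_left_mono) auto
    also have "\<dots> \<le> \<bar>\<phi>' a - \<phi>' a'\<bar>" using a s by (intro slope(1)) auto
    finally show ?thesis .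
  qed
  have pos: "0 < ka * (k * s)" using ka sep s by simp
  have ne: "\<phi>' a \<noteq> \<phi>' a'" using kks pos by auto
  have main: "\<bar>phase \<phi> \<zeta> x - phase \<phi> \<zeta> y - (x - y) * (fst \<zeta> + \<phi>' c * snd \<zeta>)\<bar>
      \<le> \<bar>x - y\<bar> * strip_norm (\<phi>' a) (\<phi>' a') \<zeta> / 4"
    if c: "x \<in> {c..<c + s}" "y \<in> {c..<c + s}" "-2 \<le> c" "c + s \<le> 2" for \<zeta> x y c
  proof -
    let ?N = "strip_norm (\<phi>' a) (\<phi>' a') \<zeta>"
    have N0: "0 \<le> ?N" by (simp add: strip_norm_def max_def)
    have pp: "0 < \<bar>\<phi>' a - \<phi>' a'\<bar> * (ka * (k * s))" using ne pos by simp
    have "phase \<phi> \<zeta> x - phase \<phi> \<zeta> y - (x - y) * (fst \<zeta> + \<phi>' c * snd \<zeta>) = (\<phi> x - \<phi> y - \<phi>' c * (x - y)) * snd \<zeta>"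
      by (simp add: phase_def algebra_simps)
    then have "\<bar>phase \<phi> \<zeta> x - phase \<phi> \<zeta> y - (x - y) * (fst \<zeta> + \<phi>' c * snd \<zeta>)\<bar>
      \<le> (La * s * \<bar>x - y\<bar>) * (2 * ?N / \<bar>\<phi>' a - \<phi>' a'\<bar>)"
      unfolding abs_mult using tangent_error[OF c] abs_snd_le_strip_norm[OF ne, of \<zeta>]
      by (simp only: abs_mult) (intro mult_mono order_trans[OF abs_ge_zero tangent_error[OF c]], auto)
    also have "\<dots> \<le> (ka * k / 8 * s * \<bar>x - y\<bar>) * (2 * ?N / (ka * (k * s)))"
      using kks pos N0 s sep ka pp by (intro mult_mono divide_left_mono) auto
    also have "\<dots> = \<bar>x - y\<bar> * ?N / 4" using ka s sep(1) by (simp add: field_simps)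
    finally show ?thesis .
  qed
  show "arc_pair \<mu> \<phi> b A al r0 D lam g C p (\<phi>' a) (\<phi>' a') a (a + s) a' (a' + s)"
    using ne a main by unfold_locales auto
qed

text \<open>Arcs will have length \<open>gap * R powr (- e)\<close>. The denominator keeps the total
  length of \<open>k + 1\<close> of them below \<open>r0\<close>, so that growth applies to the
  neighbourhood formed by the arcs that are not far from a given one.\<close>

definition gap :: real where
  "gap = min 1 r0 / (real k + 1)"

text \<open>Bounds \<open>s * stretch\<close> for the slopes of two far arcs of length
  \<open>s \<le> 1\<close>.\<close>

definition slope_bound :: real where
  "slope_bound = 1 + 2 * (1 + M1) / (ka * k)"

definition decay_const :: real where
  "decay_const = 2 powr p * (9 powr C * (4 * real b powr (3 * e) * (1 + slope_bound)\<^sup>2 / gap ^ 4) + 4 * A powr p)"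

text \<open>With \<open>n\<close> such that \<open>R \<le> b ^ n \<le> b * R\<close>, the product of
  \<open>loss ^ n\<close> and the square of \<open>b ^ n\<close> is at most of order
  \<open>R powr (3 * e)\<close>. The radius contains two further factors \<open>1 / s\<close>, from
  \<open>stretch\<close> and from the initial scale; squared they give
  \<open>R powr (4 * e)\<close>, whence the exponent \<open>7 * e\<close>.\<close>

lemma amp_integral_far:
  fixes R s a a' :: real
  assumes R: "1 \<le> R" and s: "s = gap * R powr (- e)" and a: "-2 \<le> a" "a + s \<le> 2" "-2 \<le> a'" "a' + s \<le> 2"
    and far: "k * s \<le> \<bar>a - a'\<bar>"
  shows "amp a a' s \<in> borel_measurable borel"
    and "(\<integral>\<^sup>+ \<xi>\<in>ball 0 R. ennreal (amp a a' s \<xi>) \<partial>lborel)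
      \<le> ennreal ((spread a s * spread a' s) powr C * (4 * real b powr (3 * e) * (1 + slope_bound)\<^sup>2 / gap ^ 4 * R powr (7 * e)))"
proof -
  have gap: "0 < gap" "gap \<le> 1" "gap \<le> r0" using r0 by (auto simp: gap_def divide_le_eq min_def intro: order_trans)
  have Re: "0 < R powr (- e)" "R powr (- e) \<le> 1" using R e powr_mono[of "- e" 0 R] by auto
  have s0: "0 < s" "s \<le> 1" "s \<le> r0"
    using gap Re mult_mono[of gap r0 "R powr (- e)" 1] mult_mono[of gap 1 "R powr (- e)" 1] r0 by (auto simp: s)
  note fa = far_arcs[OF s0(1) a far]
  interpret arc_pair \<mu> \<phi> b A al r0 D lam g C p "\<phi>' a" "\<phi>' a'" a "a + s" a' "a' + s" by (rule fa(1))
  show "amp a a' s \<in> borel_measurable borel" by (rule amp_measurable[OF s0(1)]) auto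
  let ?st = "stretch (\<phi>' a) (\<phi>' a')"
  define n where "n = nat \<lceil>log b R\<rceil>"
  have b1: "1 < real b" using b by simp
  have lR: "0 \<le> log b R" using R b1 by simp
  have n1: "R \<le> real b ^ n"
  proof -
    have "R = b powr (log b R)" using R b1 by simp
    also have "\<dots> \<le> b powr (real n)" using b1 lR by (intro powr_mono) (auto simp: n_def)
    finally show ?thesis using b1 by (simp add: powr_realpow)
  qed
  have n2: "real b ^ n \<le> b * R"
  proof -
    have "real n \<le> 1 + log b R" using lR by (simp add: n_def) linarith
    then have "b powr (real n) \<le> b powr (1 + log b R)" using b1 by (intro powr_mono) auto
    also have "\<dots> = b * R" using R b1 by (simp add: powr_add)
    finally show ?thesis using b1 by (simp add: powr_realpow)
  qed
  have M0: "0 \<le> M1" using M1[of 0] abs_ge_zero[of "\<phi>' 0"] by (metis atLeastAtMost_iff neg_le_0_iff_le order_trans zero_le_numeral)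
  have sb: "0 \<le> slope_bound" using M0 ka by (simp add: slope_bound_def)
  have st: "0 \<le> ?st" "?st \<le> slope_bound / s"
  proof -
    show "0 \<le> ?st" by (simp add: stretch_def)
    have "?st \<le> 1 / s + 2 * (1 + M1) / (ka * (k * s))" unfolding stretch_def
    proof (intro add_mono frac_le)
      show "1 \<le> 1 / s" using s0 by simp
      show "2 * (1 + \<bar>\<phi>' a\<bar>) \<le> 2 * (1 + M1)" using M1[of a] a s0 by auto
    qed (use fa(2) ka sep s0 M0 in auto)
    also have "\<dots> = slope_bound / s" using s0 by (simp add: slope_bound_def add_divide_distrib)
    finally show "?st \<le> slope_bound / s" .
  qed
  let ?A = "4 * (R + ?st * lam * (real b ^ n - 1) / (20 * s))\<^sup>2"
  have bn: "1 \<le> real b ^ n" using b1 by (intro one_le_power) auto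
  have "R + ?st * lam * (real b ^ n - 1) / (20 * s) \<le> real b ^ n + slope_bound / s * 1 * (real b ^ n) / (1 * s)"
  proof (intro add_mono n1 frac_le mult_mono)
    show "lam \<le> 1" using D by (simp add: lam divide_le_eq)
  qed (use st sb s0 bn lam_pos in auto)
  also have "\<dots> = real b ^ n * (1 + slope_bound / s\<^sup>2)" by (simp add: power2_eq_square algebra_simps)
  also have "\<dots> \<le> real b ^ n * ((1 + slope_bound) / s\<^sup>2)"
  proof (intro mult_left_mono)
    have "s\<^sup>2 \<le> 1" using s0 by (simp add: power_le_one)
    then have "1 \<le> 1 / s\<^sup>2" using s0 by simp
    then show "1 + slope_bound / s\<^sup>2 \<le> (1 + slope_bound) / s\<^sup>2" by (simp add: add_divide_distrib)
  qed (use bn in auto)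
  finally have rad: "R + ?st * lam * (real b ^ n - 1) / (20 * s) \<le> real b ^ n * ((1 + slope_bound) / s\<^sup>2)" .
  have rad0: "0 \<le> R + ?st * lam * (real b ^ n - 1) / (20 * s)" using R st lam_pos bn s0 by simp
  have "loss ^ n * ?A \<le> loss ^ n * (4 * (real b ^ n * ((1 + slope_bound) / s\<^sup>2))\<^sup>2)"
    using rad rad0 loss_nonneg by (intro mult_left_mono power_mono) auto
  also have "\<dots> = 4 * (loss * (real b)\<^sup>2) ^ n * ((1 + slope_bound)\<^sup>2 / s ^ 4)"
  proof -
    have "(real b ^ n * ((1 + slope_bound) / s\<^sup>2))\<^sup>2 = ((real b)\<^sup>2) ^ n * ((1 + slope_bound)\<^sup>2 / s ^ 4)"
      unfolding power_mult_distrib power_divide by (simp add: power_mult[symmetric] mult.commute)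
    then show ?thesis by (simp add: power_mult_distrib)
  qed
  also have "\<dots> \<le> 4 * (real b powr (3 * e)) ^ n * ((1 + slope_bound)\<^sup>2 / s ^ 4)"
    using loss_small loss_nonneg s0 by (intro mult_right_mono mult_left_mono power_mono) auto
  also have "(real b powr (3 * e)) ^ n = (real b ^ n) powr (3 * e)"
    using b1 by (simp add: powr_realpow[symmetric] powr_powr mult.commute)
  also have "4 * (real b ^ n) powr (3 * e) * ((1 + slope_bound)\<^sup>2 / s ^ 4)
      \<le> 4 * (b * R) powr (3 * e) * ((1 + slope_bound)\<^sup>2 / s ^ 4)"
    using n2 e s0 bn by (intro mult_right_mono mult_left_mono powr_mono2) auto
  also have "\<dots> = 4 * real b powr (3 * e) * (1 + slope_bound)\<^sup>2 / gap ^ 4 * R powr (7 * e)"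
  proof -
    have s4: "s ^ 4 = gap ^ 4 * R powr (- 4 * e)"
      using R by (simp add: s power_mult_distrib powr_realpow[symmetric] powr_powr mult.commute)
    have R7: "R powr (3 * e) = R powr (7 * e) * R powr (- 4 * e)" by (simp add: powr_add[symmetric])
    have "R powr (- 4 * e) \<noteq> 0" using R by simp
    then have cancel: "4 * (u * (v * R powr (- 4 * e))) * (x / (y * R powr (- 4 * e))) = 4 * u * x / y * v" for u v x y :: real
      by (cases "y = 0") simp_all
    show ?thesis unfolding s4 powr_mult R7 by (rule cancel)
  qed
  finally have LA: "loss ^ n * ?A \<le> 4 * real b powr (3 * e) * (1 + slope_bound)\<^sup>2 / gap ^ 4 * R powr (7 * e)" .
  have "(\<integral>\<^sup>+ \<xi>\<in>ball 0 R. ennreal (amp a a' s \<xi>) \<partial>lborel)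
     \<le> ennreal ((spread a s * spread a' s) powr C * loss ^ n * ?A)"
    using R s0 by (intro amp_integral_le) auto
  also have "\<dots> \<le> ennreal ((spread a s * spread a' s) powr C * (4 * real b powr (3 * e) * (1 + slope_bound)\<^sup>2 / gap ^ 4 * R powr (7 * e)))"
    unfolding mult.assoc[of "(spread a s * spread a' s) powr C"] using LA by (intro ennreal_leI mult_left_mono) auto
  finally show "(\<integral>\<^sup>+ \<xi>\<in>ball 0 R. ennreal (amp a a' s \<xi>) \<partial>lborel)
      \<le> ennreal ((spread a s * spread a' s) powr C * (4 * real b powr (3 * e) * (1 + slope_bound)\<^sup>2 / gap ^ 4 * R powr (7 * e)))" .
qed


text \<open>The squared modulus of the transform is bounded by a double sum over arcs. Near pairs
  are estimated by absolute values; their total \<open>Nr\<close>, of order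
  \<open>R powr (- e * al)\<close>, raised to the power \<open>p\<close> compensates for the area of
  the ball. The far pairs enter through \<open>weighted_Hoelder\<close>, again with spreads as
  weights, to match the bound in \<open>amp_integral_far\<close>.\<close>

lemma decay:
  fixes R :: real
  assumes R: "1 \<le> R"
  shows "(\<integral>\<^sup>+ \<xi>\<in>ball 0 R. ennreal (cmod (LINT x|\<mu>. wave \<phi> \<xi> x) powr (2 * p)) \<partial>lborel)
    \<le> ennreal (decay_const * R powr (7 * e))"
proof -
  define s where "s = gap * R powr (- e)"
  \<comment> \<open>The summand 1 makes \<open>2 < m * s\<close> strict, so that the half-open cells
    starting at -1 contain the endpoint 1; \<open>m * s \<le> 3\<close> keeps them inside
    \<open>[-2, 2]\<close>.\<close>
  define m where "m = nat \<lfloor>2 / s\<rfloor> + 1"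
  define a where "a i = -1 + real i * s" for i
  define w where "w i = measure \<mu> (cell (a i) s)" for i
  define E where "E i \<xi> = osc (cell (a i) s) (\<lambda>_. 1) \<xi>" for i \<xi>
  define S where "S i \<xi> = avgsup (cell (a i) s) (lam / s) \<xi>" for i \<xi>
  define far where "far i j \<longleftrightarrow> i + k \<le> j \<or> j + k \<le> i" for i j :: nat
  define z where "z i j \<xi> = (if far i j then S i \<xi> * S j \<xi> else 0)" for i j \<xi>
  define Y where "Y i j = spread (a i) s * spread (a j) s" for i j
  have k1: "0 < real k + 1" by simp
  have gap: "0 < gap" "gap \<le> 1" "(real k + 1) * gap = min 1 r0"
    using r0 by (auto simp: gap_def divide_le_eq min_def)
  have Re: "0 < R powr (- e)" "R powr (- e) \<le> 1" using R e powr_mono[of "- e" 0 R] by auto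
  have ks: "(real k + 1) * s = min 1 r0 * R powr (- e)" by (simp add: s_def gap(3)[symmetric] mult.assoc)
  have s0: "0 < s" using gap Re by (simp add: s_def)
  have s1: "s \<le> 1" using mult_mono[of gap 1 "R powr (- e)" 1] gap Re by (simp add: s_def)
  have ksr: "(real k + 1) * s \<le> r0"
    unfolding ks using Re r0 mult_mono[of "min 1 r0" r0 "R powr (- e)" 1] by simp
  have m0: "0 < m" by (simp add: m_def)
  have ms: "2 < m * s" "m * s \<le> 3"
  proof -
    have fl: "real (nat \<lfloor>2 / s\<rfloor>) = of_int \<lfloor>2 / s\<rfloor>" using s0 by simp
    have "2 / s < real m" unfolding m_def using fl by (simp; linarith)
    then show "2 < m * s" using s0 by (simp add: pos_divide_less_eq)
    have "real m \<le> 2 / s + 1" unfolding m_def using fl by (simp; linarith)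
    then have "real m * s \<le> (2 / s + 1) * s" using s0 by (intro mult_right_mono) auto
    then show "m * s \<le> 3" using s0 s1 by (simp add: distrib_right)
  qed
  have r: "0 < m * s" using ms by simp
  \<comment> \<open>The grid consists of the children of a single cell of length
    \<open>m * s\<close>, so the partition lemmas for cells apply to it.\<close>
  have ch: "child (-1) (m * s) m i = cell (a i) s" for i using m0 by (simp add: child_def a_def)
  have ab: "-2 \<le> a i" "a i + s \<le> 2" if "i < m" for i
  proof -
    have "0 \<le> real i * s" using s0 by simp
    then show "-2 \<le> a i" by (simp add: a_def)
    have "(real i + 1) * s \<le> m * s" using that s0 by (intro mult_right_mono) auto
    then show "a i + s \<le> 2" using ms by (simp add: a_def distrib_right)
  qed
  have AEc: "AE x in \<mu>. x \<in> cell (-1) (m * s)"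
    using concentrated by eventually_elim (use ms in \<open>auto simp: cell_def\<close>)
  have w0: "0 \<le> w i" for i by (simp add: w_def)
  have w1: "sum w {..<m} = 1"
  proof -
    have "sum w {..<m} = measure \<mu> (cell (-1) (m * s))"
      using measure_cell_sum[OF r m0, of "-1"] by (simp add: ch w_def)
    also have "\<dots> = measure \<mu> (space \<mu>)"
      using AEc by (intro finite_measure_eq_AE) (auto simp: sets_eq_imp_space_eq[OF sets_\<mu>] elim: eventually_mono)
    finally show ?thesis by (simp add: total)
  qed
  have L0: "0 \<le> lam / s" using lam_pos s0 by simp
  have S0: "0 \<le> S i \<xi>" for i \<xi> by (simp add: S_def avgsup_nonneg L0)
  have one: "(\<lambda>_. 1) \<in> modulators q (lam / s)" for q by (rule one_in_modulators[OF L0])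
  have fourier: "(LINT x|\<mu>. wave \<phi> \<xi> x) = (\<Sum>i<m. E i \<xi>)" for \<xi>
  proof -
    have "(\<Sum>i<m. E i \<xi>) = osc (cell (-1) (m * s)) (\<lambda>_. 1) \<xi>"
      using osc_cell[OF r m0 one, of "-1" \<xi>] by (simp add: ch E_def)
    also have "\<dots> = (LINT x|\<mu>. wave \<phi> \<xi> x)"
      unfolding osc_def set_lebesgue_integral_def
      by (intro integral_cong_AE) (use AEc in \<open>auto elim: eventually_mono\<close>)
    finally show ?thesis by simp
  qed
  have E1: "cmod (E i \<xi>) \<le> w i * S i \<xi>" "cmod (E i \<xi>) \<le> w i" for i \<xi>
    using cmod_osc_le_oscsup[OF cell_sets one, of "a i" s \<xi>] cmod_osc_le[OF cell_sets one, of "a i" s \<xi>]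
    by (simp_all add: E_def w_def S_def measure_times_avgsup[OF cell_sets L0])
  define Nr where "Nr = A * R powr (- e * al)"
  have Nr0: "0 \<le> Nr" using A by (simp add: Nr_def)
  have near: "(\<Sum>j\<in>{j. j < m \<and> \<not> far i j}. w j) \<le> Nr" if i: "i < m" for i
  proof -
    let ?J = "{j. j < m \<and> \<not> far i j}"
    have "(\<Sum>j\<in>?J. w j) = measure \<mu> (\<Union>j\<in>?J. cell (a j) s)"
      unfolding w_def using disjoint_child[OF r m0, of "-1"]
      by (intro finite_measure_finite_Union[symmetric]) (auto simp: ch disjoint_family_on_def)
    also have "\<dots> \<le> measure \<mu> (ball (a i) ((real k + 1) * s))"
    proof (intro finite_measure_mono UN_least subsetI)
      fix j x assume j: "j \<in> ?J" and x: "x \<in> cell (a j) s"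
      have "\<bar>real i - real j\<bar> \<le> real k" using j by (auto simp: far_def)
      then have "\<bar>real i - real j\<bar> * s \<le> k * s" using s0 by (intro mult_right_mono) auto
      moreover have "a i - a j = (real i - real j) * s" by (simp add: a_def left_diff_distrib)
      ultimately have "\<bar>a i - a j\<bar> \<le> k * s" using s0 by (simp add: abs_mult)
      moreover have "\<bar>x - a j\<bar> < s" using x by (auto simp: cell_def)
      ultimately show "x \<in> ball (a i) ((real k + 1) * s)" by (simp add: dist_real_def distrib_right)
    qed auto
    also have "\<dots> \<le> A * ((real k + 1) * s / r0) powr al * measure \<mu> (ball (a i) r0)"
      using ab[OF i] s0 k1 ksr by (intro growth) auto
    also have "\<dots> \<le> A * (R powr (- e)) powr al * 1"
    proof (intro mult_mono powr_mono2)
      show "(real k + 1) * s / r0 \<le> R powr (- e)"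
        unfolding ks using r0 Re by (simp add: divide_le_eq min_def)
      show "measure \<mu> (ball (a i) r0) \<le> 1" using bounded_measure[of "ball (a i) r0"] total by simp
    qed (use A al s0 r0 k1 in auto)
    finally show ?thesis by (simp add: Nr_def powr_powr)
  qed
  define F where "F \<xi> = (\<Sum>i<m. \<Sum>j<m. w i * w j * z i j \<xi>)" for \<xi>
  have z0: "0 \<le> z i j \<xi>" for i j \<xi> using S0 by (simp add: z_def)
  have F0: "0 \<le> F \<xi>" for \<xi> unfolding F_def using w0 z0 by (intro sum_nonneg mult_nonneg_nonneg)
  have sq: "(cmod (LINT x|\<mu>. wave \<phi> \<xi> x))\<^sup>2 \<le> F \<xi> + Nr" for \<xi>
  proof -
    have "cmod (LINT x|\<mu>. wave \<phi> \<xi> x) \<le> (\<Sum>i<m. cmod (E i \<xi>))" unfolding fourier by (rule norm_sum)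
    then have "(cmod (LINT x|\<mu>. wave \<phi> \<xi> x))\<^sup>2 \<le> (\<Sum>i<m. cmod (E i \<xi>))\<^sup>2" by (intro power_mono) auto
    also have "\<dots> = (\<Sum>i<m. \<Sum>j<m. cmod (E i \<xi>) * cmod (E j \<xi>))" by (simp add: power2_eq_square sum_product)
    also have "\<dots> \<le> (\<Sum>i<m. \<Sum>j<m. w i * w j * z i j \<xi> + w i * (if far i j then 0 else w j))"
    proof (intro sum_mono)
      fix i j
      show "cmod (E i \<xi>) * cmod (E j \<xi>) \<le> w i * w j * z i j \<xi> + w i * (if far i j then 0 else w j)"
      proof (cases "far i j")
        case True
        have "cmod (E i \<xi>) * cmod (E j \<xi>) \<le> (w i * S i \<xi>) * (w j * S j \<xi>)"
          using E1 w0 S0 by (intro mult_mono) auto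
        then show ?thesis using True by (simp add: z_def mult_ac)
      next
        case False
        have "cmod (E i \<xi>) * cmod (E j \<xi>) \<le> w i * w j" using E1 w0 by (intro mult_mono) auto
        then show ?thesis using False by (simp add: z_def)
      qed
    qed
    also have "\<dots> = F \<xi> + (\<Sum>i<m. w i * (\<Sum>j\<in>{j. j < m \<and> \<not> far i j}. w j))"
    proof -
      have "(\<Sum>j<m. if far i j then 0 else w j) = (\<Sum>j\<in>{j. j < m \<and> \<not> far i j}. w j)" for i
        by (intro sum.mono_neutral_cong_right) auto
      then show ?thesis by (simp add: F_def sum.distrib sum_distrib_left[symmetric])
    qed
    also have "(\<Sum>i<m. w i * (\<Sum>j\<in>{j. j < m \<and> \<not> far i j}. w j)) \<le> (\<Sum>i<m. w i * Nr)"
      using near w0 by (intro sum_mono mult_left_mono) auto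
    also have "\<dots> = Nr" using w1 by (simp add: sum_distrib_right[symmetric])
    finally show ?thesis by simp
  qed
  define H where "H i j \<xi> = (if far i j then amp (a i) (a j) s \<xi> else 0)" for i j \<xi>
  have H0: "0 \<le> H i j \<xi>" for i j \<xi> by (simp add: H_def amp_def)
  have Y1: "1 \<le> Y i j" for i j
  proof -
    have "1 * 1 \<le> Y i j" unfolding Y_def
      by (intro mult_mono spread_ge_1[OF s0] order_trans[OF zero_le_one spread_ge_1[OF s0]]) auto
    then show ?thesis by simp
  qed
  \<comment> \<open>The weights are affordable at the initial scale: the spreads average to at most
    3, since triples overlap threefold and the total mass is 1.\<close>
  have sumY: "(\<Sum>i<m. \<Sum>j<m. w i * w j * Y i j) \<le> 9"
  proof -
    have one_side: "(\<Sum>i<m. w i * spread (a i) s) \<le> 3"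
    proof -
      have "(\<Sum>i<m. w i * spread (a i) s) \<le> (\<Sum>i<m. triple (-1 + real i * (m * s / m)) (m * s / m))"
        using m0 by (intro sum_mono) (simp add: w_def measure_times_spread a_def)
      also have "\<dots> \<le> 3 * measure \<mu> {-1 - m * s / m..<-1 + m * s + m * s / m}" by (rule sum_triple_le[OF r m0])
      also have "\<dots> \<le> 3 * 1" using bounded_measure[of "{-1 - m * s / m..<-1 + m * s + m * s / m}"] total
        by (intro mult_left_mono) auto
      finally show ?thesis by simp
    qed
    have "(\<Sum>i<m. \<Sum>j<m. w i * w j * Y i j) = (\<Sum>i<m. w i * spread (a i) s) * (\<Sum>j<m. w j * spread (a j) s)"
      by (simp add: Y_def sum_product mult_ac)
    also have "\<dots> \<le> 3 * 3"
      using one_side spread_ge_1[OF s0] w0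
      by (intro mult_mono sum_nonneg mult_nonneg_nonneg) (auto intro: order_trans[OF zero_le_one])
    finally show ?thesis by simp
  qed
  have Fp: "F \<xi> powr p \<le> (\<Sum>i<m. \<Sum>j<m. 9 powr C * (w i * w j * Y i j powr (- C)) * H i j \<xi>)" for \<xi>
  proof -
    let ?I = "{..<m} \<times> {..<m}"
    let ?W = "\<lambda>(i, j). w i * w j" and ?Y = "\<lambda>(i, j). Y i j" and ?z = "\<lambda>(i, j). z i j \<xi>"
    have sums: "(\<Sum>i<m. \<Sum>j<m. f i j) = (\<Sum>(i, j)\<in>?I. f i j)" for f :: "nat \<Rightarrow> nat \<Rightarrow> real"
      by (rule sum.cartesian_product)
    have "(\<Sum>q\<in>?I. ?W q * ?z q) powr p \<le> (\<Sum>q\<in>?I. ?W q * ?Y q) powr C * (\<Sum>q\<in>?I. ?W q * ?Y q powr (- C) * ?z q powr p)"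
    proof (rule weighted_Hoelder)
      have "(\<Sum>i<m. \<Sum>j<m. w i * w j) = 1" using w1 by (simp add: sum_product[symmetric])
      then show "sum ?W ?I = 1" unfolding sums by (simp add: case_prod_unfold)
      show "C + 1 \<le> p" using C p by argo
      show "0 < ?Y q" for q using Y1[of "fst q" "snd q"] by (simp add: case_prod_unfold)
      show "0 \<le> ?z q" for q using z0 by (simp add: case_prod_unfold)
    qed (use w0 C in auto)
    also have "\<dots> \<le> 9 powr C * (\<Sum>q\<in>?I. ?W q * ?Y q powr (- C) * ?z q powr p)"
    proof (intro mult_right_mono powr_mono2)
      show "(\<Sum>q\<in>?I. ?W q * ?Y q) \<le> 9" using sumY unfolding sums by (simp add: case_prod_unfold)
      show "0 \<le> (\<Sum>q\<in>?I. ?W q * ?Y q)"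
        using w0 order_trans[OF zero_le_one Y1] by (intro sum_nonneg) auto
      show "0 \<le> (\<Sum>q\<in>?I. ?W q * ?Y q powr (- C) * ?z q powr p)" using w0 by (intro sum_nonneg) auto
    qed (use C in auto)
    also have "(\<Sum>q\<in>?I. ?W q * ?z q) = F \<xi>" unfolding F_def sums by (simp add: case_prod_unfold)
    also have "(\<Sum>q\<in>?I. ?W q * ?Y q powr (- C) * ?z q powr p) = (\<Sum>i<m. \<Sum>j<m. w i * w j * Y i j powr (- C) * z i j \<xi> powr p)"
      unfolding sums by (simp add: case_prod_unfold)
    also have "\<dots> = (\<Sum>i<m. \<Sum>j<m. w i * w j * Y i j powr (- C) * H i j \<xi>)"
      by (intro sum.cong refl) (auto simp: z_def H_def amp_def S_def)
    finally show ?thesis by (simp add: sum_distrib_left mult.assoc)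
  qed
  define X where "X = 4 * real b powr (3 * e) * (1 + slope_bound)\<^sup>2 / gap ^ 4 * R powr (7 * e)"
  have X0: "0 \<le> X" using gap by (simp add: X_def)
  have far_dist: "k * s \<le> \<bar>a i - a j\<bar>" if "far i j" for i j
  proof -
    have "real k \<le> \<bar>real i - real j\<bar>" using that by (auto simp: far_def)
    then have "k * s \<le> \<bar>real i - real j\<bar> * s" using s0 by (intro mult_right_mono) auto
    moreover have "a i - a j = (real i - real j) * s" by (simp add: a_def left_diff_distrib)
    ultimately show ?thesis using s0 by (simp add: abs_mult)
  qed
  have Hm: "H i j \<in> borel_measurable borel" if "i < m" "j < m" for i j
    using amp_integral_far(1)[OF R s_def ab[OF that(1)] ab[OF that(2)] far_dist]
    by (cases "far i j") (simp_all add: H_def[abs_def])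
  have HI: "(\<integral>\<^sup>+ \<xi>\<in>ball 0 R. ennreal (H i j \<xi>) \<partial>lborel) \<le> ennreal (Y i j powr C * X)" if "i < m" "j < m" for i j
    using amp_integral_far(2)[OF R s_def ab[OF that(1)] ab[OF that(2)] far_dist] X0
    by (cases "far i j") (simp_all add: H_def X_def Y_def)
  have [measurable]: "ball (0 :: real \<times> real) R \<in> sets borel" by simp
  let ?c = "\<lambda>i j. 2 powr p * (9 powr C * (w i * w j * Y i j powr (- C)))"
  have c0: "0 \<le> ?c i j" for i j using w0 by auto
  let ?N = "2 powr p * Nr powr p"
  have pt: "ennreal (cmod (LINT x|\<mu>. wave \<phi> \<xi> x) powr (2 * p))
    \<le> (\<Sum>i<m. \<Sum>j<m. ennreal (?c i j) * ennreal (H i j \<xi>)) + ennreal ?N" for \<xi>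
  proof -
    let ?f = "cmod (LINT x|\<mu>. wave \<phi> \<xi> x)"
    have "?f powr (2 * p) = (?f\<^sup>2) powr p" by (simp add: powr_powr flip: powr_numeral)
    also have "\<dots> \<le> (F \<xi> + Nr) powr p" using sq p_pos by (intro powr_mono2) auto
    also have "\<dots> \<le> 2 powr p * (F \<xi> powr p + Nr powr p)" using F0 Nr0 p_pos by (intro powr_add_le) auto
    also have "\<dots> \<le> 2 powr p * ((\<Sum>i<m. \<Sum>j<m. 9 powr C * (w i * w j * Y i j powr (- C)) * H i j \<xi>) + Nr powr p)"
      using Fp by (intro mult_left_mono add_right_mono) auto
    also have "\<dots> = (\<Sum>i<m. \<Sum>j<m. ?c i j * H i j \<xi>) + ?N"
      by (simp add: distrib_left sum_distrib_left mult.assoc)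
    finally have "ennreal (?f powr (2 * p)) \<le> ennreal ((\<Sum>i<m. \<Sum>j<m. ?c i j * H i j \<xi>) + ?N)" by (rule ennreal_leI)
    also have "\<dots> = ennreal (\<Sum>i<m. \<Sum>j<m. ?c i j * H i j \<xi>) + ennreal ?N"
      by (intro ennreal_plus sum_nonneg mult_nonneg_nonneg[OF c0 H0]) auto
    also have "ennreal (\<Sum>i<m. \<Sum>j<m. ?c i j * H i j \<xi>) = (\<Sum>i<m. ennreal (\<Sum>j<m. ?c i j * H i j \<xi>))"
      by (intro sum_ennreal[symmetric] sum_nonneg mult_nonneg_nonneg[OF c0 H0])
    also have "\<dots> = (\<Sum>i<m. \<Sum>j<m. ennreal (?c i j * H i j \<xi>))"
      by (intro sum.cong refl sum_ennreal[symmetric] mult_nonneg_nonneg[OF c0 H0])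
    also have "\<dots> = (\<Sum>i<m. \<Sum>j<m. ennreal (?c i j) * ennreal (H i j \<xi>))"
      by (simp only: ennreal_mult[OF c0 H0])
    finally show ?thesis .
  qed
  define G where "G \<xi> = 1 * (\<Sum>i<m. \<Sum>j<m. ennreal (?c i j) * (ennreal (H i j \<xi>) * indicator (ball 0 R) \<xi>))" for \<xi>
  have Gm: "G \<in> borel_measurable lborel"
  proof -
    have "(\<lambda>\<xi>. ennreal c * (ennreal (H i j \<xi>) * indicator (ball 0 R) \<xi>)) \<in> borel_measurable lborel"
      if "i < m" "j < m" for c i j using Hm[OF that] by measurable
    then show ?thesis unfolding G_def[abs_def] mult_1 by (intro borel_measurable_sum) auto
  qed
  have "(\<integral>\<^sup>+ \<xi>\<in>ball 0 R. ennreal (cmod (LINT x|\<mu>. wave \<phi> \<xi> x) powr (2 * p)) \<partial>lborel)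
    \<le> (\<integral>\<^sup>+ \<xi>. G \<xi> + ennreal ?N * indicator (ball 0 R) \<xi> \<partial>lborel)"
  proof (rule nn_integral_mono)
    fix \<xi> :: "real \<times> real"
    show "ennreal (cmod (LINT x|\<mu>. wave \<phi> \<xi> x) powr (2 * p)) * indicator (ball 0 R) \<xi>
      \<le> G \<xi> + ennreal ?N * indicator (ball 0 R) \<xi>"
      using pt[of \<xi>] by (cases "\<xi> \<in> ball 0 R") (simp_all add: G_def)
  qed
  also have "\<dots> = (\<integral>\<^sup>+ \<xi>. G \<xi> \<partial>lborel) + (\<integral>\<^sup>+ \<xi>. ennreal ?N * indicator (ball (0 :: real \<times> real) R) \<xi> \<partial>lborel)"
    by (intro nn_integral_add Gm) measurable
  also have "\<dots> = 1 * (\<Sum>i<m. \<Sum>j<m. ennreal (?c i j) * (\<integral>\<^sup>+ \<xi>\<in>ball 0 R. ennreal (H i j \<xi>) \<partial>lborel))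
     + ennreal ?N * emeasure lborel (ball (0 :: real \<times> real) R)"
    unfolding G_def
  proof (intro arg_cong2[where f="(+)"] nn_integral_double_sum)
    show "(\<lambda>\<xi>. ennreal (H i j \<xi>) * indicator (ball 0 R) \<xi>) \<in> borel_measurable lborel" if "i < m" "j < m" for i j
      using Hm[OF that] by measurable
  qed (simp add: nn_integral_cmult_indicator)
  also have "\<dots> \<le> 1 * (\<Sum>i<m. \<Sum>j<m. ennreal (?c i j) * ennreal (Y i j powr C * X)) + ennreal ?N * ennreal (4 * R\<^sup>2)"
    using R by (intro add_mono mult_left_mono sum_mono HI emeasure_ball_real2_le) auto
  also have "\<dots> = ennreal (2 powr p * 9 powr C * X + ?N * (4 * R\<^sup>2))"
  proof -
    have "ennreal (?c i j) * ennreal (Y i j powr C * X) = ennreal (2 powr p * 9 powr C * X * (w i * w j))" for i j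
    proof -
      have "Y i j powr (- C) * Y i j powr C = 1" using Y1[of i j] by (simp add: powr_add[symmetric])
      then have "?c i j * (Y i j powr C * X) = 2 powr p * 9 powr C * X * (w i * w j)" by (simp add: mult_ac)
      moreover have "ennreal (?c i j) * ennreal (Y i j powr C * X) = ennreal (?c i j * (Y i j powr C * X))"
        using X0 by (intro ennreal_mult[symmetric] c0) auto
      ultimately show ?thesis by (simp only:)
    qed
    then have "(\<Sum>i<m. \<Sum>j<m. ennreal (?c i j) * ennreal (Y i j powr C * X)) = (\<Sum>i<m. \<Sum>j<m. ennreal (2 powr p * 9 powr C * X * (w i * w j)))"
      by simp
    also have "\<dots> = ennreal (\<Sum>i<m. \<Sum>j<m. 2 powr p * 9 powr C * X * (w i * w j))"
      using w0 X0 by (simp add: sum_ennreal sum_nonneg)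
    also have "(\<Sum>i<m. \<Sum>j<m. 2 powr p * 9 powr C * X * (w i * w j)) = 2 powr p * 9 powr C * X"
      using w1 by (simp only: sum_distrib_left[symmetric] sum_distrib_right[symmetric] mult_1_right)
    finally show ?thesis using X0 by (simp add: ennreal_mult ennreal_plus)
  qed
  also have "\<dots> \<le> ennreal (decay_const * R powr (7 * e))"
  proof (rule ennreal_leI)
    \<comment> \<open>Here \<open>p_large\<close> is used: \<open>e * al * p \<ge> 2\<close> cancels
      the area factor \<open>R powr 2\<close>.\<close>
    have "Nr powr p * R\<^sup>2 = A powr p * (R powr (- e * al * p) * R powr 2)"
      using R by (simp add: Nr_def powr_mult powr_powr mult.assoc)
    also have "R powr (- e * al * p) * R powr 2 = R powr (2 - e * al * p)" unfolding powr_add[symmetric] by simp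
    also have "\<dots> \<le> R powr (7 * e)" using R p_large e by (intro powr_mono) auto
    finally have "Nr powr p * R\<^sup>2 \<le> A powr p * R powr (7 * e)" by (simp add: mult_left_mono)
    then have "2 powr p * (4 * (Nr powr p * R\<^sup>2)) \<le> 2 powr p * (4 * (A powr p * R powr (7 * e)))"
      by (intro mult_left_mono) auto
    then show "2 powr p * 9 powr C * X + ?N * (4 * R\<^sup>2) \<le> decay_const * R powr (7 * e)"
      unfolding decay_const_def X_def by (simp add: distrib_left distrib_right mult_ac)
  qed
  finally show ?thesis .
qed

end

section \<open>Uniformly perfect measures\<close>

text \<open>The complement of the support is a union of null balls, and by Lindelof's theorem
  countably many of them cover it.\<close>

lemma emeasure_compl_spt:
  fixes \<sigma> :: "'a::{metric_space, second_countable_topology} measure"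
  assumes "sets \<sigma> = sets borel" shows "- spt \<sigma> \<in> null_sets \<sigma>"
proof -
  let ?F = "{ball x r | x r. 0 < r \<and> emeasure \<sigma> (ball x r) = 0}"
  have "\<And>S. S \<in> ?F \<Longrightarrow> open S" by auto
  then obtain F where F: "F \<subseteq> ?F" "countable F" "\<Union>F = \<Union>?F" by (rule Lindelof)
  have "\<Union>F \<in> null_sets \<sigma>"
    using F(1,2) assms by (intro null_sets_UN'[where N="\<lambda>S. S", simplified]) (auto simp: null_sets_def)
  moreover have "- spt \<sigma> = \<Union>F"
  proof
    show "- spt \<sigma> \<subseteq> \<Union>F"
    proof
      fix x assume "x \<in> - spt \<sigma>"
      then obtain r where "0 < r" "emeasure \<sigma> (ball x r) = 0" by (auto simp: spt_def)
      then have "ball x r \<in> ?F" "x \<in> ball x r" by auto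
      then show "x \<in> \<Union>F" unfolding F(3) by blast
    qed
    show "\<Union>F \<subseteq> - spt \<sigma>"
    proof
      fix y assume "y \<in> \<Union>F"
      then obtain x r where xr: "0 < r" "emeasure \<sigma> (ball x r) = 0" "y \<in> ball x r" using F(1) by blast
      define d where "d = r - dist x y"
      have "ball y d \<subseteq> ball x r" unfolding d_def by (rule subsetI) (use dist_triangle in \<open>smt (verit) mem_ball\<close>)
      then have "emeasure \<sigma> (ball y d) \<le> emeasure \<sigma> (ball x r)" using assms by (intro emeasure_mono) auto
      moreover have "0 < d" using xr by (simp add: d_def)
      ultimately show "y \<in> - spt \<sigma>" using xr(2) by (auto simp: spt_def)
    qed
  qed
  ultimately show ?thesis by simp
qed

lemma obtain_power_between:
  fixes D x :: real
  assumes "1 < D" "1 \<le> x"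
  obtains j :: nat where "D ^ j \<le> x" "x < D ^ Suc j"
proof -
  define j where "j = nat \<lfloor>log D x\<rfloor>"
  have l: "0 \<le> log D x" using assms by simp
  have x: "x = D powr log D x" using assms by simp
  have "D powr real j \<le> D powr log D x" using assms l by (intro powr_mono) (auto simp: j_def)
  then have "D ^ j \<le> x" using assms x by (simp add: powr_realpow)
  moreover have "D powr log D x < D powr real (Suc j)" using assms l by (intro powr_less_mono) (auto simp: j_def, linarith)
  then have "x < D ^ Suc j" using assms x by (metis less_trans powr_realpow zero_less_one)
  ultimately show ?thesis by (rule that)
qed

text \<open>A support of diameter at least \<open>d\<close> does not fit into a ball of radius below
  \<open>d / 2\<close>, whatever its centre; so the defining inequality is available at each of the
  \<open>j\<close> dilations.\<close>

lemma uniformly_perfect_iterate: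
  fixes \<sigma> :: "(real \<times> real) measure"
  assumes \<sigma>: "prob_space \<sigma>" "uniformly_perfect D \<beta> \<sigma>" and D: "1 < D" and \<beta>: "0 \<le> \<beta>" "\<beta> \<le> \<beta>'"
    and diam: "d \<le> diameter (spt \<sigma>)" and r: "0 < r" "2 * (D ^ j * r) < d"
  shows "measure \<sigma> (ball x r) \<le> \<beta>' ^ j * measure \<sigma> (ball x (D ^ j * r))"
  using r(2)
proof (induction j)
  case (Suc j)
  interpret prob_space \<sigma> by (rule \<sigma>(1))
  let ?s = "D ^ j * r"
  have s: "0 < ?s" using r(1) D by simp
  have "1 * ?s \<le> D * ?s" using D s by (intro mult_right_mono) auto
  then have "2 * ?s < d" using Suc.prems by (simp add: mult.assoc)
  note IH = Suc.IH[OF this]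
  have "\<not> spt \<sigma> \<subseteq> ball x (D * ?s)"
  proof
    assume "spt \<sigma> \<subseteq> ball x (D * ?s)"
    then have "diameter (spt \<sigma>) \<le> diameter (ball x (D * ?s))" by (intro diameter_subset bounded_ball)
    also have "\<dots> \<le> 2 * (D * ?s)" using D s by simp
    finally show False using diam Suc.prems by (simp add: mult.assoc)
  qed
  then have "emeasure \<sigma> (ball x ?s) \<le> ennreal \<beta> * emeasure \<sigma> (ball x (D * ?s))"
    using \<sigma>(2) s unfolding uniformly_perfect_on_def by blast
  then have "measure \<sigma> (ball x ?s) \<le> \<beta> * measure \<sigma> (ball x (D * ?s))"
    using \<beta> by (simp add: emeasure_eq_measure ennreal_mult[symmetric])
  also have "\<dots> \<le> \<beta>' * measure \<sigma> (ball x (D * ?s))" using \<beta> by (intro mult_right_mono) auto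
  finally have "\<beta>' ^ j * measure \<sigma> (ball x ?s) \<le> \<beta>' ^ j * (\<beta>' * measure \<sigma> (ball x (D * ?s)))"
    using \<beta> by (intro mult_left_mono) auto
  then show ?case using IH by (simp add: mult_ac)
qed simp

text \<open>Over the interval of radius \<open>\<rho>\<close> the curve stays in a planar ball of
  radius \<open>(1 + M) * \<rho>\<close>, and planar balls project into intervals of the same
  radius; between the two, uniform perfectness is iterated about \<open>log D (r' / \<rho>)\<close>
  times. The exponent \<open>al\<close> solves \<open>D powr (- al) = \<beta>'\<close>. If
  \<open>r'\<close> is below \<open>(1 + M) * \<rho>\<close>, the factor is at least 1 and
  monotonicity suffices.\<close>

lemma uniformly_perfect_growth:
  fixes \<sigma> :: "(real \<times> real) measure"
  assumes \<sigma>: "prob_space \<sigma>" "sets \<sigma> = sets borel" "uniformly_perfect D \<beta> \<sigma>" "spt \<sigma> \<subseteq> curveP \<phi>"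
    and D: "1 < D" and \<beta>: "0 \<le> \<beta>" "\<beta> \<le> \<beta>'" "0 < \<beta>'" "\<beta>' < 1" and diam: "d \<le> diameter (spt \<sigma>)"
    and Lip: "\<And>x y. x \<in> {-2..2} \<Longrightarrow> y \<in> {-2..2} \<Longrightarrow> \<bar>\<phi> x - \<phi> y\<bar> \<le> M * \<bar>x - y\<bar>" "0 \<le> M"
    and al: "al = ln (1 / \<beta>') / ln D" and x: "x \<in> {-2..2}" and \<rho>: "0 < \<rho>" "\<rho> \<le> r'" "r' \<le> d / 4"
  shows "measure (distr \<sigma> borel fst) (ball x \<rho>)
    \<le> (D * (1 + M)) powr al * (\<rho> / r') powr al * measure (distr \<sigma> borel fst) (ball x r')"
proof -
  interpret prob_space \<sigma> by (rule \<sigma>(1))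
  note [measurable_cong] = \<sigma>(2)
  let ?\<mu> = "distr \<sigma> borel fst"
  have fst_meas [measurable]: "fst \<in> \<sigma> \<rightarrow>\<^sub>M (borel :: real measure)"
    unfolding measurable_cong_sets[OF \<sigma>(2) refl]
    by (intro borel_measurable_continuous_onI continuous_on_fst continuous_on_id)
  have \<mu>: "measure ?\<mu> S = measure \<sigma> (fst -` S)" if "S \<in> sets borel" for S
    using that sets_eq_imp_space_eq[OF \<sigma>(2)] by (subst measure_distr[OF fst_meas]) auto
  have al0: "0 < al" using D \<beta> by (simp add: al)
  have Dal: "D powr (- al) = \<beta>'" using D \<beta> by (simp add: al powr_def ln_div)
  define K where "K = 1 + M"
  have K: "1 \<le> K" using Lip by (simp add: K_def)
  let ?P = "(x, \<phi> x)"
  have small: "measure ?\<mu> (ball x \<rho>) \<le> measure \<sigma> (ball ?P (K * \<rho>))"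
  proof -
    have "AE z in \<sigma>. z \<in> curveP \<phi>"
      using emeasure_compl_spt[OF \<sigma>(2)] \<sigma>(4) by (intro AE_I'[of "- spt \<sigma>"]) auto
    then have "AE z in \<sigma>. z \<in> fst -` ball x \<rho> \<longrightarrow> z \<in> ball ?P (K * \<rho>)"
    proof eventually_elim
      case (elim z)
      then obtain y where y: "z = (y, \<phi> y)" "y \<in> {-1..1}" by (auto simp: curveP_def)
      have "\<bar>\<phi> x - \<phi> y\<bar> \<le> M * \<bar>x - y\<bar>" using y x by (intro Lip) auto
      then have "dist ?P z \<le> \<bar>x - y\<bar> + M * \<bar>x - y\<bar>"
        using norm_Pair_le[of "x - y" "\<phi> x - \<phi> y"] by (simp add: y dist_norm)
      also have "\<dots> = K * \<bar>x - y\<bar>" by (simp add: K_def distrib_right)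
      finally have "dist ?P z \<le> K * \<bar>x - y\<bar>" .
      moreover have "K * \<bar>x - y\<bar> < K * \<rho>" if "\<bar>x - y\<bar> < \<rho>" using that K by simp
      ultimately show ?case by (auto simp: y dist_real_def)
    qed
    then show ?thesis unfolding \<mu>[OF borel_open[OF open_ball]]
      using \<sigma>(2) by (intro finite_measure_mono_AE) auto
  qed
  have large: "measure \<sigma> (ball ?P s) \<le> measure ?\<mu> (ball x s)" for s
  proof -
    have "ball ?P s \<subseteq> fst -` ball x s"
    proof
      fix z assume "z \<in> ball ?P s"
      then have "dist x (fst z) < s" using dist_fst_le[of ?P z] by simp
      then show "z \<in> fst -` ball x s" by simp
    qed
    moreover have "fst -` ball x s \<in> sets \<sigma>" unfolding \<sigma>(2) by (intro borel_open open_vimage_fst) auto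
    ultimately show ?thesis unfolding \<mu>[OF borel_open[OF open_ball]] by (intro finite_measure_mono)
  qed
  have mono: "measure ?\<mu> (ball x s) \<le> measure ?\<mu> (ball x s')" if "s \<le> s'" for s s'
  proof -
    interpret M: prob_space ?\<mu> by (rule prob_space_distr[OF fst_meas])
    show ?thesis using that by (intro M.finite_measure_mono) auto
  qed
  have r'0: "0 < r'" using \<rho> by simp
  show ?thesis
  proof (cases "r' < K * \<rho>")
    case True
    have "1 \<le> (D * K * (\<rho> / r')) powr al"
    proof (intro ge_one_powr_ge_zero)
      have "1 \<le> K * \<rho> / r'" using True r'0 by simp
      then have "1 * 1 \<le> D * (K * \<rho> / r')" using D by (intro mult_mono) auto
      then show "1 \<le> D * K * (\<rho> / r')" by (simp add: mult.assoc)
    qed (use al0 in simp)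
    then have "1 * measure ?\<mu> (ball x r') \<le> (D * K * (\<rho> / r')) powr al * measure ?\<mu> (ball x r')"
      by (intro mult_right_mono) auto
    then show ?thesis using mono[OF \<rho>(2)] unfolding K_def[symmetric] powr_mult[of "D * K" "\<rho> / r'"] by linarith
  next
    case False
    then have "1 \<le> r' / (K * \<rho>)" using K \<rho> by simp
    then obtain j where j: "D ^ j \<le> r' / (K * \<rho>)" "r' / (K * \<rho>) < D ^ Suc j" by (rule obtain_power_between[OF D])
    have Kr: "0 < K * \<rho>" using K \<rho> by simp
    have j1: "D ^ j * (K * \<rho>) \<le> r'" using j(1) Kr by (simp add: pos_le_divide_eq)
    have "r' < D ^ Suc j * (K * \<rho>)" using j(2) Kr by (simp add: pos_divide_less_eq)
    then have j2: "1 < D ^ j * (D * K * (\<rho> / r'))" using r'0 by (simp add: field_simps)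
    have d: "2 * (D ^ j * (K * \<rho>)) < d" using j1 \<rho> by linarith
    have "\<beta>' ^ j \<le> (D * K * (\<rho> / r')) powr al"
    proof -
      have "1 \<le> (D ^ j * (D * K * (\<rho> / r'))) powr al" using j2 al0 by (intro ge_one_powr_ge_zero) auto
      also have "\<dots> = (D ^ j) powr al * (D * K * (\<rho> / r')) powr al" by (rule powr_mult)
      finally have "(D ^ j) powr (- al) * 1 \<le> (D ^ j) powr (- al) * ((D ^ j) powr al * (D * K * (\<rho> / r')) powr al)"
        by (intro mult_left_mono) auto
      also have "\<dots> = (D * K * (\<rho> / r')) powr al"
        using D by (simp add: mult.assoc[symmetric] powr_add[symmetric])
      also have "(D ^ j) powr (- al) = (D powr (- al)) ^ j"
        using D by (simp add: powr_realpow[symmetric] powr_powr mult.commute)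
      finally show ?thesis by (simp add: Dal)
    qed
    moreover have "measure ?\<mu> (ball x \<rho>) \<le> \<beta>' ^ j * measure ?\<mu> (ball x r')"
    proof -
      have "measure ?\<mu> (ball x \<rho>) \<le> \<beta>' ^ j * measure \<sigma> (ball ?P (D ^ j * (K * \<rho>)))"
        using small uniformly_perfect_iterate[OF \<sigma>(1,3) D \<beta>(1,2) diam Kr d] by (meson order_trans)
      also have "\<dots> \<le> \<beta>' ^ j * measure ?\<mu> (ball x r')"
        using large mono[OF j1] \<beta> by (intro mult_left_mono) (auto intro: order_trans)
      finally show ?thesis .
    qed
    ultimately have "measure ?\<mu> (ball x \<rho>) \<le> (D * K * (\<rho> / r')) powr al * measure ?\<mu> (ball x r')"
      by (meson measure_nonneg mult_right_mono order_trans)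
    then show ?thesis unfolding K_def[symmetric] powr_mult[of "D * K" "\<rho> / r'"] .
  qed
qed

section \<open>Choice of the parameters and conclusion\<close>

lemma inverse_powr_small:
  fixes b q :: real
  assumes "0 < q" "q < 1" "0 < b" "ln (1 / b) / ln q \<le> p" shows "q powr p \<le> 1 / b"
proof -
  have "ln q < 0" using assms by simp
  then have "p * ln q \<le> ln (1 / b)" using assms(4) by (simp add: neg_divide_le_eq)
  then have "exp (p * ln q) \<le> exp (ln (1 / b))" by simp
  then show ?thesis using assms by (simp add: powr_def)
qed

lemma obtain_scale_ratio:
  fixes X Y e :: real
  assumes "0 < e"
  obtains b :: nat where "4 \<le> b" "X \<le> real b powr e" "Y \<le> (real b)\<^sup>2"
proof -
  define b where "b = nat \<lceil>max 4 (max (max 1 X powr (1 / e)) Y)\<rceil>"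
  have b: "max 4 (max (max 1 X powr (1 / e)) Y) \<le> real b" unfolding b_def by linarith
  then have "4 \<le> real b" "max 1 X powr (1 / e) \<le> real b" "Y \<le> real b" by auto
  moreover have "X \<le> real b powr e"
  proof -
    have "X \<le> max 1 X" by simp
    also have "\<dots> = (max 1 X powr (1 / e)) powr e" using assms by (simp add: powr_powr)
    also have "\<dots> \<le> real b powr e" using assms \<open>max 1 X powr (1 / e) \<le> real b\<close> by (intro powr_mono2) auto
    finally show ?thesis .
  qed
  moreover have "real b \<le> (real b)\<^sup>2" using \<open>4 \<le> real b\<close> by (simp add: power2_eq_square)
  ultimately show ?thesis using order_trans[of Y "real b" "(real b)\<^sup>2"] by (intro that[of b]) auto
qed

theorem theorem1p1:
  fixes \<phi> \<phi>' \<phi>'' :: "real \<Rightarrow> real"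
  assumes d1: "\<And>x. (\<phi> has_real_derivative \<phi>' x) (at x)"
    and d2: "\<And>x. (\<phi>' has_real_derivative \<phi>'' x) (at x)"
    and c2: "continuous_on UNIV \<phi>''"
    and conv: "\<And>x. x \<in> {-2..2} \<Longrightarrow> \<phi>'' x > 0"
  shows "\<forall>D \<beta> \<epsilon>. D > 1 \<and> 0 \<le> \<beta> \<and> \<beta> < 1 \<and> 0 < \<epsilon> \<and> \<epsilon> < 1 \<longrightarrow>
    (\<exists>p::real. p \<ge> 1 \<and>
      (\<forall>\<dd>::real. \<dd> > 0 \<longrightarrow>
        (\<exists>C::real. \<forall>\<sigma>::(real \<times> real) measure.
           prob_space \<sigma> \<and> sets \<sigma> = sets borel \<and> uniformly_perfect D \<beta> \<sigma> \<and>
           spt \<sigma> \<subseteq> curveP \<phi> \<and> diameter (spt \<sigma>) \<ge> \<dd> \<longrightarrow>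
           (\<forall>R::real. R \<ge> 1 \<longrightarrow>
              (\<integral>\<^sup>+ \<xi> \<in> ball 0 R. ennreal (cmod (fourier_meas \<sigma> \<xi>) powr p) \<partial>lborel)
                \<le> ennreal (C * R powr \<epsilon>)))))"
proof (intro allI impI, elim conjE)
  fix D \<beta> \<epsilon> :: real
  assume D: "1 < D" and \<beta>: "0 \<le> \<beta>" "\<beta> < 1" and \<epsilon>: "0 < \<epsilon>" "\<epsilon> < 1"
  have \<phi>c: "continuous_on S \<phi>" and \<phi>'c: "continuous_on S \<phi>'" for S
    using d1 d2 by (meson DERIV_isCont continuous_at_imp_continuous_on)+
  have \<phi>''c: "continuous_on {-2..2} \<phi>''" using c2 by (rule continuous_on_subset) simp
  obtain x0 where x0: "x0 \<in> {-2..2}" "\<And>y. y \<in> {-2..2} \<Longrightarrow> \<phi>'' x0 \<le> \<phi>'' y"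
    using continuous_attains_inf[OF compact_Icc _ \<phi>''c] by fastforce
  obtain x1 where x1: "x1 \<in> {-2..2}" "\<And>y. y \<in> {-2..2} \<Longrightarrow> \<phi>'' y \<le> \<phi>'' x1"
    using continuous_attains_sup[OF compact_Icc _ \<phi>''c] by fastforce
  define ka where "ka = \<phi>'' x0"
  define La where "La = \<phi>'' x1"
  have ka: "0 < ka" using conv x0(1) by (simp add: ka_def)
  have slope: "ka * \<bar>x - y\<bar> \<le> \<bar>\<phi>' x - \<phi>' y\<bar> \<and> \<bar>\<phi>' x - \<phi>' y\<bar> \<le> La * \<bar>x - y\<bar>"
    if xy: "x \<in> {-2..2}" "y \<in> {-2..2}" for x y
  proof -
    have ord: "ka * (v - u) \<le> \<phi>' v - \<phi>' u \<and> \<phi>' v - \<phi>' u \<le> La * (v - u)"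
      if uv: "u < v" "u \<in> {-2..2}" "v \<in> {-2..2}" for u v
    proof -
      obtain z where z: "u < z" "z < v" "\<phi>' v - \<phi>' u = (v - u) * \<phi>'' z" using MVT2[OF uv(1), of \<phi>' \<phi>''] d2 by blast
      have "z \<in> {-2..2}" using z uv by auto
      then have "ka \<le> \<phi>'' z" "\<phi>'' z \<le> La" using x0(2) x1(2) by (auto simp: ka_def La_def)
      then show ?thesis unfolding z(3) using uv(1) by (simp add: mult.commute)
    qed
    consider "x < y" | "y < x" | "x = y" by linarith
    then show ?thesis
    proof cases
      case 1
      have "0 \<le> ka * (y - x)" using 1 ka by simp
      with ord[OF 1 xy] 1 show ?thesis by simp
    next
      case 2
      have "0 \<le> ka * (x - y)" using 2 ka by simp
      with ord[OF 2 xy(2,1)] 2 show ?thesis by simp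
    qed simp
  qed
  have "bounded (\<phi>' ` {-2..2})" by (intro compact_imp_bounded compact_continuous_image \<phi>'c) simp
  then obtain M1 where M1: "\<And>x. x \<in> {-2..2} \<Longrightarrow> \<bar>\<phi>' x\<bar> \<le> M1" unfolding bounded_iff real_norm_def by blast
  have M0: "0 \<le> M1" using M1[of 0] by simp
  have Lip: "\<bar>\<phi> x - \<phi> y\<bar> \<le> M1 * \<bar>x - y\<bar>" if xy: "x \<in> {-2..2}" "y \<in> {-2..2}" for x y
  proof -
    have "norm (\<phi> x - \<phi> y) \<le> M1 * norm (x - y)"
      using M1 d1 xy by (intro field_differentiable_bound[of "{-2..2}" \<phi> \<phi>']) (auto intro: has_field_derivative_at_within)
    then show ?thesis by simp
  qed
  \<comment> \<open>\<open>\<beta>\<close> may be 0; enlarging it keeps the logarithm in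
    \<open>al\<close> meaningful and \<open>al\<close> positive.\<close>
  define \<beta>' where "\<beta>' = max \<beta> (1 / 2)"
  have \<beta>': "\<beta> \<le> \<beta>'" "0 < \<beta>'" "\<beta>' < 1" using \<beta> by (auto simp: \<beta>'_def)
  define al where "al = ln (1 / \<beta>') / ln D"
  have al: "0 < al" using D \<beta>' by (simp add: al_def)
  define A where "A = (D * (1 + M1)) powr al"
  have "1 * 1 \<le> D * (1 + M1)" using D M0 by (intro mult_mono) auto
  then have A: "1 \<le> A" using al by (simp add: A_def ge_one_powr_ge_zero)
  \<comment> \<open>Solves \<open>A * (1 / D') powr al = 1 / 2\<close>, so that growth between the
    radii \<open>\<rho>\<close> and \<open>D' * \<rho>\<close> becomes the factor 2.\<close>
  define D' where "D' = (2 * A) powr (1 / al)"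
  have D': "1 \<le> D'" using A al by (simp add: D'_def ge_one_powr_ge_zero)
  have D'al: "D' powr al = 2 * A" using A al by (simp add: D'_def powr_powr)
  define lam where "lam = 1 / (200 * D')"
  have lam: "0 < lam" "lam \<le> 1" using D' by (auto simp: lam_def divide_le_eq)
  define e where "e = \<epsilon> / 8"
  have e: "0 < e" "e \<le> 1" "7 * e \<le> \<epsilon>" using \<epsilon> by (auto simp: e_def)
  note e7 = e(3)
  \<comment> \<open>With \<open>g = b powr e\<close> the left side of \<open>edge_gain\<close> is a
    constant times \<open>b powr (- e * al * C) = b powr (- 4)\<close>. The constant will be at most
    \<open>b\<^sup>2\<close>, which leaves \<open>b powr (- 2)\<close>.\<close>
  define C where "C = 4 / (e * al)"
  have C: "0 < C" "e * al * C = 4" using e al by (auto simp: C_def)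
  \<comment> \<open>The constants to be dominated involve \<open>C\<close>, \<open>lam\<close> and
    \<open>A\<close> but not \<open>p\<close>, so \<open>b\<close> can precede
    \<open>p\<close>.\<close>
  obtain b :: nat where b: "4 \<le> b" "max 3 (9 powr C * (64 / lam\<^sup>2 + 1)) \<le> real b powr e"
      "(12 * A * 3 powr al) powr C \<le> (real b)\<^sup>2"
    by (rule obtain_scale_ratio[OF e(1)])
  define g where "g = real b powr e"
  have b1: "1 \<le> real b" using b(1) by simp
  have g: "3 \<le> g" "9 powr C * (64 / lam\<^sup>2 + 1) \<le> g" "g \<le> b"
    using b(2) powr_mono[OF e(2) b1] b1 by (auto simp: g_def)
  have edge: "(12 * A * (3 / g) powr al) powr C \<le> 1 / (real b)\<^sup>2"
  proof -
    have "(3 / g) powr al = 3 powr al * real b powr (- (e * al))"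
      using b1 by (simp add: g_def powr_divide powr_powr powr_minus_divide)
    then have "(12 * A * (3 / g) powr al) powr C = ((12 * A * 3 powr al) * real b powr (- (e * al))) powr C"
      by (simp add: mult_ac)
    also have "\<dots> = (12 * A * 3 powr al) powr C * real b powr (- 4)"
      unfolding powr_mult[of "12 * A * 3 powr al"] powr_powr using C(2) by simp
    also have "\<dots> \<le> (real b)\<^sup>2 * real b powr (- 4)" using b(3) by (intro mult_right_mono) auto
    also have "\<dots> = real b powr 2 * real b powr (- 4)" using b1 by simp
    also have "\<dots> = real b powr (- 2)" unfolding powr_add[symmetric] by simp
    also have "\<dots> = 1 / (real b)\<^sup>2" using b1 by (simp add: powr_minus_divide)
    finally show ?thesis .
  qed
  define \<eta> where "\<eta> = lam\<^sup>2 / 8 / (32 * real b)"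
  have \<eta>: "0 < \<eta>" "\<eta> < 1"
  proof -
    show "0 < \<eta>" using lam b1 by (simp add: \<eta>_def)
    have "lam\<^sup>2 \<le> 1" using lam by (simp add: power_le_one)
    then show "\<eta> < 1" using b1 by (simp add: \<eta>_def divide_less_eq)
  qed
  \<comment> \<open>Three demands: the exponent needed for \<open>weighted_Hoelder\<close> after
    squaring, the near pairs against the area of the ball, and the gain \<open>1 / b\<^sup>2\<close>
    from the factor \<open>1 - \<eta>\<close>. None of them involves the diameter of the
    support.\<close>
  define p where "p = max (2 * (C + 1)) (max (2 / (e * al)) (ln (1 / (real b)\<^sup>2) / ln (1 - \<eta>)))"
  have p: "2 * (C + 1) \<le> p" "2 / (e * al) \<le> p" "ln (1 / (real b)\<^sup>2) / ln (1 - \<eta>) \<le> p" by (auto simp: p_def)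
  have p2: "2 \<le> e * al * p" using p(2) e al by (simp add: pos_divide_le_eq mult.commute)
  have gain: "(1 - \<eta>) powr p \<le> 1 / (real b)\<^sup>2" using \<eta> b1 p(3) by (intro inverse_powr_small) auto
  have loss: "9 powr C * (64 / lam\<^sup>2 + 1) * (g / b)\<^sup>2 * (real b)\<^sup>2 \<le> real b powr (3 * e)"
  proof -
    have "9 powr C * (64 / lam\<^sup>2 + 1) * (g / b)\<^sup>2 * (real b)\<^sup>2 = 9 powr C * (64 / lam\<^sup>2 + 1) * g\<^sup>2"
      using b1 by (simp add: power_divide)
    also have "\<dots> \<le> g * g\<^sup>2" using g by (intro mult_right_mono) auto
    also have "\<dots> = g ^ 3" by (simp add: power3_eq_cube power2_eq_square)
    also have "\<dots> = real b powr (3 * e)" using b1 by (simp add: g_def powr_realpow[symmetric] powr_powr mult.commute)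
    finally show ?thesis .
  qed
  define k where "k = nat \<lceil>8 * La / ka\<rceil> + 1"
  have k: "1 \<le> k" "8 * La \<le> ka * k"
  proof -
    have "8 * La / ka \<le> k" unfolding k_def by linarith
    then show "8 * La \<le> ka * k" using ka by (simp add: pos_divide_le_eq mult.commute)
  qed (simp add: k_def)
  show "\<exists>p\<ge>1. \<forall>\<dd>>0. \<exists>C. \<forall>\<sigma>::(real \<times> real) measure.
           prob_space \<sigma> \<and> sets \<sigma> = sets borel \<and> uniformly_perfect D \<beta> \<sigma> \<and>
           spt \<sigma> \<subseteq> curveP \<phi> \<and> diameter (spt \<sigma>) \<ge> \<dd> \<longrightarrow>
           (\<forall>R\<ge>1. (\<integral>\<^sup>+ \<xi> \<in> ball 0 R. ennreal (cmod (fourier_meas \<sigma> \<xi>) powr p) \<partial>lborel)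
                \<le> ennreal (C * R powr \<epsilon>))"
  \<comment> \<open>\<open>amp\<close> is the \<open>p\<close>-th power of a product of two values,
    so the transform itself is controlled with exponent \<open>2 * p\<close>.\<close>
  proof (rule exI[of _ "2 * p"], intro conjI allI impI)
    show "1 \<le> 2 * p" using p(1) C by argo
    fix d :: real assume d: "0 < d"
    \<comment> \<open>This is \<open>decay_const\<close> with \<open>r0 = d / 4\<close> written out,
      so that it is fixed before \<open>\<sigma>\<close>.\<close>
    define K where "K = 2 powr p * (9 powr C * (4 * real b powr (3 * e) * (1 + (1 + 2 * (1 + M1) / (ka * k)))\<^sup>2
      / (min 1 (d / 4) / (real k + 1)) ^ 4) + 4 * A powr p)"
    have K0: "0 \<le> K" using d by (simp add: K_def)
    show "\<exists>C. \<forall>\<sigma>::(real \<times> real) measure.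
           prob_space \<sigma> \<and> sets \<sigma> = sets borel \<and> uniformly_perfect D \<beta> \<sigma> \<and>
           spt \<sigma> \<subseteq> curveP \<phi> \<and> diameter (spt \<sigma>) \<ge> d \<longrightarrow>
           (\<forall>R\<ge>1. (\<integral>\<^sup>+ \<xi> \<in> ball 0 R. ennreal (cmod (fourier_meas \<sigma> \<xi>) powr (2 * p)) \<partial>lborel)
                \<le> ennreal (C * R powr \<epsilon>))"
    proof (intro exI[of _ K] allI impI, elim conjE)
      fix \<sigma> :: "(real \<times> real) measure" and R :: real
      assume \<sigma>: "prob_space \<sigma>" "sets \<sigma> = sets borel" "uniformly_perfect D \<beta> \<sigma>" "spt \<sigma> \<subseteq> curveP \<phi>" "d \<le> diameter (spt \<sigma>)"
        and R: "1 \<le> R"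
      interpret P: prob_space \<sigma> by (rule \<sigma>(1))
      note [measurable_cong] = \<sigma>(2)
      let ?\<mu> = "distr \<sigma> borel fst"
      have fst_meas [measurable]: "fst \<in> \<sigma> \<rightarrow>\<^sub>M (borel :: real measure)"
        unfolding measurable_cong_sets[OF \<sigma>(2) refl]
        by (intro borel_measurable_continuous_onI continuous_on_fst continuous_on_id)
      interpret M: prob_space ?\<mu> by (rule P.prob_space_distr[OF fst_meas])
      have on_curve: "AE z in \<sigma>. z \<in> curveP \<phi>"
        using emeasure_compl_spt[OF \<sigma>(2)] \<sigma>(4) by (intro AE_I'[of "- spt \<sigma>"]) auto
      have growth: "measure ?\<mu> (ball x \<rho>) \<le> A * (\<rho> / r') powr al * measure ?\<mu> (ball x r')"
        if "x \<in> {-2..2}" "0 < \<rho>" "\<rho> \<le> r'" "r' \<le> d / 4" for x \<rho> r'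
        unfolding A_def
        by (rule uniformly_perfect_growth[OF \<sigma>(1-4) D \<beta>(1) \<beta>' \<sigma>(5) Lip M0 al_def that])
      \<comment> \<open>A reverse doubling condition: it bounds the mass of the dilated ball from
        below only.\<close>
      have doubling: "2 * measure ?\<mu> (ball x \<rho>) \<le> measure ?\<mu> (ball x (D' * \<rho>))"
        if "x \<in> {-2..2}" "0 < \<rho>" "D' * \<rho> \<le> d / 4" for x \<rho>
      proof -
        have "measure ?\<mu> (ball x \<rho>) \<le> A * (\<rho> / (D' * \<rho>)) powr al * measure ?\<mu> (ball x (D' * \<rho>))"
          using that D' by (intro growth) auto
        also have "A * (\<rho> / (D' * \<rho>)) powr al = 1 / 2"
          using that D' A by (simp add: powr_divide D'al)
        finally show ?thesis by simp
      qed
      have cm: "curve_measure ?\<mu> \<phi>" by unfold_locales (simp_all add: \<phi>c)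
      have "growth_measure ?\<mu> \<phi> b A al (d / 4) D' lam g C p"
      proof (intro growth_measure.intro[OF cm] growth_measure_axioms.intro)
        show "0 \<le> A" using A by simp
        show "(1 - lam\<^sup>2 / 8 / (32 * real b)) powr p \<le> 1 / (real b)\<^sup>2" using gain by (simp add: \<eta>_def)
      qed (fact b(1) D' lam_def g(1) g(3) C(1) p(1) edge | (rule growth doubling, assumption+))+
      then interpret growth_measure ?\<mu> \<phi> b A al "d / 4" D' lam g C p .
      interpret convex_curve_measure ?\<mu> \<phi> b A al "d / 4" D' lam g C p \<phi>' k La ka M1 e
      proof unfold_locales
        show "AE x in ?\<mu>. x \<in> {-1..1}"
          using on_curve by (subst AE_distr_iff[OF fst_meas]) (auto simp: curveP_def elim: eventually_mono)
        show "measure ?\<mu> (space ?\<mu>) = 1" by (rule M.prob_space)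
        show "loss * (real b)\<^sup>2 \<le> real b powr (3 * e)" using loss by (simp only: loss_def)
        show "0 < d / 4" using d by simp
        show "ka * \<bar>x - y\<bar> \<le> \<bar>\<phi>' x - \<phi>' y\<bar>" "\<bar>\<phi>' x - \<phi>' y\<bar> \<le> La * \<bar>x - y\<bar>"
          if "x \<in> {-2..2}" "y \<in> {-2..2}" for x y using slope[OF that] by auto
      qed (fact d1 ka k e(1) p2 al | (rule M1, assumption))+
      have fourier: "fourier_meas \<sigma> \<xi> = (LINT x|?\<mu>. wave \<phi> \<xi> x)" for \<xi>
      proof -
        have "(LINT x|?\<mu>. wave \<phi> \<xi> x) = (LINT z|\<sigma>. wave \<phi> \<xi> (fst z))" by (rule integral_distr[OF fst_meas]) simp
        also have "\<dots> = fourier_meas \<sigma> \<xi>" unfolding fourier_meas_def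
        proof (intro integral_cong_AE)
          show "AE z in \<sigma>. wave \<phi> \<xi> (fst z) = cis (- 2 * pi * (z \<bullet> \<xi>))"
            using on_curve by eventually_elim (auto simp: curveP_def wave_def phase_def inner_prod_def)
          show "(\<lambda>z. wave \<phi> \<xi> (fst z)) \<in> borel_measurable \<sigma>" by measurable
          show "(\<lambda>z. cis (- 2 * pi * (z \<bullet> \<xi>))) \<in> borel_measurable \<sigma>" unfolding cis_conv_exp by measurable
        qed
        finally show ?thesis by simp
      qed
      have "(\<integral>\<^sup>+ \<xi>\<in>ball 0 R. ennreal (cmod (fourier_meas \<sigma> \<xi>) powr (2 * p)) \<partial>lborel) \<le> ennreal (decay_const * R powr (7 * e))"
        unfolding fourier by (rule decay[OF R])
      also have "decay_const = K" by (simp add: K_def decay_const_def gap_def slope_bound_def)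
      also have "ennreal (K * R powr (7 * e)) \<le> ennreal (K * R powr \<epsilon>)"
        using K0 R e7 by (intro ennreal_leI mult_left_mono powr_mono)
      finally show "(\<integral>\<^sup>+ \<xi>\<in>ball 0 R. ennreal (cmod (fourier_meas \<sigma> \<xi>) powr (2 * p)) \<partial>lborel) \<le> ennreal (K * R powr \<epsilon>)" .
    qed
  qed
qed

end
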